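(* Let $A$ be a $\mathrm{C}^*$-algebra, let $G\rtimes_\alpha H$ be a semi-direct product of groups, and let $(\{I_{(g,h)}\}_{(g,h)\in G\rtimes_\alpha H},\{\theta_{(g,h)}\}_{(g,h)\in G\rtimes_\alpha H})$ be a partial action $\theta$ of $G\rtimes_\alpha H$ on $A$ such that for every $g\in G$ and $h\in H$, $$I_{(g,h)}\subset I_{(g,e)}\cap I_{(e,h)}.$$ Let $A\rtimes G$ be the partial crossed product of the partial action $(\{I_{(g,e)}\}_{g\in G},\{\theta_{(g,e)}\}_{g\in G})$ of $G$ on $A$ obtained by restricting $\theta$ to the subgroup $G\times\{e\}$. Then there exist a partial action of $H$ on $A\rtimes G$ and a $*$-isomorphism $$\varphi\colon A\rtimes_\theta(G\rtimes_\alpha H)\to(A\rtimes G)\rtimes H$$ such that $\varphi(a\,\delta_{(g,h)})=(a\,\delta_g)\delta_h$ for all $g\in G$, $h\in H$ and $a\in I_{(g,h)}$ (so in particular $a\,\delta_g$ belongs to the ideal of $A\rtimes G$ associated with $h$ by the partial action of $H$).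
   Context: All groups are discrete; $e$ denotes the identity element of any group. For a homomorphism $\alpha:H\to\mathrm{Aut}(G)$, the semi-direct product $G\rtimes_\alpha H$ is the set $G\times H$ with product $(g,h)(g',h')=(g\alpha_h(g'),hh')$. A partial action $\theta$ of a group $\Gamma$ on a $\mathrm{C}^*$-algebra $A$ is a pair $(\{I_s\}_{s\in \Gamma},\{\theta_s\}_{s\in \Gamma})$, where each $I_s$ is a closed two-sided ideal of $A$ and each $\theta_s$ is a $*$-isomorphism from $I_{s^{-1}}$ onto $I_s$, such that: (i) $\theta_e=\mathrm{Id}_A$; (ii) for all $s,t\in \Gamma$ and $x\in I_{s^{-1}}$, if $\theta_s(x)\in I_{t^{-1}}$, then $x\in I_{(ts)^{-1}}$ and $\theta_{ts}(x)=\theta_t(\theta_s(x))$. Partial crossed product: let $A\rtimes_{\theta,\mathrm{alg}}\Gamma$ be the vector space of finitely supported functions $f:\Gamma\to A$ with $f(s)\in I_s$ for all $s$. For $a\in I_s$ let $a\delta_s$ denote the function with value $a$ at $s$ and $0$ elsewhere. It is a $*$-algebra with operations determined by $(a_s\delta_s)(b_t\delta_t)=\theta_s(\theta_{s^{-1}}(a_s)b_t)\delta_{st}$ and $(a_s\delta_s)^*=\theta_{s^{-1}}(a_s^* )\delta_{s^{-1}}$. The partial crossed product $A\rtimes_\theta \Gamma$ (also written $A\rtimes \Gamma$) is the enveloping $\mathrm{C}^*$-algebra of $A\rtimes_{\theta,\mathrm{alg}}\Gamma$ with respect to $\|x\|_{\max}=\sup\{p(x): p \text{ a } \mathrm{C}^*\text{-seminorm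 on } A\rtimes_{\theta,\mathrm{alg}}\Gamma\}$. *)

theory Defs
  imports
    "HOL-Algebra.Module"
    "HOL-Algebra.Bij"
    "HOL-Analysis.Abstract_Metric_Spaces"
begin

section \<open>\<open>C\<^sup>*\<close>-algebras\<close>

definition complex_ring :: "complex ring" where
  "complex_ring = \<lparr>carrier = UNIV, mult = (*), one = 1, zero = 0, add = (+)\<rparr>"

text \<open>Algebras are not required to be unital. The field \<open>one\<close> inherited from \<open>ring\<close> is never
  referred to for a complex algebra; the constructions below set it to \<open>undefined\<close>.\<close>

record 'a star_alg = "(complex, 'a) module" +
  star :: "'a \<Rightarrow> 'a"

record 'a cstar_alg = "'a star_alg" +
  nrm :: "'a \<Rightarrow> real"

locale star_algebra = Module.module complex_ring A for A :: "('a, 'm) star_alg_scheme" (structure) +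
  assumes m_closed: "\<lbrakk>x \<in> carrier A; y \<in> carrier A\<rbrakk> \<Longrightarrow> x \<otimes> y \<in> carrier A"
    and m_assoc: "\<lbrakk>x \<in> carrier A; y \<in> carrier A; z \<in> carrier A\<rbrakk> \<Longrightarrow>
      (x \<otimes> y) \<otimes> z = x \<otimes> (y \<otimes> z)"
    and l_distr: "\<lbrakk>x \<in> carrier A; y \<in> carrier A; z \<in> carrier A\<rbrakk> \<Longrightarrow>
      (x \<oplus> y) \<otimes> z = (x \<otimes> z) \<oplus> (y \<otimes> z)"
    and r_distr: "\<lbrakk>x \<in> carrier A; y \<in> carrier A; z \<in> carrier A\<rbrakk> \<Longrightarrow>
      z \<otimes> (x \<oplus> y) = (z \<otimes> x) \<oplus> (z \<otimes> y)"
    and smult_m_left: "\<lbrakk>x \<in> carrier A; y \<in> carrier A\<rbrakk> \<Longrightarrow> (c \<odot> x) \<otimes> y = c \<odot> (x \<otimes> y)"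
    and smult_m_right: "\<lbrakk>x \<in> carrier A; y \<in> carrier A\<rbrakk> \<Longrightarrow> x \<otimes> (c \<odot> y) = c \<odot> (x \<otimes> y)"
    and star_closed: "x \<in> carrier A \<Longrightarrow> star A x \<in> carrier A"
    and star_star: "x \<in> carrier A \<Longrightarrow> star A (star A x) = x"
    and star_add: "\<lbrakk>x \<in> carrier A; y \<in> carrier A\<rbrakk> \<Longrightarrow> star A (x \<oplus> y) = star A x \<oplus> star A y"
    and star_smult: "x \<in> carrier A \<Longrightarrow> star A (c \<odot> x) = cnj c \<odot> star A x"
    and star_mult: "\<lbrakk>x \<in> carrier A; y \<in> carrier A\<rbrakk> \<Longrightarrow> star A (x \<otimes> y) = star A y \<otimes> star A x"

locale cstar_seminorm =
  fixes A :: "('a, 'm) star_alg_scheme" (structure) and p :: "'a \<Rightarrow> real"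
  assumes nonneg: "x \<in> carrier A \<Longrightarrow> 0 \<le> p x"
    and triangle: "\<lbrakk>x \<in> carrier A; y \<in> carrier A\<rbrakk> \<Longrightarrow> p (x \<oplus> y) \<le> p x + p y"
    and homogeneous: "x \<in> carrier A \<Longrightarrow> p (c \<odot> x) = cmod c * p x"
    and submultiplicative: "\<lbrakk>x \<in> carrier A; y \<in> carrier A\<rbrakk> \<Longrightarrow> p (x \<otimes> y) \<le> p x * p y"
    and star_isometric: "x \<in> carrier A \<Longrightarrow> p (star A x) = p x"
    and cstar_identity: "x \<in> carrier A \<Longrightarrow> p (star A x \<otimes> x) = (p x)\<^sup>2"

text \<open>The locale \<open>Metric_space\<close> constrains the distance also outside the carrier, where it
  is therefore set to \<open>0\<close>.\<close>

definition nrm_dist :: "('a, 'm) cstar_alg_scheme \<Rightarrow> 'a \<Rightarrow> 'a \<Rightarrow> real" where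
  "nrm_dist A x y = (if x \<in> carrier A \<and> y \<in> carrier A then nrm A (x \<ominus>\<^bsub>A\<^esub> y) else 0)"

locale cstar_algebra = star_algebra A + cstar_seminorm A "nrm A"
  for A :: "('a, 'm) cstar_alg_scheme" (structure) +
  assumes definite: "\<lbrakk>x \<in> carrier A; nrm A x = 0\<rbrakk> \<Longrightarrow> x = \<zero>"
    and complete: "Metric_space.mcomplete (carrier A) (nrm_dist A)"

definition closed_two_sided_ideal :: "'a set \<Rightarrow> ('a, 'm) cstar_alg_scheme \<Rightarrow> bool" where
  "closed_two_sided_ideal J A \<longleftrightarrow>
     submodule J complex_ring A \<and>
     (\<forall>a\<in>carrier A. \<forall>x\<in>J. a \<otimes>\<^bsub>A\<^esub> x \<in> J \<and> x \<otimes>\<^bsub>A\<^esub> a \<in> J) \<and>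
     closedin (Metric_space.mtopology (carrier A) (nrm_dist A)) J"

definition star_isomorphism ::
  "('a, 'm) star_alg_scheme \<Rightarrow> ('b, 'n) star_alg_scheme \<Rightarrow> ('a \<Rightarrow> 'b) \<Rightarrow> bool" where
  "star_isomorphism A B \<phi> \<longleftrightarrow>
     bij_betw \<phi> (carrier A) (carrier B) \<and>
     (\<forall>x\<in>carrier A. \<forall>y\<in>carrier A. \<phi> (x \<oplus>\<^bsub>A\<^esub> y) = \<phi> x \<oplus>\<^bsub>B\<^esub> \<phi> y) \<and>
     (\<forall>c. \<forall>x\<in>carrier A. \<phi> (c \<odot>\<^bsub>A\<^esub> x) = c \<odot>\<^bsub>B\<^esub> \<phi> x) \<and>
     (\<forall>x\<in>carrier A. \<forall>y\<in>carrier A. \<phi> (x \<otimes>\<^bsub>A\<^esub> y) = \<phi> x \<otimes>\<^bsub>B\<^esub> \<phi> y) \<and>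
     (\<forall>x\<in>carrier A. \<phi> (star A x) = star B (\<phi> x))"


section \<open>Enveloping \<open>C\<^sup>*\<close>-algebras\<close>

definition max_seminorm :: "('a, 'm) star_alg_scheme \<Rightarrow> 'a \<Rightarrow> real" where
  "max_seminorm B x = Sup {p x | p. cstar_seminorm B p}"

text \<open>The separated completion of \<open>B\<close> with respect to a seminorm \<open>p\<close>: Cauchy sequences modulo
  sequences that tend to zero.\<close>

definition cauchy_seqs :: "('a, 'm) star_alg_scheme \<Rightarrow> ('a \<Rightarrow> real) \<Rightarrow> (nat \<Rightarrow> 'a) set" where
  "cauchy_seqs B p = {X. range X \<subseteq> carrier B \<and>
     (\<forall>\<epsilon>>0. \<exists>N. \<forall>m\<ge>N. \<forall>n\<ge>N. p (X m \<ominus>\<^bsub>B\<^esub> X n) < \<epsilon>)}"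

definition cauchy_rel ::
  "('a, 'm) star_alg_scheme \<Rightarrow> ('a \<Rightarrow> real) \<Rightarrow> ((nat \<Rightarrow> 'a) \<times> (nat \<Rightarrow> 'a)) set" where
  "cauchy_rel B p = {(X, Y). X \<in> cauchy_seqs B p \<and> Y \<in> cauchy_seqs B p \<and>
     (\<lambda>n. p (X n \<ominus>\<^bsub>B\<^esub> Y n)) \<longlonglongrightarrow> 0}"

definition completion ::
  "('a, 'm) star_alg_scheme \<Rightarrow> ('a \<Rightarrow> real) \<Rightarrow> (nat \<Rightarrow> 'a) set cstar_alg" where
  "completion B p =
     \<lparr>carrier = cauchy_seqs B p // cauchy_rel B p,
      mult = (\<lambda>U V. \<Union>X\<in>U. \<Union>Y\<in>V. cauchy_rel B p `` {\<lambda>n. X n \<otimes>\<^bsub>B\<^esub> Y n}),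
      one = undefined,
      zero = cauchy_rel B p `` {\<lambda>n. \<zero>\<^bsub>B\<^esub>},
      add = (\<lambda>U V. \<Union>X\<in>U. \<Union>Y\<in>V. cauchy_rel B p `` {\<lambda>n. X n \<oplus>\<^bsub>B\<^esub> Y n}),
      smult = (\<lambda>c U. \<Union>X\<in>U. cauchy_rel B p `` {\<lambda>n. c \<odot>\<^bsub>B\<^esub> X n}),
      star = (\<lambda>U. \<Union>X\<in>U. cauchy_rel B p `` {\<lambda>n. star B (X n)}),
      nrm = (\<lambda>U. THE r. \<forall>X\<in>U. (\<lambda>n. p (X n)) \<longlonglongrightarrow> r)\<rparr>"

definition enveloping_cstar :: "('a, 'm) star_alg_scheme \<Rightarrow> (nat \<Rightarrow> 'a) set cstar_alg" where
  "enveloping_cstar B = completion B (max_seminorm B)"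

definition to_enveloping :: "('a, 'm) star_alg_scheme \<Rightarrow> 'a \<Rightarrow> (nat \<Rightarrow> 'a) set" where
  "to_enveloping B x = cauchy_rel B (max_seminorm B) `` {\<lambda>n. x}"


section \<open>Partial actions and partial crossed products\<close>

locale partial_action = cstar_algebra A + \<Gamma>: group \<Gamma>
  for A :: "('a, 'm) cstar_alg_scheme"
    and \<Gamma> :: "('s, 'n) monoid_scheme"
    and I :: "'s \<Rightarrow> 'a set"
    and \<theta> :: "'s \<Rightarrow> 'a \<Rightarrow> 'a" +
  assumes ideal: "s \<in> carrier \<Gamma> \<Longrightarrow> closed_two_sided_ideal (I s) A"
    and iso: "s \<in> carrier \<Gamma> \<Longrightarrow>
      star_isomorphism (A\<lparr>carrier := I (inv\<^bsub>\<Gamma>\<^esub> s)\<rparr>) (A\<lparr>carrier := I s\<rparr>) (\<theta> s)"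
    and one_domain: "I \<one>\<^bsub>\<Gamma>\<^esub> = carrier A"
    and one_action: "x \<in> carrier A \<Longrightarrow> \<theta> \<one>\<^bsub>\<Gamma>\<^esub> x = x"
    and mult_domain: "\<lbrakk>s \<in> carrier \<Gamma>; t \<in> carrier \<Gamma>; x \<in> I (inv\<^bsub>\<Gamma>\<^esub> s); \<theta> s x \<in> I (inv\<^bsub>\<Gamma>\<^esub> t)\<rbrakk> \<Longrightarrow>
      x \<in> I (inv\<^bsub>\<Gamma>\<^esub> (t \<otimes>\<^bsub>\<Gamma>\<^esub> s))"
    and mult_action: "\<lbrakk>s \<in> carrier \<Gamma>; t \<in> carrier \<Gamma>; x \<in> I (inv\<^bsub>\<Gamma>\<^esub> s); \<theta> s x \<in> I (inv\<^bsub>\<Gamma>\<^esub> t)\<rbrakk> \<Longrightarrow>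
      \<theta> (t \<otimes>\<^bsub>\<Gamma>\<^esub> s) x = \<theta> t (\<theta> s x)"

text \<open>The product and the involution are the (conjugate-)linear extensions of
  \<open>(a \<delta>\<^sub>s) (b \<delta>\<^sub>t) = \<theta>\<^sub>s (\<theta>\<^bsub>s\<^sup>-\<^sup>1\<^esub> a \<cdot> b) \<delta>\<^bsub>s t\<^esub>\<close> and
  \<open>(a \<delta>\<^sub>s)\<^sup>* = \<theta>\<^bsub>s\<^sup>-\<^sup>1\<^esub> (a\<^sup>*) \<delta>\<^bsub>s\<^sup>-\<^sup>1\<^esub>\<close>: the coefficient of \<open>f g\<close> at \<open>r\<close> collects the terms with
  \<open>s t = r\<close>, that is \<open>t = s\<^sup>-\<^sup>1 r\<close>.  Functions are \<open>0\<close> outside \<open>carrier \<Gamma>\<close>.\<close>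

definition algebraic_crossed_product ::
  "('a, 'm) cstar_alg_scheme \<Rightarrow> ('s, 'n) monoid_scheme \<Rightarrow> ('s \<Rightarrow> 'a set) \<Rightarrow> ('s \<Rightarrow> 'a \<Rightarrow> 'a)
     \<Rightarrow> ('s \<Rightarrow> 'a) star_alg" where
  "algebraic_crossed_product A \<Gamma> I \<theta> =
     \<lparr>carrier = {f. (\<forall>s\<in>carrier \<Gamma>. f s \<in> I s) \<and> (\<forall>s. s \<notin> carrier \<Gamma> \<longrightarrow> f s = \<zero>\<^bsub>A\<^esub>) \<and>
                   finite {s. f s \<noteq> \<zero>\<^bsub>A\<^esub>}},
      mult = (\<lambda>f g r. if r \<in> carrier \<Gamma>
                then \<Oplus>\<^bsub>A\<^esub>s\<in>{s \<in> carrier \<Gamma>. f s \<noteq> \<zero>\<^bsub>A\<^esub>}.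
                       \<theta> s (\<theta> (inv\<^bsub>\<Gamma>\<^esub> s) (f s) \<otimes>\<^bsub>A\<^esub> g (inv\<^bsub>\<Gamma>\<^esub> s \<otimes>\<^bsub>\<Gamma>\<^esub> r))
                else \<zero>\<^bsub>A\<^esub>),
      one = undefined,
      zero = (\<lambda>r. \<zero>\<^bsub>A\<^esub>),
      add = (\<lambda>f g r. f r \<oplus>\<^bsub>A\<^esub> g r),
      smult = (\<lambda>c f r. c \<odot>\<^bsub>A\<^esub> f r),
      star = (\<lambda>f r. if r \<in> carrier \<Gamma> then \<theta> r (star A (f (inv\<^bsub>\<Gamma>\<^esub> r))) else \<zero>\<^bsub>A\<^esub>)\<rparr>"

definition crossed_product ::
  "('a, 'm) cstar_alg_scheme \<Rightarrow> ('s, 'n) monoid_scheme \<Rightarrow> ('s \<Rightarrow> 'a set) \<Rightarrow> ('s \<Rightarrow> 'a \<Rightarrow> 'a)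
     \<Rightarrow> (nat \<Rightarrow> 's \<Rightarrow> 'a) set cstar_alg" where
  "crossed_product A \<Gamma> I \<theta> = enveloping_cstar (algebraic_crossed_product A \<Gamma> I \<theta>)"

text \<open>\<open>cp_delta A \<Gamma> I \<theta> a s\<close> is the image of \<open>a \<delta>\<^sub>s\<close> in the partial crossed product.\<close>

definition cp_delta ::
  "('a, 'm) cstar_alg_scheme \<Rightarrow> ('s, 'n) monoid_scheme \<Rightarrow> ('s \<Rightarrow> 'a set) \<Rightarrow> ('s \<Rightarrow> 'a \<Rightarrow> 'a)
     \<Rightarrow> 'a \<Rightarrow> 's \<Rightarrow> (nat \<Rightarrow> 's \<Rightarrow> 'a) set" where
  "cp_delta A \<Gamma> I \<theta> a s =
     to_enveloping (algebraic_crossed_product A \<Gamma> I \<theta>) (\<lambda>t. if t = s then a else \<zero>\<^bsub>A\<^esub>)"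


section \<open>Semi-direct products of groups\<close>

definition semidirect_product ::
  "('g, 'm) monoid_scheme \<Rightarrow> ('h \<Rightarrow> 'g \<Rightarrow> 'g) \<Rightarrow> ('h, 'n) monoid_scheme \<Rightarrow> ('g \<times> 'h) monoid" where
  "semidirect_product G \<alpha> H =
     \<lparr>carrier = carrier G \<times> carrier H,
      mult = (\<lambda>(g, h) (g', h'). (g \<otimes>\<^bsub>G\<^esub> \<alpha> h g', h \<otimes>\<^bsub>H\<^esub> h')),
      one = (\<one>\<^bsub>G\<^esub>, \<one>\<^bsub>H\<^esub>)\<rparr>"

end

theory Submission
  imports Defs
begin

text \<open>
  Put \<open>K h = I (1, h)\<close>. The hypothesis forces \<open>I (g, h) = I (g, 1) \<inter> K h\<close>, so that \<open>K h\<close> is invariant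
  under \<open>G\<close> and the functions with values in \<open>K h\<close> form a \<open>*\<close>-ideal of the algebraic crossed product
  of \<open>A\<close> by \<open>G\<close>, on which \<open>h\<close> acts by \<open>a \<delta>\<^sub>g \<mapsto> \<theta>\<^bsub>(1,h)\<^esub> a \<delta>\<^bsub>\<alpha> h g\<^esub>\<close>. Every \<open>C\<^sup>*\<close>-seminorm on a
  \<open>*\<close>-ideal of an algebraic crossed product extends to the whole algebra: left multiplication by
  \<open>a \<delta>\<^sub>g\<close> is bounded because a self-adjoint \<open>c\<close> of norm less than \<open>1\<close> is the real part of the unitary
  multiplier \<open>c + \<i> sqrt (1 - c\<^sup>2)\<close>. Hence the algebraic action is isometric for the maximal
  seminorm and passes to the closures of the ideals.

  The map \<open>F \<mapsto> (h \<mapsto> \<Sum>\<^sub>g F (g, h) \<delta>\<^sub>g)\<close> is a \<open>*\<close>-homomorphism of algebraic crossed products with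
  \<open>\<ell>\<^sup>1\<close>-dense image. A \<open>C\<^sup>*\<close>-seminorm \<open>p\<close> on its source satisfies \<open>p (F\<^sup>* F) \<le> \<parallel>F\<^sup>* F\<parallel>\<close> for \<open>F\<close> supported
  over a single \<open>h\<close>, since then \<open>F\<^sup>* F\<close> lies over \<open>G\<close>; it is therefore dominated by the \<open>\<ell>\<^sup>1\<close>-norm and
  extends by density. So the map is isometric for the maximal seminorms and induces the
  isomorphism of the completions.
\<close>

section \<open>Complex \<open>*\<close>-algebras and seminorms\<close>

text \<open>C*-seminorms take the place of representations: no Hilbert space, spectrum or
  unitization occurs, and an expression such as 1 - d is handled as the operator y - d y. Three
  obstacles shape the proof. The seminorm pulled back along the action of h lives on an ideal only,
  while the maximal seminorm is a supremum over seminorms on the whole algebra; without an extension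
  result the ideal might carry C*-seminorms larger than the restricted maximal one. Next, the
  composition law of the action of H speaks of points in the intersection of two closed ideals,
  which has to be recognized as the closure of the intersection of the algebraic ideals; approximate
  units give this. Finally, the comparison map need not be onto, because A \<rtimes> G is completed
  before H enters. Seminorms on its source must therefore be bounded by a norm of the target, and
  that norm measures each fibre over h in A \<rtimes> G, not coefficient by coefficient in
  A.\<close>

lemma complex_ring_simps [simp]:
  "carrier complex_ring = UNIV" "mult complex_ring = (*)" "one complex_ring = 1"
  "zero complex_ring = 0" "add complex_ring = (+)"
  by (simp_all add: complex_ring_def)

lemma cring_complex_ring: "cring complex_ring"
proof (rule cringI)
  show "abelian_group complex_ring"
    by (rule abelian_groupI) (auto intro: exI[of _ "- (x::complex)" for x])
  show "Group.comm_monoid complex_ring"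
    by (rule Group.comm_monoidI) auto
qed (simp add: algebra_simps)

text \<open>Additive inverses are not demanded: \<open>(-1) \<odot> x\<close> is one, by
  distributivity over scalars and \<open>0 \<odot> x = \<zero>\<close>.\<close>

lemma star_algebraI:
  fixes A :: "('a, 'm) star_alg_scheme" (structure)
  assumes "\<And>x y. \<lbrakk>x \<in> carrier A; y \<in> carrier A\<rbrakk> \<Longrightarrow> x \<oplus> y \<in> carrier A"
    and zero: "\<zero> \<in> carrier A"
    and "\<And>x y z. \<lbrakk>x \<in> carrier A; y \<in> carrier A; z \<in> carrier A\<rbrakk> \<Longrightarrow> (x \<oplus> y) \<oplus> z = x \<oplus> (y \<oplus> z)"
    and "\<And>x y. \<lbrakk>x \<in> carrier A; y \<in> carrier A\<rbrakk> \<Longrightarrow> x \<oplus> y = y \<oplus> x"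
    and "\<And>x. x \<in> carrier A \<Longrightarrow> \<zero> \<oplus> x = x"
    and smult_closed: "\<And>c x. x \<in> carrier A \<Longrightarrow> c \<odot> x \<in> carrier A"
    and null: "\<And>x. x \<in> carrier A \<Longrightarrow> 0 \<odot> x = \<zero>"
    and l_distr: "\<And>c d x. x \<in> carrier A \<Longrightarrow> (c + d) \<odot> x = c \<odot> x \<oplus> d \<odot> x"
    and "\<And>c x y. \<lbrakk>x \<in> carrier A; y \<in> carrier A\<rbrakk> \<Longrightarrow> c \<odot> (x \<oplus> y) = c \<odot> x \<oplus> c \<odot> y"
    and "\<And>c d x. x \<in> carrier A \<Longrightarrow> (c * d) \<odot> x = c \<odot> (d \<odot> x)"
    and one: "\<And>x. x \<in> carrier A \<Longrightarrow> 1 \<odot> x = x"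
    and "star_algebra_axioms A"
  shows "star_algebra A"
proof (rule star_algebra.intro[OF moduleI assms(12)])
  show "abelian_group A"
  proof (rule abelian_groupI)
    fix x assume x: "x \<in> carrier A"
    have "(-1) \<odot> x \<oplus> x = \<zero>"
      using l_distr[OF x, of "-1" 1] null[OF x] one[OF x] by simp
    then show "\<exists>y\<in>carrier A. y \<oplus> x = \<zero>" using smult_closed[OF x] by blast
  qed (use assms in auto)
qed (use assms cring_complex_ring in auto)

context star_algebra
begin

lemma sm_closed [simp, intro]: "x \<in> carrier A \<Longrightarrow> c \<odot> x \<in> carrier A"
  using smult_closed by simp

lemma sm_add_l: "x \<in> carrier A \<Longrightarrow> (c + d) \<odot> x = c \<odot> x \<oplus> d \<odot> x"
  using smult_l_distr by simp

lemma sm_add_r: "\<lbrakk>x \<in> carrier A; y \<in> carrier A\<rbrakk> \<Longrightarrow> c \<odot> (x \<oplus> y) = c \<odot> x \<oplus> c \<odot> y"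
  using smult_r_distr by simp

lemma sm_assoc: "x \<in> carrier A \<Longrightarrow> c \<odot> (d \<odot> x) = (c * d) \<odot> x"
  using smult_assoc1 by simp

lemma sm_one [simp]: "x \<in> carrier A \<Longrightarrow> 1 \<odot> x = x"
  using smult_one by simp

lemma sm_zero_l [simp]: "x \<in> carrier A \<Longrightarrow> 0 \<odot> x = \<zero>"
  using smult_l_null by simp

lemma sm_zero_r [simp]: "c \<odot> \<zero> = \<zero>"
  using smult_r_null by simp

lemma neg_sm: "x \<in> carrier A \<Longrightarrow> \<ominus> x = (-1) \<odot> x"
  by (rule M.minus_equality) (use sm_add_l[of x "-1" 1] in auto)

lemma minus_sm: "\<lbrakk>x \<in> carrier A; y \<in> carrier A\<rbrakk> \<Longrightarrow> x \<ominus> y = x \<oplus> (-1) \<odot> y"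
  by (simp add: M.minus_eq neg_sm)

lemma diff_closed [simp, intro]: "\<lbrakk>x \<in> carrier A; y \<in> carrier A\<rbrakk> \<Longrightarrow> x \<ominus> y \<in> carrier A"
  by simp

declare m_closed [simp, intro] and star_closed [simp, intro]

lemma mult_zero_l [simp]: "x \<in> carrier A \<Longrightarrow> \<zero> \<otimes> x = \<zero>"
  using smult_m_left[of "\<zero>" x 0] by simp

lemma mult_zero_r [simp]: "x \<in> carrier A \<Longrightarrow> x \<otimes> \<zero> = \<zero>"
  using smult_m_right[of x "\<zero>" 0] by simp

lemma star_zero [simp]: "star A \<zero> = \<zero>"
  using star_smult[of "\<zero>" 0] by simp

lemma diff_self [simp]: "x \<in> carrier A \<Longrightarrow> x \<ominus> x = \<zero>"
  by (simp add: M.minus_eq M.r_neg)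

lemma diff_zero [simp]: "x \<in> carrier A \<Longrightarrow> x \<ominus> \<zero> = x"
  by (simp add: minus_sm)

lemma minus_plus_cancel: "\<lbrakk>x \<in> carrier A; y \<in> carrier A\<rbrakk> \<Longrightarrow> (x \<ominus> y) \<oplus> y = x"
  by (simp add: M.minus_eq M.a_assoc M.l_neg)

lemma diff_eq_zero: "\<lbrakk>x \<in> carrier A; y \<in> carrier A; x \<ominus> y = \<zero>\<rbrakk> \<Longrightarrow> x = y"
  using minus_plus_cancel[of x y] by simp

lemma diff_swap: "\<lbrakk>x \<in> carrier A; y \<in> carrier A\<rbrakk> \<Longrightarrow> y \<ominus> x = (-1) \<odot> (x \<ominus> y)"
  by (simp add: minus_sm sm_add_r sm_assoc M.a_comm)

lemma diff_diff_add:
  "\<lbrakk>x \<in> carrier A; y \<in> carrier A; z \<in> carrier A\<rbrakk> \<Longrightarrow> x \<ominus> z = (x \<ominus> y) \<oplus> (y \<ominus> z)"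
  by (metis M.a_assoc M.minus_eq minus_plus_cancel diff_closed M.a_inv_closed)

lemma diff_add:
  "\<lbrakk>x \<in> carrier A; y \<in> carrier A; x' \<in> carrier A; y' \<in> carrier A\<rbrakk> \<Longrightarrow>
    (x \<oplus> y) \<ominus> (x' \<oplus> y') = (x \<ominus> x') \<oplus> (y \<ominus> y')"
  by (simp add: minus_sm sm_add_r M.a_ac)

lemma sm_diff: "\<lbrakk>x \<in> carrier A; y \<in> carrier A\<rbrakk> \<Longrightarrow> c \<odot> (x \<ominus> y) = c \<odot> x \<ominus> c \<odot> y"
  by (simp add: minus_sm sm_add_r sm_assoc mult.commute)

lemma mult_diff_r:
  "\<lbrakk>x \<in> carrier A; y \<in> carrier A; z \<in> carrier A\<rbrakk> \<Longrightarrow> x \<otimes> (y \<ominus> z) = x \<otimes> y \<ominus> x \<otimes> z"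
  by (simp add: minus_sm r_distr smult_m_right)

lemma mult_diff_l:
  "\<lbrakk>x \<in> carrier A; y \<in> carrier A; z \<in> carrier A\<rbrakk> \<Longrightarrow> (x \<ominus> y) \<otimes> z = x \<otimes> z \<ominus> y \<otimes> z"
  by (simp add: minus_sm l_distr smult_m_left)

lemma diff_mult:
  "\<lbrakk>x \<in> carrier A; y \<in> carrier A; x' \<in> carrier A; y' \<in> carrier A\<rbrakk> \<Longrightarrow>
    x \<otimes> y \<ominus> x' \<otimes> y' = (x \<ominus> x') \<otimes> y \<oplus> x' \<otimes> (y \<ominus> y')"
  using diff_diff_add[of "x \<otimes> y" "x' \<otimes> y" "x' \<otimes> y'"]
  by (simp add: mult_diff_l mult_diff_r)

lemma star_diff: "\<lbrakk>x \<in> carrier A; y \<in> carrier A\<rbrakk> \<Longrightarrow> star A (x \<ominus> y) = star A x \<ominus> star A y"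
  by (simp add: minus_sm star_add star_smult)

lemma add_diff_cancel:
  "\<lbrakk>x \<in> carrier A; y \<in> carrier A; z \<in> carrier A; x \<oplus> y = z\<rbrakk> \<Longrightarrow> y = z \<ominus> x"
  by (metis M.a_assoc M.a_comm M.a_inv_closed M.minus_eq M.r_neg M.r_zero)

end

text \<open>A *-subalgebra in the purely algebraic sense. It is a predicate on sets because the same
  record with a smaller \<open>carrier\<close> serves for ideals and for domains of partial
  isomorphisms.\<close>

definition star_closed_subset :: "'a set \<Rightarrow> ('a, 'm) star_alg_scheme \<Rightarrow> bool" where
  "star_closed_subset S A \<longleftrightarrow> S \<subseteq> carrier A \<and> \<zero>\<^bsub>A\<^esub> \<in> S \<and>
    (\<forall>x\<in>S. \<forall>y\<in>S. x \<oplus>\<^bsub>A\<^esub> y \<in> S) \<and> (\<forall>c. \<forall>x\<in>S. c \<odot>\<^bsub>A\<^esub> x \<in> S) \<and>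
    (\<forall>x\<in>S. \<forall>y\<in>S. x \<otimes>\<^bsub>A\<^esub> y \<in> S) \<and> (\<forall>x\<in>S. star A x \<in> S)"

lemma (in star_algebra) star_subalgebra:
  assumes "star_closed_subset S A"
  shows "star_algebra (A\<lparr>carrier := S\<rparr>)"
proof -
  have S: "S \<subseteq> carrier A" using assms by (simp add: star_closed_subset_def)
  note in_A [simp] = subsetD[OF S]
  show ?thesis
  proof (rule star_algebraI)
    show "star_algebra_axioms (A\<lparr>carrier := S\<rparr>)"
      using assms unfolding star_algebra_axioms_def star_closed_subset_def
      by (auto simp: m_assoc l_distr r_distr smult_m_left smult_m_right star_star star_add
          star_smult star_mult)
  qed (use assms in \<open>auto simp: star_closed_subset_def M.a_ac sm_add_l sm_add_r sm_assoc\<close>)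
qed

text \<open>Negation in a record is chosen within its carrier, so it could change when the carrier
  shrinks; both differences equal x plus (-1) times y.\<close>

lemma (in star_algebra) diff_sub:
  assumes "star_closed_subset S A" "x \<in> S" "y \<in> S"
  shows "x \<ominus>\<^bsub>A\<lparr>carrier := S\<rparr>\<^esub> y = x \<ominus> y"
proof -
  interpret S: star_algebra "A\<lparr>carrier := S\<rparr>" by (rule star_subalgebra) fact
  have "x \<in> carrier A" "y \<in> carrier A" using assms by (auto simp: star_closed_subset_def)
  then show ?thesis using assms(2,3) by (simp add: minus_sm S.minus_sm)
qed

text \<open>The C*-identity is left out so that the l1-norm of a crossed product, which need not
  satisfy it, is an instance as well.\<close>

locale seminormed_star_algebra = star_algebra A for A :: "('a, 'm) star_alg_scheme" (structure) +
  fixes p :: "'a \<Rightarrow> real"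
  assumes nonneg: "x \<in> carrier A \<Longrightarrow> 0 \<le> p x"
    and triangle: "\<lbrakk>x \<in> carrier A; y \<in> carrier A\<rbrakk> \<Longrightarrow> p (x \<oplus> y) \<le> p x + p y"
    and homogeneous: "x \<in> carrier A \<Longrightarrow> p (c \<odot> x) = cmod c * p x"
    and submultiplicative: "\<lbrakk>x \<in> carrier A; y \<in> carrier A\<rbrakk> \<Longrightarrow> p (x \<otimes> y) \<le> p x * p y"
    and star_isometric: "x \<in> carrier A \<Longrightarrow> p (star A x) = p x"

section \<open>Limits with respect to submultiplicative *-seminorms\<close>

definition slim :: "('a, 'm) star_alg_scheme \<Rightarrow> ('a \<Rightarrow> real) \<Rightarrow> (nat \<Rightarrow> 'a) \<Rightarrow> 'a \<Rightarrow> bool" where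
  "slim A p X x \<longleftrightarrow> range X \<subseteq> carrier A \<and> x \<in> carrier A \<and> (\<lambda>n. p (X n \<ominus>\<^bsub>A\<^esub> x)) \<longlonglongrightarrow> 0"

lemma slim_in: "slim A p X x \<Longrightarrow> X n \<in> carrier A" "slim A p X x \<Longrightarrow> x \<in> carrier A"
  by (auto simp: slim_def)

context seminormed_star_algebra
begin

lemma p_zero [simp]: "p \<zero> = 0"
  using homogeneous[of "\<zero>" 0] by simp

lemma p_diff_comm: "\<lbrakk>x \<in> carrier A; y \<in> carrier A\<rbrakk> \<Longrightarrow> p (x \<ominus> y) = p (y \<ominus> x)"
  by (subst diff_swap) (auto simp: homogeneous)

lemma p_diff_triangle:
  "\<lbrakk>x \<in> carrier A; y \<in> carrier A; z \<in> carrier A\<rbrakk> \<Longrightarrow> p (x \<ominus> z) \<le> p (x \<ominus> y) + p (y \<ominus> z)"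
  by (subst diff_diff_add[of x y z]) (auto intro: triangle)

lemma p_diff_le: "\<lbrakk>x \<in> carrier A; y \<in> carrier A\<rbrakk> \<Longrightarrow> p (x \<ominus> y) \<le> p x + p y"
  using triangle[of x "(-1) \<odot> y"] by (simp add: minus_sm homogeneous)

lemma p_rev_triangle: "\<lbrakk>x \<in> carrier A; y \<in> carrier A\<rbrakk> \<Longrightarrow> \<bar>p x - p y\<bar> \<le> p (x \<ominus> y)"
  using triangle[of "x \<ominus> y" y] triangle[of "y \<ominus> x" x]
  by (simp add: minus_plus_cancel p_diff_comm abs_le_iff)

lemma slim_const: "x \<in> carrier A \<Longrightarrow> slim A p (\<lambda>n. x) x"
  by (auto simp: slim_def)

lemma slim_squeeze:
  assumes "\<And>n. X n \<in> carrier A" "x \<in> carrier A" "\<And>n. p (X n \<ominus> x) \<le> f n" "f \<longlonglongrightarrow> 0"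
  shows "slim A p X x"
  unfolding slim_def
proof (intro conjI)
  show "(\<lambda>n. p (X n \<ominus> x)) \<longlonglongrightarrow> 0"
    by (rule tendsto_sandwich[OF _ _ tendsto_const assms(4)])
      (use assms nonneg in \<open>auto intro!: always_eventually\<close>)
qed (use assms in auto)

lemma slim_p: "slim A p X x \<Longrightarrow> (\<lambda>n. p (X n)) \<longlonglongrightarrow> p x"
proof -
  assume lim: "slim A p X x"
  have "(\<lambda>n. p (X n) - p x) \<longlonglongrightarrow> 0"
  proof (rule Lim_null_comparison)
    show "\<forall>\<^sub>F n in sequentially. norm (p (X n) - p x) \<le> p (X n \<ominus> x)"
      using lim by (auto simp: slim_def p_rev_triangle range_subsetD)
  qed (use lim in \<open>simp add: slim_def\<close>)
  then show ?thesis by (simp add: LIM_zero_iff)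
qed

lemma slim_add:
  assumes "slim A p X x" "slim A p Y y"
  shows "slim A p (\<lambda>n. X n \<oplus> Y n) (x \<oplus> y)"
proof (rule slim_squeeze)
  show "(\<lambda>n. p (X n \<ominus> x) + p (Y n \<ominus> y)) \<longlonglongrightarrow> 0"
    using assms by (auto simp: slim_def intro!: tendsto_add_zero)
qed (use slim_in[OF assms(1)] slim_in[OF assms(2)] in \<open>auto simp: diff_add intro: triangle\<close>)

lemma slim_smult:
  assumes "slim A p X x"
  shows "slim A p (\<lambda>n. c \<odot> X n) (c \<odot> x)"
proof (rule slim_squeeze)
  show "(\<lambda>n. cmod c * p (X n \<ominus> x)) \<longlonglongrightarrow> 0"
    using assms by (auto simp: slim_def intro!: tendsto_mult_right_zero)
qed (use slim_in[OF assms(1)] in \<open>auto simp: sm_diff[symmetric] homogeneous\<close>)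

lemma slim_diff:
  assumes "slim A p X x" "slim A p Y y"
  shows "slim A p (\<lambda>n. X n \<ominus> Y n) (x \<ominus> y)"
  using slim_add[OF assms(1) slim_smult[OF assms(2), of "-1"]] slim_in[OF assms(1)]
    slim_in[OF assms(2)] by (simp add: minus_sm)

lemma slim_star:
  assumes "slim A p X x"
  shows "slim A p (\<lambda>n. star A (X n)) (star A x)"
proof (rule slim_squeeze)
  show "(\<lambda>n. p (X n \<ominus> x)) \<longlonglongrightarrow> 0"
    using assms by (auto simp: slim_def)
qed (use slim_in[OF assms(1)] in \<open>auto simp: star_diff[symmetric] star_isometric\<close>)

lemma slim_mult:
  assumes "slim A p X x" "slim A p Y y"
  shows "slim A p (\<lambda>n. X n \<otimes> Y n) (x \<otimes> y)"
proof (rule slim_squeeze)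
  note [simp] = slim_in[OF assms(1)] slim_in[OF assms(2)]
  have "(\<lambda>n. p (X n \<ominus> x) * p (Y n) + p x * p (Y n \<ominus> y)) \<longlonglongrightarrow> 0 * p y + p x * 0"
    using assms slim_p[OF assms(2)] by (intro tendsto_intros) (auto simp: slim_def)
  then show "(\<lambda>n. p (X n \<ominus> x) * p (Y n) + p x * p (Y n \<ominus> y)) \<longlonglongrightarrow> 0" by simp
  fix n
  show "p (X n \<otimes> Y n \<ominus> x \<otimes> y) \<le> p (X n \<ominus> x) * p (Y n) + p x * p (Y n \<ominus> y)"
    by (subst diff_mult, simp_all)
      (intro order_trans[OF triangle] add_mono submultiplicative; simp)
qed (use slim_in[OF assms(1)] slim_in[OF assms(2)] in auto)

end

lemma (in star_algebra) seminormed_of_cstar_seminorm: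
  "cstar_seminorm A p \<Longrightarrow> seminormed_star_algebra A p"
  by (intro seminormed_star_algebra.intro star_algebra_axioms seminormed_star_algebra_axioms.intro)
    (auto simp: cstar_seminorm_def)

section \<open>\<open>C\<^sup>*\<close>-seminorms and multipliers\<close>

text \<open>If \<open>C\<close>, \<open>E\<close> are commuting self-adjoint multipliers with \<open>C\<^sup>2 + E\<^sup>2 = 1\<close>, then \<open>C \<plusminus> \<i> E\<close> are
  unitary, hence isometric for every \<open>C\<^sup>*\<close>-seminorm.\<close>

lemma (in star_algebra) unitary_multiplier_bound:
  assumes p: "cstar_seminorm A p"
    and C: "\<And>j. j \<in> carrier A \<Longrightarrow> C j \<in> carrier A" and E: "\<And>j. j \<in> carrier A \<Longrightarrow> E j \<in> carrier A"
    and CS: "\<And>j k. \<lbrakk>j \<in> carrier A; k \<in> carrier A\<rbrakk> \<Longrightarrow> star A (C j) \<otimes> k = star A j \<otimes> C k"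
    and ES: "\<And>j k. \<lbrakk>j \<in> carrier A; k \<in> carrier A\<rbrakk> \<Longrightarrow> star A (E j) \<otimes> k = star A j \<otimes> E k"
    and CE: "\<And>j. j \<in> carrier A \<Longrightarrow> C (E j) = E (C j)"
    and CCEE: "\<And>j. j \<in> carrier A \<Longrightarrow> C (C j) \<oplus> E (E j) = j"
    and j: "j \<in> carrier A"
  shows "p (C j) \<le> p j" "p (E j) \<le> p j"
proof -
  interpret p: seminormed_star_algebra A p by (rule seminormed_of_cstar_seminorm[OF p])
  note [simp] = C E j
  \<comment> \<open>The conditions on s hold exactly for \<i> and -\<i>. In the expanded square the
    mixed terms carry the factors -s and s and cancel because C and E commute.\<close>
  have iso: "p (C j \<oplus> s \<odot> E j) = p j" if s: "cnj s = -s" "s * s = -1" for s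
  proof -
    define X where "X = star A j \<otimes> C (E j)"
    have [simp]: "X \<in> carrier A" by (simp add: X_def)
    have s': "cnj s * s = 1" using s by simp
    have "star A (C j \<oplus> s \<odot> E j) \<otimes> (C j \<oplus> s \<odot> E j) =
      (star A j \<otimes> C (C j) \<oplus> (-s) \<odot> X) \<oplus> (s \<odot> X \<oplus> star A j \<otimes> E (E j))"
      using s by (simp add: star_add star_smult l_distr r_distr smult_m_left smult_m_right sm_assoc
          CS ES CE X_def sm_add_r s(2))
    also have "\<dots> = star A j \<otimes> C (C j) \<oplus> star A j \<otimes> E (E j) \<oplus> ((-s) \<odot> X \<oplus> s \<odot> X)"
      by (simp add: M.a_ac)
    also have "\<dots> = star A j \<otimes> j"
      by (simp add: sm_add_l[symmetric] r_distr[symmetric] CCEE)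
    finally have "(p (C j \<oplus> s \<odot> E j))\<^sup>2 = (p j)\<^sup>2"
      using cstar_seminorm.cstar_identity[OF p, of "C j \<oplus> s \<odot> E j"]
        cstar_seminorm.cstar_identity[OF p, of j] by simp
    then show ?thesis by (simp add: p.nonneg)
  qed
  define u where "u = C j \<oplus> \<i> \<odot> E j"
  define v where "v = C j \<oplus> (-\<i>) \<odot> E j"
  have [simp]: "u \<in> carrier A" "v \<in> carrier A" by (auto simp: u_def v_def)
  have uv: "p u = p j" "p v = p j" using iso[of \<i>] iso[of "-\<i>"] by (simp_all add: u_def v_def)
  \<comment> \<open>C j and E j are recovered as (u + v) / 2 and (u - v) / (2 \<i>), where u and v
    both have seminorm \<open>p j\<close>.\<close>
  have "u \<oplus> v = C j \<oplus> C j \<oplus> (\<i> \<odot> E j \<oplus> (-\<i>) \<odot> E j)"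
    by (simp add: u_def v_def M.a_ac)
  also have "\<dots> = 2 \<odot> C j"
    using sm_add_l[of "C j" 1 1] by (simp add: sm_add_l[symmetric])
  finally have "2 * p (C j) \<le> p u + p v"
    using p.triangle[of u v] by (simp add: p.homogeneous)
  then show "p (C j) \<le> p j" by (simp add: uv)
  have "u \<ominus> v = (C j \<ominus> C j) \<oplus> (\<i> \<odot> E j \<oplus> \<i> \<odot> E j)"
    using diff_add[of "C j" "\<i> \<odot> E j" "C j" "(-\<i>) \<odot> E j"] minus_sm[of "\<i> \<odot> E j" "(-\<i>) \<odot> E j"]
    by (simp add: u_def v_def sm_assoc del: diff_self)
  also have "\<dots> = (2 * \<i>) \<odot> E j"
    using sm_add_l[of "E j" \<i> \<i>] by simp
  finally have "2 * p (E j) \<le> p u + p v"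
    using p.p_diff_le[of u v] by (simp add: p.homogeneous norm_mult)
  then show "p (E j) \<le> p j" by (simp add: uv)
qed

text \<open>The relation \<open>d \<oplus> d = c \<otimes> c \<oplus> d \<otimes> d\<close> says c^2
  + (1 - d)^2 = 1 without mentioning a unit, so left multiplications by c and by 1 - d form a pair
  as in \<open>unitary_multiplier_bound\<close>. Only their action on J matters; p need not be a
  seminorm outside J.\<close>

lemma (in star_algebra) sqrt_multiplier_bound:
  assumes J: "star_closed_subset J A"
    and p: "cstar_seminorm (A\<lparr>carrier := J\<rparr>) p"
    and c [simp]: "c \<in> carrier A" and d [simp]: "d \<in> carrier A"
    and cJ: "\<And>j. j \<in> J \<Longrightarrow> c \<otimes> j \<in> J" and dJ: "\<And>j. j \<in> J \<Longrightarrow> d \<otimes> j \<in> J"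
    and sc: "star A c = c" and sd: "star A d = d" and cd: "c \<otimes> d = d \<otimes> c"
    and sqrt: "d \<oplus> d = c \<otimes> c \<oplus> d \<otimes> d"
    and j: "j \<in> J"
  shows "p (c \<otimes> j) \<le> p j" "p (j \<ominus> d \<otimes> j) \<le> p j"
proof -
  interpret S: star_algebra "A\<lparr>carrier := J\<rparr>" by (rule star_subalgebra[OF J])
  have JA [simp]: "\<And>j. j \<in> J \<Longrightarrow> j \<in> carrier A"
    using J by (auto simp: star_closed_subset_def)
  have minus: "j \<oplus> (-1) \<odot> (d \<otimes> j) \<in> J" if "j \<in> J" for j
    using that J dJ[OF that] by (auto simp: star_closed_subset_def)
  let ?C = "\<lambda>j. c \<otimes> j"
  let ?E = "\<lambda>j. j \<oplus> (-1) \<odot> (d \<otimes> j)"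
  have CCEE: "?C (?C j) \<oplus> ?E (?E j) = j" if "j \<in> J" for j
  proof -
    define x where "x = d \<otimes> j"
    have [simp]: "j \<in> carrier A" "x \<in> carrier A" using that by (auto simp: x_def)
    have ccj: "c \<otimes> (c \<otimes> j) \<oplus> d \<otimes> x = x \<oplus> x"
      using arg_cong[OF sqrt, of "\<lambda>z. z \<otimes> j"] by (simp add: l_distr m_assoc x_def)
    have "?C (?C j) \<oplus> ?E (?E j) =
      (c \<otimes> (c \<otimes> j) \<oplus> d \<otimes> x) \<oplus> (j \<oplus> ((-1) \<odot> x \<oplus> (-1) \<odot> x))"
      by (simp add: x_def[symmetric] r_distr smult_m_right sm_add_r sm_assoc M.a_ac)
    also have "\<dots> = j \<oplus> ((x \<oplus> (-1) \<odot> x) \<oplus> (x \<oplus> (-1) \<odot> x))"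
      unfolding ccj by (simp add: M.a_ac)
    also have "\<dots> = j" using minus_sm[of x x] by simp
    finally show ?thesis .
  qed
  have cdj: "c \<otimes> (d \<otimes> j) = d \<otimes> (c \<otimes> j)" if "j \<in> J" for j
    using that cd by (simp add: m_assoc[symmetric])
  have "p (?C j) \<le> p j" "p (?E j) \<le> p j"
    by (rule S.unitary_multiplier_bound[OF p, of ?C ?E j], simp_all add: cJ minus j CCEE,
       simp_all add: star_add star_smult star_mult sc sd l_distr r_distr m_assoc smult_m_left
         smult_m_right cdj)+
  then show "p (c \<otimes> j) \<le> p j" "p (j \<ominus> d \<otimes> j) \<le> p j"
    using j by (simp_all add: minus_sm)
qed

text \<open>Definiteness without completeness: enough for uniqueness of limits, and the setting in
  which completions and closed ideals are placed before they are known to be complete.\<close>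

locale pre_cstar_algebra = star_algebra A + cstar_seminorm A "nrm A"
  for A :: "('a, 'm) cstar_alg_scheme" (structure) +
  assumes definite: "\<lbrakk>x \<in> carrier A; nrm A x = 0\<rbrakk> \<Longrightarrow> x = \<zero>"

sublocale pre_cstar_algebra \<subseteq> N: seminormed_star_algebra A "nrm A"
  by (rule seminormed_of_cstar_seminorm) (rule cstar_seminorm_axioms)

context pre_cstar_algebra
begin

lemma Metric_space_nrm: "Metric_space (carrier A) (nrm_dist A)"
proof (rule Metric_space.intro)
  show "0 \<le> nrm_dist A x y" for x y by (simp add: nrm_dist_def N.nonneg)
  show "nrm_dist A x y = nrm_dist A y x" for x y by (simp add: nrm_dist_def N.p_diff_comm)
  show "nrm_dist A x y = 0 \<longleftrightarrow> x = y" if "x \<in> carrier A" "y \<in> carrier A" for x y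
    using that definite[of "x \<ominus> y"] diff_eq_zero[of x y] by (auto simp: nrm_dist_def)
  show "nrm_dist A x z \<le> nrm_dist A x y + nrm_dist A y z"
    if "x \<in> carrier A" "y \<in> carrier A" "z \<in> carrier A" for x y z
    using that by (simp add: nrm_dist_def N.p_diff_triangle)
qed

text \<open>A topological limit allows finitely many terms outside the carrier, \<open>slim\<close>
  none; this is the reason for the condition on the range.\<close>

lemma limitin_slim:
  "limitin (Metric_space.mtopology (carrier A) (nrm_dist A)) X x sequentially \<and> range X \<subseteq> carrier A
    \<longleftrightarrow> slim A (nrm A) X x"
proof -
  interpret Metric_space "carrier A" "nrm_dist A" by (rule Metric_space_nrm)
  show ?thesis
    unfolding limitin_metric_dist_null slim_def
    by (auto simp: nrm_dist_def range_subsetD cong: conj_cong)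
qed

lemma slim_unique: "\<lbrakk>slim A (nrm A) X x; slim A (nrm A) X y\<rbrakk> \<Longrightarrow> x = y"
  using N.slim_p[OF N.slim_diff[of X x X y]] definite[of "x \<ominus> y"] diff_eq_zero[of x y]
  by (auto simp: slim_def range_subsetD LIMSEQ_const_iff)

lemma slim_cauchy: "slim A (nrm A) X x \<Longrightarrow> X \<in> cauchy_seqs A (nrm A)"
  unfolding cauchy_seqs_def
proof (intro CollectI conjI allI impI)
  assume X: "slim A (nrm A) X x"
  note [simp] = slim_in[OF X]
  show "range X \<subseteq> carrier A" by auto
  fix e :: real assume "0 < e"
  then have "\<forall>\<^sub>F n in sequentially. nrm A (X n \<ominus> x) < e / 2"
    using X by (auto simp: slim_def dest: order_tendstoD(2)[of _ _ _ "e / 2"])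
  then obtain M where M: "\<And>n. n \<ge> M \<Longrightarrow> nrm A (X n \<ominus> x) < e / 2"
    by (auto simp: eventually_sequentially)
  have "nrm A (X m \<ominus> X n) < e" if "m \<ge> M" "n \<ge> M" for m n
    using N.p_diff_triangle[of "X m" x "X n"] N.p_diff_comm[of x "X n"] M[OF that(1)] M[OF that(2)]
    by simp
  then show "\<exists>N. \<forall>m\<ge>N. \<forall>n\<ge>N. nrm A (X m \<ominus> X n) < e" by blast
qed

lemma cstar_algebraI:
  assumes "\<And>X. X \<in> cauchy_seqs A (nrm A) \<Longrightarrow> \<exists>x. slim A (nrm A) X x"
  shows "cstar_algebra A"
proof -
  interpret Metric_space "carrier A" "nrm_dist A" by (rule Metric_space_nrm)
  have "\<exists>x. limitin mtopology X x sequentially" if X: "MCauchy X" for X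
  proof -
    have "X n \<in> carrier A" for n using X by (auto simp: MCauchy_def)
    then have "X \<in> cauchy_seqs A (nrm A)"
      using X unfolding MCauchy_def cauchy_seqs_def by (auto simp: nrm_dist_def)
    then show ?thesis using assms limitin_slim by blast
  qed
  then have "mcomplete" by (simp add: mcomplete_def)
  then show ?thesis
    by (intro cstar_algebra.intro star_algebra_axioms cstar_seminorm_axioms
        cstar_algebra_axioms.intro definite)
qed

end

sublocale cstar_algebra \<subseteq> P?: pre_cstar_algebra A
  by (intro pre_cstar_algebra.intro star_algebra_axioms cstar_seminorm_axioms
      pre_cstar_algebra_axioms.intro definite)

context cstar_algebra
begin

lemma cauchy_slim:
  assumes "X \<in> cauchy_seqs A (nrm A)"
  obtains x where "slim A (nrm A) X x"
proof -
  interpret Metric_space "carrier A" "nrm_dist A" by (rule P.Metric_space_nrm)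
  have X: "range X \<subseteq> carrier A" using assms by (simp add: cauchy_seqs_def)
  then have "X n \<in> carrier A" for n by auto
  then have "MCauchy X"
    using assms unfolding MCauchy_def cauchy_seqs_def by (auto simp: nrm_dist_def)
  then obtain x where "limitin mtopology X x sequentially"
    using complete unfolding mcomplete_def by blast
  then show thesis using that P.limitin_slim X by blast
qed

text \<open>The element \<open>d = 1 - sqrt (1 - c\<^sup>2)\<close>, obtained as the fixed point of the contraction
  \<open>d \<mapsto> (c\<^sup>2 + d\<^sup>2) / 2\<close>; this form avoids a unit.\<close>

lemma exists_sqrt_complement:
  assumes c [simp]: "c \<in> carrier A" and sc: "star A c = c" and lt: "nrm A c < 1"
  obtains d where "d \<in> carrier A" "star A d = d" "c \<otimes> d = d \<otimes> c"
    "d \<oplus> d = c \<otimes> c \<oplus> d \<otimes> d"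
proof -
  define b where "b = c \<otimes> c"
  define r where "r = nrm A b"
  have [simp]: "b \<in> carrier A" by (simp add: b_def)
  have r: "0 \<le> r" "r < 1"
  proof -
    have "r \<le> nrm A c * nrm A c" by (simp add: r_def b_def N.submultiplicative)
    also have "\<dots> \<le> nrm A c * 1" using lt by (intro mult_left_mono) (auto simp: N.nonneg)
    finally show "r < 1" using lt by simp
  qed (simp add: r_def N.nonneg)
  define F where "F = (\<lambda>d. (1/2) \<odot> (b \<oplus> d \<otimes> d))"
  define D where "D = (\<lambda>n. (F ^^ n) \<zero>)"
  have DS: "D (Suc n) = F (D n)" for n by (simp add: D_def)
  \<comment> \<open>The bound r survives one step because (r + r * r) / 2 \<le> r, and on the ball
    of radius r the map F contracts distances by the factor r.\<close>
  have inv: "D n \<in> carrier A \<and> star A (D n) = D n \<and> c \<otimes> D n = D n \<otimes> c \<and> nrm A (D n) \<le> r" for n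
  proof (induction n)
    case 0 then show ?case using r by (simp add: D_def)
  next
    case (Suc n)
    note IH = Suc.IH and [simp] = conjunct1[OF Suc.IH]
    have "nrm A (D n \<otimes> D n) \<le> r * r"
      using N.submultiplicative[of "D n" "D n"] mult_mono[of "nrm A (D n)" r "nrm A (D n)" r] IH r
      by (simp add: N.nonneg)
    also have "\<dots> \<le> r" using r by (simp add: mult_left_le_one_le)
    finally have "nrm A (D (Suc n)) \<le> r"
      using N.triangle[of b "D n \<otimes> D n"] by (simp add: DS F_def N.homogeneous r_def)
    moreover have "c \<otimes> (D n \<otimes> D n) = D n \<otimes> D n \<otimes> c"
      by (metis IH c m_assoc)
    ultimately show ?case using IH
      by (simp add: DS F_def star_smult star_add star_mult b_def sc smult_m_left smult_m_right
          r_distr l_distr m_assoc)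
  qed
  have DA [simp]: "D n \<in> carrier A" for n using inv by blast
  have step: "nrm A (D (Suc (Suc n)) \<ominus> D (Suc n)) \<le> r * nrm A (D (Suc n) \<ominus> D n)" for n
  proof -
    define x y where "x = D (Suc n)" and "y = D n"
    have [simp]: "x \<in> carrier A" "y \<in> carrier A" and le: "nrm A x \<le> r" "nrm A y \<le> r"
      using inv by (auto simp: x_def y_def)
    have "D (Suc (Suc n)) \<ominus> D (Suc n) = F x \<ominus> F y"
      by (simp add: x_def y_def DS)
    also have "\<dots> = (1/2) \<odot> (x \<otimes> x \<ominus> y \<otimes> y)"
      by (simp add: F_def sm_diff[symmetric] diff_add)
    also have "nrm A \<dots> = nrm A ((x \<ominus> y) \<otimes> x \<oplus> y \<otimes> (x \<ominus> y)) / 2"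
      by (subst diff_mult) (simp_all add: N.homogeneous)
    also have "\<dots> \<le> (nrm A (x \<ominus> y) * r + r * nrm A (x \<ominus> y)) / 2"
    proof -
      have "nrm A ((x \<ominus> y) \<otimes> x) \<le> nrm A (x \<ominus> y) * r"
        by (rule order_trans[OF N.submultiplicative mult_left_mono]) (auto simp: le N.nonneg)
      moreover have "nrm A (y \<otimes> (x \<ominus> y)) \<le> r * nrm A (x \<ominus> y)"
        by (rule order_trans[OF N.submultiplicative mult_right_mono]) (auto simp: le N.nonneg)
      ultimately show ?thesis
        using N.triangle[of "(x \<ominus> y) \<otimes> x" "y \<otimes> (x \<ominus> y)"]
        by (simp add: mult.commute)
    qed
    finally have "nrm A (D (Suc (Suc n)) \<ominus> D (Suc n)) \<le> r * nrm A (x \<ominus> y)"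
      by (simp add: algebra_simps)
    then show ?thesis by (simp add: x_def y_def)
  qed
  have geo: "nrm A (D (Suc n) \<ominus> D n) \<le> r ^ n * r" for n
  proof (induction n)
    case 0
    have "D 0 = \<zero>" by (simp add: D_def)
    then show ?case using inv[of 1] by simp
  next
    case (Suc n)
    show ?case using order_trans[OF step mult_left_mono[OF Suc.IH r(1)]] by (simp add: mult.assoc)
  qed
  \<comment> \<open>The right-hand side is the sum of \<open>r ^ (n + i) * r\<close> over i <
    k.\<close>
  have tail: "nrm A (D (n + k) \<ominus> D n) \<le> r ^ n * r / (1 - r) * (1 - r ^ k)" for n k
  proof (induction k)
    case 0 then show ?case by simp
  next
    case (Suc k)
    have "nrm A (D (n + Suc k) \<ominus> D n) \<le> r ^ (n + k) * r + r ^ n * r / (1 - r) * (1 - r ^ k)"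
      using N.p_diff_triangle[of "D (n + Suc k)" "D (n + k)" "D n"] geo[of "n + k"] Suc.IH by simp
    also have "\<dots> = r ^ n * r / (1 - r) * (1 - r ^ Suc k)"
      using r by (simp add: field_simps power_add)
    finally show ?case .
  qed
  have cau: "D \<in> cauchy_seqs A (nrm A)"
    unfolding cauchy_seqs_def
  proof (intro CollectI conjI allI impI)
    fix e :: real assume e: "e > 0"
    have "(\<lambda>n. r ^ n * r / (1 - r)) \<longlonglongrightarrow> 0 * r / (1 - r)"
      using r by (intro tendsto_intros LIMSEQ_realpow_zero) auto
    then have "\<forall>\<^sub>F n in sequentially. r ^ n * r / (1 - r) < e / 2"
      using e by (intro order_tendstoD(2)[of _ "0 * r / (1 - r)"]) auto
    then obtain M where M: "r ^ M * r / (1 - r) < e / 2" by (auto simp: eventually_sequentially)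
    have *: "nrm A (D m \<ominus> D M) < e / 2" if "m \<ge> M" for m
    proof -
      have "r ^ M * r / (1 - r) * (1 - r ^ (m - M)) \<le> r ^ M * r / (1 - r) * 1"
        using r by (intro mult_left_mono) auto
      then show ?thesis using tail[of M "m - M"] M that by simp
    qed
    have "nrm A (D m \<ominus> D n) < e" if "m \<ge> M" "n \<ge> M" for m n
      using N.p_diff_triangle[of "D m" "D M" "D n"] N.p_diff_comm[of "D M" "D n"] *[OF that(1)] *[OF that(2)]
      by simp
    then show "\<exists>N. \<forall>m\<ge>N. \<forall>n\<ge>N. nrm A (D m \<ominus> D n) < e" by blast
  qed auto
  then obtain d where d: "slim A (nrm A) D d" by (rule cauchy_slim)
  note [simp] = slim_in[OF d]
  have "slim A (nrm A) (\<lambda>n. D (Suc n)) d"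
    using d by (auto simp: slim_def intro: LIMSEQ_Suc[of "\<lambda>n. nrm A (D n \<ominus> d)"])
  moreover have "slim A (nrm A) (\<lambda>n. D (Suc n)) (F d)"
    unfolding DS F_def by (intro N.slim_smult N.slim_add N.slim_mult N.slim_const d) simp
  ultimately have "d = F d" by (rule P.slim_unique)
  then have "2 \<odot> d = 2 \<odot> F d" by simp
  then have "d \<oplus> d = b \<oplus> d \<otimes> d"
    using sm_add_l[of d 1 1] by (simp add: F_def sm_assoc)
  moreover have "star A d = d"
    using N.slim_star[OF d] inv d by (intro P.slim_unique[of D]) auto
  moreover have "c \<otimes> d = d \<otimes> c"
  proof (rule P.slim_unique)
    show "slim A (nrm A) (\<lambda>n. c \<otimes> D n) (c \<otimes> d)"
      by (intro N.slim_mult N.slim_const d) simp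
    show "slim A (nrm A) (\<lambda>n. c \<otimes> D n) (d \<otimes> c)"
      using N.slim_mult[OF d N.slim_const[OF c]] inv by simp
  qed
  ultimately show thesis using that[of d] by (simp add: b_def)
qed

end

section \<open>*-homomorphisms and domination of C*-seminorms by the norm\<close>

definition star_hom :: "('a, 'm) star_alg_scheme \<Rightarrow> ('b, 'n) star_alg_scheme \<Rightarrow> ('a \<Rightarrow> 'b) \<Rightarrow> bool" where
  "star_hom A B \<phi> \<longleftrightarrow> \<phi> ` carrier A \<subseteq> carrier B \<and>
     (\<forall>x\<in>carrier A. \<forall>y\<in>carrier A. \<phi> (x \<oplus>\<^bsub>A\<^esub> y) = \<phi> x \<oplus>\<^bsub>B\<^esub> \<phi> y) \<and>
     (\<forall>c. \<forall>x\<in>carrier A. \<phi> (c \<odot>\<^bsub>A\<^esub> x) = c \<odot>\<^bsub>B\<^esub> \<phi> x) \<and>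
     (\<forall>x\<in>carrier A. \<forall>y\<in>carrier A. \<phi> (x \<otimes>\<^bsub>A\<^esub> y) = \<phi> x \<otimes>\<^bsub>B\<^esub> \<phi> y) \<and>
     (\<forall>x\<in>carrier A. \<phi> (star A x) = star B (\<phi> x))"

lemma star_homD:
  assumes "star_hom A B \<phi>"
  shows "x \<in> carrier A \<Longrightarrow> \<phi> x \<in> carrier B"
    and "\<lbrakk>x \<in> carrier A; y \<in> carrier A\<rbrakk> \<Longrightarrow> \<phi> (x \<oplus>\<^bsub>A\<^esub> y) = \<phi> x \<oplus>\<^bsub>B\<^esub> \<phi> y"
    and "x \<in> carrier A \<Longrightarrow> \<phi> (c \<odot>\<^bsub>A\<^esub> x) = c \<odot>\<^bsub>B\<^esub> \<phi> x"
    and "\<lbrakk>x \<in> carrier A; y \<in> carrier A\<rbrakk> \<Longrightarrow> \<phi> (x \<otimes>\<^bsub>A\<^esub> y) = \<phi> x \<otimes>\<^bsub>B\<^esub> \<phi> y"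
    and "x \<in> carrier A \<Longrightarrow> \<phi> (star A x) = star B (\<phi> x)"
  using assms by (auto simp: star_hom_def)

lemma star_hom_zero:
  assumes "star_algebra A" "star_algebra B" "star_hom A B \<phi>"
  shows "\<phi> \<zero>\<^bsub>A\<^esub> = \<zero>\<^bsub>B\<^esub>"
proof -
  interpret A: star_algebra A by fact
  interpret B: star_algebra B by fact
  show ?thesis
    using star_homD(1)[OF assms(3), of "\<zero>\<^bsub>A\<^esub>"] star_homD(3)[OF assms(3), of "\<zero>\<^bsub>A\<^esub>" 0] by simp
qed

lemma star_hom_diff:
  assumes "star_algebra A" "star_algebra B" "star_hom A B \<phi>" "x \<in> carrier A" "y \<in> carrier A"
  shows "\<phi> (x \<ominus>\<^bsub>A\<^esub> y) = \<phi> x \<ominus>\<^bsub>B\<^esub> \<phi> y"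
proof -
  interpret A: star_algebra A by fact
  interpret B: star_algebra B by fact
  show ?thesis
    using assms(4,5) by (simp add: star_homD[OF assms(3)] A.minus_sm B.minus_sm)
qed

lemma cstar_seminorm_pullback:
  assumes "star_algebra A" "star_hom A B \<phi>" "cstar_seminorm B p"
  shows "cstar_seminorm A (\<lambda>x. p (\<phi> x))"
proof -
  interpret A: star_algebra A by fact
  interpret p: cstar_seminorm B p by fact
  note [simp] = star_homD[OF assms(2)]
  show ?thesis
    by unfold_locales (auto simp: p.nonneg p.triangle p.homogeneous p.submultiplicative
        p.star_isometric p.cstar_identity A.M.a_closed)
qed

context cstar_algebra
begin

text \<open>The complement d of c / r exists in A because A is complete; its defining equation is
  then carried into B by \<iota>, although B has no norm and \<iota> c may act on J without lying in
  it. The strict bound by r is what gives c / r norm less than 1.\<close>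

lemma selfadjoint_multiplier_bound:
  assumes B: "star_algebra B" and J: "star_closed_subset J B"
    and p: "cstar_seminorm (B\<lparr>carrier := J\<rparr>) p" and hom: "star_hom A B \<iota>"
    and \<iota>J: "\<And>a j. \<lbrakk>a \<in> carrier A; j \<in> J\<rbrakk> \<Longrightarrow> \<iota> a \<otimes>\<^bsub>B\<^esub> j \<in> J"
    and c: "c \<in> carrier A" "star A c = c" and r: "nrm A c < r" and j: "j \<in> J"
  shows "p (\<iota> c \<otimes>\<^bsub>B\<^esub> j) \<le> r * p j"
proof -
  interpret B: star_algebra B by fact
  interpret p: cstar_seminorm "B\<lparr>carrier := J\<rparr>" p by fact
  note [simp] = star_homD[OF hom] c
  have r0: "r > 0" using N.nonneg[OF c(1)] r by linarith
  have jB [simp]: "j \<in> carrier B" using J j by (auto simp: star_closed_subset_def)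
  define c' where "c' = complex_of_real (1 / r) \<odot> c"
  have c': "c' \<in> carrier A" "star A c' = c'" "nrm A c' < 1"
    using r r0 by (auto simp: c'_def star_smult N.homogeneous norm_divide)
  obtain d where d: "d \<in> carrier A" "star A d = d" "c' \<otimes> d = d \<otimes> c'"
    "d \<oplus> d = c' \<otimes> c' \<oplus> d \<otimes> d"
    using exists_sqrt_complement[OF c'] by blast
  have "p (\<iota> c' \<otimes>\<^bsub>B\<^esub> j) \<le> p j"
  proof (rule B.sqrt_multiplier_bound(1)[OF J p, of _ "\<iota> d"])
    show "star B (\<iota> c') = \<iota> c'" "star B (\<iota> d) = \<iota> d"
      by (metis c' d star_homD(5)[OF hom])+
    show "\<iota> c' \<otimes>\<^bsub>B\<^esub> \<iota> d = \<iota> d \<otimes>\<^bsub>B\<^esub> \<iota> c'"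
      by (metis c' d star_homD(4)[OF hom])
    show "\<iota> d \<oplus>\<^bsub>B\<^esub> \<iota> d = \<iota> c' \<otimes>\<^bsub>B\<^esub> \<iota> c' \<oplus>\<^bsub>B\<^esub> \<iota> d \<otimes>\<^bsub>B\<^esub> \<iota> d"
      using arg_cong[OF d(4), of \<iota>] c'(1) d(1) by simp
  qed (use c' d j in \<open>simp_all add: \<iota>J\<close>)
  moreover have "\<iota> c' \<otimes>\<^bsub>B\<^esub> j = complex_of_real (1 / r) \<odot>\<^bsub>B\<^esub> (\<iota> c \<otimes>\<^bsub>B\<^esub> j)"
    by (simp add: c'_def B.smult_m_left)
  moreover have "p (complex_of_real (1 / r) \<odot>\<^bsub>B\<^esub> (\<iota> c \<otimes>\<^bsub>B\<^esub> j)) = p (\<iota> c \<otimes>\<^bsub>B\<^esub> j) / r"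
    using p.homogeneous[of "\<iota> c \<otimes>\<^bsub>B\<^esub> j" "complex_of_real (1 / r)"] \<iota>J[OF c(1) j] r0 by (simp add: norm_divide)
  ultimately have "p (\<iota> c \<otimes>\<^bsub>B\<^esub> j) / r \<le> p j" by simp
  then show ?thesis using r0 by (simp add: divide_le_eq mult.commute)
qed

text \<open>A substitute for the spectral radius argument: for self-adjoint c and every r above its
  norm, multiplication by c has p-bound r, hence p(c)^2 = p(c c) \<le> r p(c). The general case
  follows by applying this to \<open>star A x \<otimes> x\<close>.\<close>

lemma cstar_seminorm_le_norm:
  assumes p: "cstar_seminorm A p" and x: "x \<in> carrier A"
  shows "p x \<le> nrm A x"
proof -
  interpret p: cstar_seminorm A p by fact
  have sa: "p c \<le> nrm A c" if c: "c \<in> carrier A" "star A c = c" for c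
  proof (rule dense_ge)
    fix r assume r: "nrm A c < r"
    have "p (c \<otimes> c) \<le> r * p c"
    proof (rule selfadjoint_multiplier_bound[OF star_algebra_axioms, of "carrier A" p "\<lambda>x. x"])
      show "star_closed_subset (carrier A) A" by (auto simp: star_closed_subset_def)
      show "star_hom A A (\<lambda>x. x)" by (auto simp: star_hom_def)
      show "cstar_seminorm (A\<lparr>carrier := carrier A\<rparr>) p" using p by simp
    qed (use c r in auto)
    then have "p c * p c \<le> r * p c"
      using p.cstar_identity[OF c(1)] c by (simp add: power2_eq_square)
    moreover have "r > 0" using N.nonneg[OF c(1)] r by linarith
    ultimately show "p c \<le> r" using p.nonneg[OF c(1)] by (cases "p c = 0") auto
  qed
  have "(p x)\<^sup>2 \<le> (nrm A x)\<^sup>2"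
    using sa[of "star A x \<otimes> x"] x by (simp add: star_mult star_star p.cstar_identity cstar_identity)
  then show ?thesis by (rule power2_le_imp_le) (simp add: N.nonneg x)
qed

text \<open>Since 1 - b^2 = (1 - d)^2 for the complement d of b, the operator is the square of a
  contraction. Positivity of b^2 enters only through this square root.\<close>

lemma selfadjoint_complement_bound:
  assumes b: "b \<in> carrier A" "star A b = b" "nrm A b < 1" and y: "y \<in> carrier A"
  shows "nrm A (y \<ominus> (b \<otimes> b) \<otimes> y) \<le> nrm A y"
proof -
  obtain d where d: "d \<in> carrier A" "star A d = d" "b \<otimes> d = d \<otimes> b"
    "d \<oplus> d = b \<otimes> b \<oplus> d \<otimes> d"
    using exists_sqrt_complement[OF b] by blast
  have E: "nrm A (y \<ominus> d \<otimes> y) \<le> nrm A y" if "y \<in> carrier A" for y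
  proof (rule sqrt_multiplier_bound(2)[of "carrier A" "nrm A" b d])
    show "star_closed_subset (carrier A) A" by (auto simp: star_closed_subset_def)
    show "cstar_seminorm (A\<lparr>carrier := carrier A\<rparr>) (nrm A)" using cstar_seminorm_axioms by simp
  qed (fact | use b d that in simp)+
  define x where "x = d \<otimes> y"
  have [simp]: "x \<in> carrier A" using d y by (simp add: x_def)
  note [simp] = b(1) d(1) y
  have "(b \<otimes> b) \<otimes> y \<oplus> d \<otimes> x = x \<oplus> x"
    using arg_cong[OF d(4), of "\<lambda>z. z \<otimes> y"] by (simp add: l_distr m_assoc x_def)
  then have bby: "(b \<otimes> b) \<otimes> y = (x \<oplus> x) \<ominus> d \<otimes> x"
    by (intro add_diff_cancel) (auto simp: M.a_comm)
  have "y \<ominus> (b \<otimes> b) \<otimes> y = (y \<ominus> x) \<ominus> d \<otimes> (y \<ominus> x)"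
    unfolding bby by (simp add: mult_diff_r x_def[symmetric])
      (simp add: minus_sm sm_add_r sm_assoc M.a_ac)
  also have "nrm A \<dots> \<le> nrm A (y \<ominus> x)" by (rule E) simp
  also have "\<dots> \<le> nrm A y" unfolding x_def by (rule E) simp
  finally show ?thesis .
qed

end

section \<open>Closed ideals\<close>

text \<open>Scalars are listed because there is no unit to express them by products. The ideals of
  the algebraic crossed products are of this kind; for closed ideals, invariance under the
  involution is a theorem, \<open>closed_ideal_star\<close>.\<close>

definition two_sided_ideal :: "'a set \<Rightarrow> ('a, 'm) star_alg_scheme \<Rightarrow> bool" where
  "two_sided_ideal J A \<longleftrightarrow> J \<subseteq> carrier A \<and> \<zero>\<^bsub>A\<^esub> \<in> J \<and>
     (\<forall>x\<in>J. \<forall>y\<in>J. x \<oplus>\<^bsub>A\<^esub> y \<in> J) \<and> (\<forall>c. \<forall>x\<in>J. c \<odot>\<^bsub>A\<^esub> x \<in> J) \<and>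
     (\<forall>a\<in>carrier A. \<forall>x\<in>J. a \<otimes>\<^bsub>A\<^esub> x \<in> J \<and> x \<otimes>\<^bsub>A\<^esub> a \<in> J)"

lemma two_sided_idealD:
  assumes "two_sided_ideal J A"
  shows "x \<in> J \<Longrightarrow> x \<in> carrier A" "\<zero>\<^bsub>A\<^esub> \<in> J" "\<lbrakk>x \<in> J; y \<in> J\<rbrakk> \<Longrightarrow> x \<oplus>\<^bsub>A\<^esub> y \<in> J"
    "x \<in> J \<Longrightarrow> c \<odot>\<^bsub>A\<^esub> x \<in> J" "\<lbrakk>a \<in> carrier A; x \<in> J\<rbrakk> \<Longrightarrow> a \<otimes>\<^bsub>A\<^esub> x \<in> J"
    "\<lbrakk>a \<in> carrier A; x \<in> J\<rbrakk> \<Longrightarrow> x \<otimes>\<^bsub>A\<^esub> a \<in> J"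
  using assms by (auto simp: two_sided_ideal_def)

lemma tendsto_zero_of_square_le:
  fixes f g :: "nat \<Rightarrow> real"
  assumes "\<And>n. 0 \<le> f n" "\<And>n. (f n)\<^sup>2 \<le> g n" "g \<longlonglongrightarrow> 0"
  shows "f \<longlonglongrightarrow> 0"
proof (rule tendsto_sandwich[OF _ _ tendsto_const])
  show "(\<lambda>n. sqrt (g n)) \<longlonglongrightarrow> 0" using tendsto_real_sqrt[OF assms(3)] by simp
qed (use assms real_le_rsqrt in \<open>auto intro!: always_eventually\<close>)

context cstar_algebra
begin

text \<open>With \<open>b = t x x\<^sup>*\<close> and \<open>S = 1 - b\<^sup>2\<close>, a contraction, the Cesaro means \<open>W\<close> of the powers of \<open>S\<close>
  satisfy \<open>\<parallel>W b\<^sup>2\<parallel> = O(1/n)\<close>; the element sought is \<open>1 - W\<close>. Since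
  \<open>\<parallel>W y\<parallel>\<^sup>2 \<le> \<parallel>W (y y\<^sup>*)\<parallel>\<close>, the convergence of \<open>W b\<^sup>4\<close> is passed down to \<open>W b\<^sup>2\<close>, \<open>W b\<close> and \<open>W x\<close>.\<close>

lemma approximate_left_unit:
  assumes x: "x \<in> carrier A"
  obtains u where "\<And>n. u n \<in> carrier A" "\<And>n. star A (u n) = u n"
    "slim A (nrm A) (\<lambda>n. u n \<otimes> x) x"
    "\<And>J n. \<lbrakk>two_sided_ideal J A; x \<in> J\<rbrakk> \<Longrightarrow> u n \<in> J"
proof -
  note [simp] = x
  \<comment> \<open>The summand 1 avoids division by zero; \<open>t * (nrm A x)\<^sup>2 < 1\<close>
    makes the norm of b less than 1.\<close>
  define t where "t = 1 / ((nrm A x)\<^sup>2 + 1)"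
  define b where "b = complex_of_real t \<odot> (x \<otimes> star A x)"
  define \<beta> where "\<beta> = b \<otimes> b"
  \<comment> \<open>In unital notation s n = 1 - S^n with S = 1 - \<beta>, and T n is the sum of s i
    over i < n.\<close>
  define s where "s = rec_nat \<zero> (\<lambda>n z. z \<oplus> (\<beta> \<ominus> \<beta> \<otimes> z))"
  define T where "T = rec_nat \<zero> (\<lambda>n z. z \<oplus> s n)"
  have s0 [simp]: "s 0 = \<zero>" and s_Suc: "\<And>n. s (Suc n) = s n \<oplus> (\<beta> \<ominus> \<beta> \<otimes> s n)"
    by (simp_all add: s_def)
  have T0 [simp]: "T 0 = \<zero>" and T_Suc: "\<And>n. T (Suc n) = T n \<oplus> s n"
    by (simp_all add: T_def)
  have t: "t > 0" "t * (nrm A x)\<^sup>2 < 1"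
    unfolding t_def by (auto intro: divide_pos_pos add_nonneg_pos simp: pos_add_strict add_nonneg_pos divide_less_eq)
  have [simp]: "b \<in> carrier A" "\<beta> \<in> carrier A" by (simp_all add: b_def \<beta>_def)
  have sb: "star A b = b" by (simp add: b_def star_smult star_mult star_star)
  have s\<beta>: "star A \<beta> = \<beta>" by (simp add: \<beta>_def star_mult sb)
  have nb: "nrm A b < 1"
  proof -
    have "nrm A (x \<otimes> star A x) \<le> (nrm A x)\<^sup>2"
      using N.submultiplicative[of x "star A x"] by (simp add: N.star_isometric power2_eq_square)
    then have "t * nrm A (x \<otimes> star A x) \<le> t * (nrm A x)\<^sup>2" using t by (intro mult_left_mono) auto
    then have "t * nrm A (x \<otimes> star A x) < 1" using t(2) by (rule le_less_trans)
    then show ?thesis using t by (simp add: b_def N.homogeneous)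
  qed
  have sA [simp]: "s n \<in> carrier A" for n by (induction n) (simp_all add: s_Suc)
  have TA [simp]: "T n \<in> carrier A" for n by (induction n) (simp_all add: T_Suc)
  have comm: "\<beta> \<otimes> s n = s n \<otimes> \<beta>" for n
  proof (induction n)
    case (Suc n)
    have "\<beta> \<otimes> (\<beta> \<otimes> s n) = (\<beta> \<otimes> s n) \<otimes> \<beta>"
      by (subst (1) Suc.IH) (simp add: m_assoc)
    then show ?case using Suc.IH by (simp add: s_Suc r_distr l_distr mult_diff_r mult_diff_l)
  qed simp
  have ss: "star A (s n) = s n" for n
    by (induction n) (simp_all add: s_Suc star_add star_diff star_mult s\<beta> comm)
  have sT: "star A (T n) = T n" for n
    by (induction n) (simp_all add: T_Suc star_add ss)
  \<comment> \<open>Operators that make sense without a unit: P n is S^n and Q n is the sum of S^i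
    over i < n.\<close>
  define S where "S = (\<lambda>y. y \<ominus> \<beta> \<otimes> y)"
  define P where "P = (\<lambda>n y. y \<ominus> s n \<otimes> y)"
  define Q where "Q = (\<lambda>n y. of_nat n \<odot> y \<ominus> T n \<otimes> y)"
  have PA [simp]: "P n y \<in> carrier A" and QA [simp]: "Q n y \<in> carrier A" if "y \<in> carrier A" for n y
    using that by (simp_all add: P_def Q_def)
  have P_Suc: "P (Suc n) y = S (P n y)" if "y \<in> carrier A" for n y
    using that by (simp add: P_def S_def s_Suc mult_diff_r l_distr mult_diff_l m_assoc)
      (simp add: minus_sm sm_add_r sm_assoc M.a_ac)
  have P_Suc': "P (Suc n) y = P n y \<ominus> P n (\<beta> \<otimes> y)" if y: "y \<in> carrier A" for n y
  proof -
    have "\<beta> \<otimes> P n y = P n (\<beta> \<otimes> y)"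
      using y by (simp add: P_def mult_diff_r m_assoc[symmetric] comm)
    then show ?thesis using y P_Suc[OF y] by (simp add: S_def)
  qed
  have Q_Suc: "Q (Suc n) y = Q n y \<oplus> P n y" if "y \<in> carrier A" for n y
    using that by (simp add: Q_def P_def T_Suc l_distr sm_add_l diff_add[symmetric] M.a_comm)
  have nP: "nrm A (P n y) \<le> nrm A y" if y: "y \<in> carrier A" for n y
  proof (induction n)
    case 0 then show ?case using y by (simp add: P_def)
  next
    case (Suc n)
    then show ?case
      using selfadjoint_complement_bound[OF _ sb nb, of "P n y"] P_Suc[OF y] y
      by (simp add: S_def \<beta>_def)
  qed
  have nQ: "nrm A (Q n y) \<le> real n * nrm A y" if y: "y \<in> carrier A" for n y
  proof (induction n)
    case 0 then show ?case using y by (simp add: Q_def)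
  next
    case (Suc n)
    then show ?case
      using N.triangle[of "Q n y" "P n y"] nP[OF y, of n] Q_Suc[OF y] y by (simp add: algebra_simps)
  qed
  \<comment> \<open>Telescoping: the sum of S^i (1 - S) over i < n is 1 - S^n.\<close>
  have Q\<beta>: "Q n (\<beta> \<otimes> y) = y \<ominus> P n y" if y: "y \<in> carrier A" for n y
  proof (induction n)
    case 0 then show ?case using y by (simp add: Q_def P_def)
  next
    case (Suc n)
    define z w where "z = P n y" and "w = P n (\<beta> \<otimes> y)"
    have [simp]: "z \<in> carrier A" "w \<in> carrier A" using y by (simp_all add: z_def w_def)
    have "y \<ominus> (z \<ominus> w) = (y \<ominus> z) \<oplus> w"
      using y by (simp add: minus_sm sm_add_r sm_assoc M.a_ac)
    then show ?case
      using Suc y P_Suc'[OF y, of n] Q_Suc[of "\<beta> \<otimes> y" n] by (simp add: z_def w_def)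
  qed
  \<comment> \<open>W n is the mean of S^0, ..., S^n and u n is 1 minus that mean; the shift to n +
    1 keeps the denominator positive.\<close>
  define u where "u = (\<lambda>n. (1 / of_nat (Suc n)) \<odot> T (Suc n))"
  define W where "W = (\<lambda>n y. y \<ominus> u n \<otimes> y)"
  have uA [simp]: "u n \<in> carrier A" for n by (simp add: u_def)
  have su: "star A (u n) = u n" for n by (simp add: u_def star_smult sT)
  have WA [simp]: "W n y \<in> carrier A" if "y \<in> carrier A" for n y using that by (simp add: W_def)
  have WQ: "W n y = (1 / of_nat (Suc n)) \<odot> Q (Suc n) y" if y: "y \<in> carrier A" for n y
  proof -
    have "(1 / of_nat (Suc n)) * of_nat (Suc n) = (1::complex)"
      by (metis nonzero_divide_eq_eq of_nat_eq_0_iff nat.distinct(2) times_divide_eq_left mult_1)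
    then show ?thesis
      using y by (simp add: W_def Q_def u_def sm_diff sm_assoc smult_m_left del: of_nat_Suc)
  qed
  have nW: "nrm A (W n y) = nrm A (Q (Suc n) y) / real (Suc n)" if y: "y \<in> carrier A" for n y
    using y by (simp add: WQ N.homogeneous norm_divide del: of_nat_Suc)
  have nW1: "nrm A (W n y) \<le> nrm A y" if y: "y \<in> carrier A" for n y
    using nQ[OF y, of "Suc n"] nW[OF y, of n] by (simp add: divide_le_eq mult.commute del: of_nat_Suc)
  have nW2: "nrm A (W n (\<beta> \<otimes> y)) \<le> 2 * nrm A y / real (Suc n)" if y: "y \<in> carrier A" for n y
    using N.p_diff_le[OF y PA[OF y], of "Suc n"] nP[OF y, of "Suc n"] y
    by (simp add: nW Q\<beta> divide_right_mono del: of_nat_Suc)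
  have sq: "(nrm A (W n y))\<^sup>2 \<le> nrm A (W n (y \<otimes> star A y))" if y: "y \<in> carrier A" for n y
  proof -
    define w where "w = W n (y \<otimes> star A y)"
    have [simp]: "w \<in> carrier A" using y by (simp add: w_def)
    have Wyy: "W n y \<otimes> star A y = w"
      using y by (simp add: w_def W_def mult_diff_l m_assoc)
    have "W n y \<otimes> star A (W n y) = W n y \<otimes> star A y \<ominus> (W n y \<otimes> star A y) \<otimes> u n"
      using y by (subst (2) W_def) (simp add: star_diff star_mult su mult_diff_r m_assoc)
    also have "\<dots> = w \<ominus> w \<otimes> u n" by (simp add: Wyy)
    \<comment> \<open>As u n is self-adjoint, multiplying w by 1 - u n on the right is W n
      conjugated by the involution, so the same contraction bound applies.\<close>
    also have "\<dots> = star A (W n (star A w))"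
      by (simp add: W_def star_diff star_mult star_star su)
    finally have "nrm A (W n y \<otimes> star A (W n y)) \<le> nrm A w"
      using nW1[of "star A w" n] by (simp add: N.star_isometric)
    moreover have "nrm A (W n y \<otimes> star A (W n y)) = (nrm A (W n y))\<^sup>2"
      using cstar_identity[of "star A (W n y)"] y by (simp add: star_star N.star_isometric)
    ultimately show ?thesis by (simp add: w_def)
  qed
  have l4: "(\<lambda>n. nrm A (W n (\<beta> \<otimes> \<beta>))) \<longlonglongrightarrow> 0"
  proof (rule tendsto_sandwich[OF _ _ tendsto_const])
    show "(\<lambda>n. 2 * nrm A \<beta> / real (Suc n)) \<longlonglongrightarrow> 0"
      using LIMSEQ_Suc[OF lim_const_over_n[of "2 * nrm A \<beta>"]] by simp
  qed (use nW2[of \<beta>] in \<open>auto intro!: always_eventually simp: N.nonneg simp del: of_nat_Suc\<close>)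
  have l2: "(\<lambda>n. nrm A (W n \<beta>)) \<longlonglongrightarrow> 0"
    by (rule tendsto_zero_of_square_le[OF _ _ l4]) (use sq[of \<beta>] in \<open>auto simp: N.nonneg s\<beta>\<close>)
  have l1: "(\<lambda>n. nrm A (W n b)) \<longlonglongrightarrow> 0"
    by (rule tendsto_zero_of_square_le[OF _ _ l2]) (use sq[of b] in \<open>auto simp: N.nonneg sb \<beta>_def\<close>)
  have Wb: "nrm A (W n b) = t * nrm A (W n (x \<otimes> star A x))" for n
    using t by (simp add: W_def b_def smult_m_right sm_diff[symmetric] N.homogeneous)
  have "(\<lambda>n. nrm A (W n b) / t) \<longlonglongrightarrow> 0 / t" using t by (intro tendsto_intros l1) auto
  then have "(\<lambda>n. nrm A (W n (x \<otimes> star A x))) \<longlonglongrightarrow> 0" using t by (simp add: Wb)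
  then have "(\<lambda>n. nrm A (W n x)) \<longlonglongrightarrow> 0"
    by (rule tendsto_zero_of_square_le[rotated 2]) (use sq[of x] in \<open>auto simp: N.nonneg\<close>)
  then have conv: "slim A (nrm A) (\<lambda>n. u n \<otimes> x) x"
    by (auto simp: slim_def W_def N.p_diff_comm[of x])
  \<comment> \<open>Valid for any algebraic ideal: only products containing the factor x, sums and
    scalars are used, and no limit is taken.\<close>
  have ideal: "u n \<in> J" if J: "two_sided_ideal J A" "x \<in> J" for J n
  proof -
    note [simp] = two_sided_idealD[OF J(1)] J(2)
    have b: "b \<in> J" and \<beta>: "\<beta> \<in> J" by (simp_all add: b_def \<beta>_def)
    have "s n \<in> J" for n by (induction n) (simp_all add: s_Suc minus_sm \<beta>)
    then have "T n \<in> J" for n by (induction n) (simp_all add: T_Suc)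
    then show ?thesis by (simp add: u_def)
  qed
  show thesis by (rule that[OF uA su conv ideal])
qed

lemma closed_two_sided_ideal_iff:
  "closed_two_sided_ideal J A \<longleftrightarrow>
    two_sided_ideal J A \<and> (\<forall>X x. range X \<subseteq> J \<longrightarrow> slim A (nrm A) X x \<longrightarrow> x \<in> J)"
proof -
  interpret Metric_space "carrier A" "nrm_dist A" by (rule Metric_space_nrm)
  have sub: "submodule J complex_ring A \<longleftrightarrow> J \<subseteq> carrier A \<and> \<zero> \<in> J \<and>
     (\<forall>x\<in>J. \<forall>y\<in>J. x \<oplus> y \<in> J) \<and> (\<forall>c. \<forall>x\<in>J. c \<odot> x \<in> J)" (is "_ \<longleftrightarrow> ?R")
  proof
    assume J: "submodule J complex_ring A"
    then have "\<zero> \<in> J" using subgroup.one_closed[OF submodule.axioms(1)[OF J]] by simp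
    then show ?R using submoduleE[OF J] by auto
  next
    assume ?R
    then show "submodule J complex_ring A"
      by (intro submoduleI) (auto simp: neg_sm subset_eq)
  qed
  have lim: "limitin mtopology X x sequentially \<longleftrightarrow> slim A (nrm A) X x" if "range X \<subseteq> J" "J \<subseteq> carrier A" for X x
    using limitin_slim[of X x] that by auto
  have "closedin mtopology J \<longleftrightarrow> (\<forall>X x. range X \<subseteq> J \<longrightarrow> slim A (nrm A) X x \<longrightarrow> x \<in> J)" if "J \<subseteq> carrier A"
    unfolding metric_closedin_iff_sequentially_closed using that lim by metis
  then show ?thesis
    unfolding closed_two_sided_ideal_def sub two_sided_ideal_def by blast
qed

lemma
  assumes "closed_two_sided_ideal J A"
  shows closed_ideal_two_sided: "two_sided_ideal J A"
    and closed_ideal_slim: "\<lbrakk>\<And>n. X n \<in> J; slim A (nrm A) X x\<rbrakk> \<Longrightarrow> x \<in> J"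
  using assms by (auto simp: closed_two_sided_ideal_iff subset_eq)

text \<open>With self-adjoint left units u n in J, \<open>star A x\<close> is the limit of
  \<open>star A x \<otimes> u n\<close>, and these products lie in J because u n does.\<close>

lemma closed_ideal_star:
  assumes J: "closed_two_sided_ideal J A" and x: "x \<in> J"
  shows "star A x \<in> J"
proof -
  note J' = closed_ideal_two_sided[OF J]
  note [simp] = two_sided_idealD[OF J']
  obtain u where u: "\<And>n. u n \<in> carrier A" "\<And>n. star A (u n) = u n"
    "slim A (nrm A) (\<lambda>n. u n \<otimes> x) x" "\<And>n. u n \<in> J"
    using approximate_left_unit[of x] x J' by (metis two_sided_idealD(1))
  have "slim A (nrm A) (\<lambda>n. star A x \<otimes> u n) (star A x)"
    using N.slim_star[OF u(3)] u(1,2) x by (simp add: star_mult)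
  then show ?thesis by (rule closed_ideal_slim[OF J, rotated]) (use u x in simp)
qed

lemma closed_ideal_star_closed:
  "closed_two_sided_ideal J A \<Longrightarrow> star_closed_subset J A"
  using closed_ideal_star closed_ideal_two_sided
  by (auto simp: star_closed_subset_def two_sided_ideal_def subset_eq)

text \<open>This makes the norm comparison for C*-algebras applicable to the maps \<theta>, whose
  domains are ideals of A rather than A.\<close>

lemma cstar_algebra_closed_ideal:
  assumes J: "closed_two_sided_ideal J A"
  shows "cstar_algebra (A\<lparr>carrier := J\<rparr>)"
proof -
  note sc = closed_ideal_star_closed[OF J]
  have JA [simp]: "\<And>x. x \<in> J \<Longrightarrow> x \<in> carrier A" using sc by (auto simp: star_closed_subset_def)
  interpret J: pre_cstar_algebra "A\<lparr>carrier := J\<rparr>"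
  proof (intro pre_cstar_algebra.intro star_subalgebra[OF sc] pre_cstar_algebra_axioms.intro)
    show "cstar_seminorm (A\<lparr>carrier := J\<rparr>) (nrm (A\<lparr>carrier := J\<rparr>))"
      by unfold_locales (auto simp: N.nonneg N.triangle N.homogeneous N.submultiplicative
        N.star_isometric cstar_identity)
  qed (auto intro: definite)
  show ?thesis
  proof (rule J.cstar_algebraI)
    fix X assume X: "X \<in> cauchy_seqs (A\<lparr>carrier := J\<rparr>) (nrm (A\<lparr>carrier := J\<rparr>))"
    then have XJ: "X n \<in> J" for n by (auto simp: cauchy_seqs_def)
    have "X \<in> cauchy_seqs A (nrm A)"
      using X XJ by (auto simp: cauchy_seqs_def diff_sub[OF sc])
    then obtain x where x: "slim A (nrm A) X x" by (rule cauchy_slim)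
    then have "x \<in> J" using closed_ideal_slim[OF J] XJ by blast
    then show "\<exists>x. slim (A\<lparr>carrier := J\<rparr>) (nrm (A\<lparr>carrier := J\<rparr>)) X x"
      using x XJ by (auto simp: slim_def diff_sub[OF sc])
  qed
qed

text \<open>The test element is w = \<open>star A z\<close>, available in J because closed ideals
  are invariant under the involution; the C*-identity does the rest.\<close>

lemma closed_ideal_nondegenerate:
  assumes z: "z \<in> J" and J: "closed_two_sided_ideal J A" and null: "\<And>w. w \<in> J \<Longrightarrow> w \<otimes> z = \<zero>"
  shows "z = \<zero>"
proof -
  have "z \<in> carrier A" using z two_sided_idealD[OF closed_ideal_two_sided[OF J]] by simp
  then show ?thesis
    using null[OF closed_ideal_star[OF J z]] cstar_identity[of z] definite[of z] by simp
qed

end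

section \<open>Separated completions\<close>

locale cstar_seminormed = star_algebra B + cstar_seminorm B p
  for B :: "('a, 'm) star_alg_scheme" (structure) and p :: "'a \<Rightarrow> real"

sublocale cstar_seminormed \<subseteq> S?: seminormed_star_algebra B p
  by (rule seminormed_of_cstar_seminorm) (rule cstar_seminorm_axioms)

context cstar_seminormed
begin

abbreviation "CS \<equiv> cauchy_seqs B p"
abbreviation "cls X \<equiv> cauchy_rel B p `` {X}"
abbreviation "C \<equiv> completion B p"

lemma CS_carrier [simp]: "X \<in> CS \<Longrightarrow> X n \<in> carrier B"
  by (auto simp: cauchy_seqs_def)

lemma CS_D: "\<lbrakk>X \<in> CS; 0 < e\<rbrakk> \<Longrightarrow> \<exists>M. \<forall>m\<ge>M. \<forall>n\<ge>M. p (X m \<ominus> X n) < e"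
  by (simp add: cauchy_seqs_def)

text \<open>One domination criterion covers all operations; a unary one takes Y = X. Positivity of K
  is the reason for enlarged constants such as \<open>cmod c + 1\<close> for scalar
  multiples.\<close>

lemma CS_domI:
  assumes X: "X \<in> CS" and Y: "Y \<in> CS" and Z: "\<And>n. Z n \<in> carrier B" and K: "K > 0"
    and le: "\<And>m n. p (Z m \<ominus> Z n) \<le> K * (p (X m \<ominus> X n) + p (Y m \<ominus> Y n))"
  shows "Z \<in> CS"
  unfolding cauchy_seqs_def
proof (intro CollectI conjI allI impI)
  fix e :: real assume "e > 0"
  then have e: "e / (2 * K) > 0" using K by simp
  obtain M where M: "\<And>m n. \<lbrakk>m \<ge> M; n \<ge> M\<rbrakk> \<Longrightarrow> p (X m \<ominus> X n) < e / (2 * K)"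
    using CS_D[OF X e] by blast
  obtain N where N: "\<And>m n. \<lbrakk>m \<ge> N; n \<ge> N\<rbrakk> \<Longrightarrow> p (Y m \<ominus> Y n) < e / (2 * K)"
    using CS_D[OF Y e] by blast
  have "p (Z m \<ominus> Z n) < e" if "m \<ge> max M N" "n \<ge> max M N" for m n
  proof -
    have "p (X m \<ominus> X n) + p (Y m \<ominus> Y n) < e / (2 * K) + e / (2 * K)"
      using that by (intro add_strict_mono M N) auto
    also have "\<dots> = e / K" using K by (simp add: field_simps)
    finally have "K * (p (X m \<ominus> X n) + p (Y m \<ominus> Y n)) < e"
      using K by (simp add: less_divide_eq mult.commute)
    then show ?thesis using le[of m n] by linarith
  qed
  then show "\<exists>N. \<forall>m\<ge>N. \<forall>n\<ge>N. p (Z m \<ominus> Z n) < e" by blast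
qed (use Z in auto)

lemma rel_domI:
  assumes X: "(X, X') \<in> cauchy_rel B p" and Y: "(Y, Y') \<in> cauchy_rel B p" and Z: "Z \<in> CS" "Z' \<in> CS"
    and le: "\<And>n. p (Z n \<ominus> Z' n) \<le> K * (p (X n \<ominus> X' n) + p (Y n \<ominus> Y' n))"
  shows "(Z, Z') \<in> cauchy_rel B p"
proof -
  have "(\<lambda>n. K * (p (X n \<ominus> X' n) + p (Y n \<ominus> Y' n))) \<longlonglongrightarrow> K * (0 + 0)"
    using X Y by (intro tendsto_intros) (auto simp: cauchy_rel_def)
  then have "(\<lambda>n. K * (p (X n \<ominus> X' n) + p (Y n \<ominus> Y' n))) \<longlonglongrightarrow> 0" by simp
  then have "(\<lambda>n. p (Z n \<ominus> Z' n)) \<longlonglongrightarrow> 0"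
    by (rule Lim_null_comparison[OF always_eventually, rotated]) (use le nonneg Z in simp)
  then show ?thesis using Z by (simp add: cauchy_rel_def)
qed

lemma equiv_cauchy_rel: "equiv CS (cauchy_rel B p)"
proof (rule equivI)
  show "cauchy_rel B p \<subseteq> CS \<times> CS" by (auto simp: cauchy_rel_def)
  show "refl_on CS (cauchy_rel B p)" by (auto simp: refl_on_def cauchy_rel_def)
  show "sym (cauchy_rel B p)" by (auto simp: sym_def cauchy_rel_def p_diff_comm)
  show "trans (cauchy_rel B p)"
  proof (rule transI)
    fix X Y Z assume XY: "(X, Y) \<in> cauchy_rel B p" and YZ: "(Y, Z) \<in> cauchy_rel B p"
    then have [simp]: "X \<in> CS" "Y \<in> CS" "Z \<in> CS" by (auto simp: cauchy_rel_def)
    show "(X, Z) \<in> cauchy_rel B p"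
      by (rule rel_domI[OF XY YZ, of _ _ 1]) (auto intro: p_diff_triangle)
  qed
qed

lemma cls_eq_iff: "\<lbrakk>X \<in> CS; Y \<in> CS\<rbrakk> \<Longrightarrow> cls X = cls Y \<longleftrightarrow> (X, Y) \<in> cauchy_rel B p"
  by (rule eq_equiv_class_iff[OF equiv_cauchy_rel])

lemma carrier_C: "carrier C = (\<lambda>X. cls X) ` CS"
  by (auto simp: completion_def quotient_def)

lemma cls_closed [simp]: "X \<in> CS \<Longrightarrow> cls X \<in> carrier C"
  by (simp add: carrier_C)

lemma carrier_CE: "\<lbrakk>U \<in> carrier C; \<And>X. \<lbrakk>X \<in> CS; U = cls X\<rbrakk> \<Longrightarrow> thesis\<rbrakk> \<Longrightarrow> thesis"
  by (auto simp: carrier_C)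

lemma CS_convergent: "X \<in> CS \<Longrightarrow> convergent (\<lambda>n. p (X n))"
proof (rule Cauchy_convergent, rule CauchyI)
  fix e :: real assume X: "X \<in> CS" and e: "e > 0"
  obtain M where M: "\<And>m n. \<lbrakk>m \<ge> M; n \<ge> M\<rbrakk> \<Longrightarrow> p (X m \<ominus> X n) < e"
    using CS_D[OF X e] by blast
  have "norm (p (X m) - p (X n)) < e" if "m \<ge> M" "n \<ge> M" for m n
    using p_rev_triangle[of "X m" "X n"] M[OF that] X by simp
  then show "\<exists>M. \<forall>m\<ge>M. \<forall>n\<ge>M. norm (p (X m) - p (X n)) < e" by blast
qed

lemma CS_bounded:
  assumes "X \<in> CS"
  obtains K where "K > 0" "\<And>n. p (X n) \<le> K"
proof -
  have "Bseq (\<lambda>n. p (X n))" by (rule convergent_imp_Bseq[OF CS_convergent[OF assms]])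
  then obtain K where K: "K > 0" "\<And>n. norm (p (X n)) \<le> K" by (auto simp: Bseq_def)
  show thesis by (rule that[OF K(1)]) (use K(2) abs_le_D1 in auto)
qed

lemma CS_const [simp]: "b \<in> carrier B \<Longrightarrow> (\<lambda>n. b) \<in> CS"
  by (auto simp: cauchy_seqs_def)

lemma CS_add [simp]: "\<lbrakk>X \<in> CS; Y \<in> CS\<rbrakk> \<Longrightarrow> (\<lambda>n. X n \<oplus> Y n) \<in> CS"
  by (rule CS_domI[of X Y _ 1]) (auto simp: diff_add intro: triangle)

lemma CS_smult [simp]: "X \<in> CS \<Longrightarrow> (\<lambda>n. c \<odot> X n) \<in> CS"
  by (rule CS_domI[of X X _ "cmod c + 1"])
    (auto simp: sm_diff[symmetric] homogeneous nonneg intro!: add_nonneg_pos mult_mono)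

lemma CS_star [simp]: "X \<in> CS \<Longrightarrow> (\<lambda>n. star B (X n)) \<in> CS"
  by (rule CS_domI[of X X _ 1]) (auto simp: star_diff[symmetric] star_isometric nonneg)

text \<open>The symmetric constant K + L is cruder than the product rule but has the shape that
  \<open>CS_domI\<close> and \<open>rel_domI\<close> ask for.\<close>

lemma mult_diff_bound:
  assumes "x \<in> carrier B" "y \<in> carrier B" "x' \<in> carrier B" "y' \<in> carrier B"
    and "p x' \<le> K" "p y \<le> L" "0 \<le> K" "0 \<le> L"
  shows "p (x \<otimes> y \<ominus> x' \<otimes> y') \<le> (K + L) * (p (x \<ominus> x') + p (y \<ominus> y'))"
proof -
  note [simp] = assms(1-4)
  have "p ((x \<ominus> x') \<otimes> y) \<le> p (x \<ominus> x') * L"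
    by (rule order_trans[OF submultiplicative mult_left_mono]) (auto simp: assms nonneg)
  moreover have "p (x' \<otimes> (y \<ominus> y')) \<le> K * p (y \<ominus> y')"
    by (rule order_trans[OF submultiplicative mult_right_mono]) (auto simp: assms nonneg)
  moreover have "0 \<le> K * p (x \<ominus> x')" "0 \<le> L * p (y \<ominus> y')"
    using assms by (auto intro!: mult_nonneg_nonneg nonneg)
  ultimately show ?thesis
    using triangle[of "(x \<ominus> x') \<otimes> y" "x' \<otimes> (y \<ominus> y')"]
    by (subst diff_mult) (simp_all add: algebra_simps)
qed

lemma CS_mult [simp]:
  assumes "X \<in> CS" "Y \<in> CS"
  shows "(\<lambda>n. X n \<otimes> Y n) \<in> CS"
proof -
  obtain K where K: "K > 0" "\<And>n. p (X n) \<le> K" using CS_bounded[OF assms(1)] by blast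
  obtain L where L: "L > 0" "\<And>n. p (Y n) \<le> L" using CS_bounded[OF assms(2)] by blast
  show ?thesis
    by (rule CS_domI[OF assms, of _ "K + L"]) (use assms K L K(1)[THEN less_imp_le] L(1)[THEN less_imp_le] in \<open>auto intro!: mult_diff_bound\<close>)
qed

lemma rel_mult:
  assumes "(X, X') \<in> cauchy_rel B p" "(Y, Y') \<in> cauchy_rel B p"
  shows "(\<lambda>n. X n \<otimes> Y n, \<lambda>n. X' n \<otimes> Y' n) \<in> cauchy_rel B p"
proof -
  have CS: "X \<in> CS" "Y \<in> CS" "X' \<in> CS" "Y' \<in> CS" using assms by (auto simp: cauchy_rel_def)
  obtain K where K: "K > 0" "\<And>n. p (X' n) \<le> K" using CS_bounded[OF CS(3)] by blast
  obtain L where L: "L > 0" "\<And>n. p (Y n) \<le> L" using CS_bounded[OF CS(2)] by blast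
  show ?thesis
    by (rule rel_domI[OF assms, of _ _ "K + L"])
      (use CS K L K(1)[THEN less_imp_le] L(1)[THEN less_imp_le] in \<open>auto intro!: mult_diff_bound\<close>)
qed

lemma mult_C: assumes "X \<in> CS" "Y \<in> CS" shows "cls X \<otimes>\<^bsub>C\<^esub> cls Y = cls (\<lambda>n. X n \<otimes> Y n)"
proof -
  have "congruent2 (cauchy_rel B p) (cauchy_rel B p) (\<lambda>X Y. cls (\<lambda>n. X n \<otimes> Y n))"
    unfolding congruent2_def
    by (intro allI impI equiv_class_eq[OF equiv_cauchy_rel] rel_mult | clarify)+
  from UN_equiv_class2[OF equiv_cauchy_rel equiv_cauchy_rel this assms]
  show ?thesis by (simp add: completion_def)
qed

lemma add_C: assumes "X \<in> CS" "Y \<in> CS" shows "cls X \<oplus>\<^bsub>C\<^esub> cls Y = cls (\<lambda>n. X n \<oplus> Y n)"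
proof -
  have "(\<lambda>n. X n \<oplus> Y n, \<lambda>n. X' n \<oplus> Y' n) \<in> cauchy_rel B p"
    if "(X, X') \<in> cauchy_rel B p" "(Y, Y') \<in> cauchy_rel B p" for X Y X' Y'
  proof -
    have "X \<in> CS" "Y \<in> CS" "X' \<in> CS" "Y' \<in> CS" using that by (auto simp: cauchy_rel_def)
    then show ?thesis
      by (intro rel_domI[OF that, of _ _ 1]) (auto simp: diff_add intro!: triangle)
  qed
  then have "congruent2 (cauchy_rel B p) (cauchy_rel B p) (\<lambda>X Y. cls (\<lambda>n. X n \<oplus> Y n))"
    unfolding congruent2_def
    by (intro allI impI equiv_class_eq[OF equiv_cauchy_rel] | clarify)+
  from UN_equiv_class2[OF equiv_cauchy_rel equiv_cauchy_rel this assms]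
  show ?thesis by (simp add: completion_def)
qed

lemma smult_C: assumes "X \<in> CS" shows "c \<odot>\<^bsub>C\<^esub> cls X = cls (\<lambda>n. c \<odot> X n)"
proof -
  have "(\<lambda>n. c \<odot> X n, \<lambda>n. c \<odot> X' n) \<in> cauchy_rel B p" if "(X, X') \<in> cauchy_rel B p" for X X'
  proof -
    have "X \<in> CS" "X' \<in> CS" using that by (auto simp: cauchy_rel_def)
    then show ?thesis
      by (intro rel_domI[OF that that, of _ _ "cmod c"])
        (auto simp: sm_diff[symmetric] homogeneous nonneg intro!: mult_left_mono)
  qed
  then have "congruent (cauchy_rel B p) (\<lambda>X. cls (\<lambda>n. c \<odot> X n))"
    unfolding congruent_def
    by (intro allI impI equiv_class_eq[OF equiv_cauchy_rel] | clarify)+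
  from UN_equiv_class[OF equiv_cauchy_rel this assms]
  show ?thesis by (simp add: completion_def)
qed

lemma star_C: assumes "X \<in> CS" shows "star C (cls X) = cls (\<lambda>n. star B (X n))"
proof -
  have "(\<lambda>n. star B (X n), \<lambda>n. star B (X' n)) \<in> cauchy_rel B p" if "(X, X') \<in> cauchy_rel B p" for X X'
  proof -
    have "X \<in> CS" "X' \<in> CS" using that by (auto simp: cauchy_rel_def)
    then show ?thesis
      by (intro rel_domI[OF that that, of _ _ 1])
        (auto simp: star_diff[symmetric] star_isometric nonneg)
  qed
  then have "congruent (cauchy_rel B p) (\<lambda>X. cls (\<lambda>n. star B (X n)))"
    unfolding congruent_def
    by (intro allI impI equiv_class_eq[OF equiv_cauchy_rel] | clarify)+
  from UN_equiv_class[OF equiv_cauchy_rel this assms]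
  show ?thesis by (simp add: completion_def)
qed

lemma zero_C: "\<zero>\<^bsub>C\<^esub> = cls (\<lambda>n. \<zero>)"
  by (simp add: completion_def)

text \<open>Equivalent sequences have seminorms with the same limit, so the definite description
  that defines the norm of a class does denote.\<close>

lemma nrm_C:
  assumes X: "X \<in> CS"
  shows "(\<lambda>n. p (X n)) \<longlonglongrightarrow> nrm C (cls X)"
proof -
  obtain r where r: "(\<lambda>n. p (X n)) \<longlonglongrightarrow> r" using CS_convergent[OF X] by (auto simp: convergent_def)
  have all: "(\<lambda>n. p (Y n)) \<longlonglongrightarrow> r" if "Y \<in> cls X" for Y
  proof -
    have YX: "Y \<in> CS" "(\<lambda>n. p (X n \<ominus> Y n)) \<longlonglongrightarrow> 0" using that by (auto simp: cauchy_rel_def)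
    have "(\<lambda>n. p (X n) - p (Y n)) \<longlonglongrightarrow> 0"
      by (rule Lim_null_comparison[OF always_eventually YX(2)]) (use X YX in \<open>auto intro: p_rev_triangle\<close>)
    from tendsto_diff[OF r this] show ?thesis by simp
  qed
  have "nrm C (cls X) = r"
    unfolding completion_def
  proof (simp, rule the_equality)
    show "\<forall>Y\<in>cls X. (\<lambda>n. p (Y n)) \<longlonglongrightarrow> r" using all by blast
    fix r' assume *: "\<forall>Y\<in>cls X. (\<lambda>n. p (Y n)) \<longlonglongrightarrow> r'"
    have "X \<in> cls X" using X by (auto simp: cauchy_rel_def)
    then show "r' = r" using * r LIMSEQ_unique by blast
  qed
  then show ?thesis using r by simp
qed

lemma nrm_C_eq: "\<lbrakk>X \<in> CS; (\<lambda>n. p (X n)) \<longlonglongrightarrow> r\<rbrakk> \<Longrightarrow> nrm C (cls X) = r"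
  using nrm_C LIMSEQ_unique by blast

lemmas C_ops = mult_C add_C smult_C star_C zero_C

lemma star_algebra_C: "star_algebra C"
proof (rule star_algebraI)
  show "star_algebra_axioms C"
    unfolding star_algebra_axioms_def
    by (auto elim!: carrier_CE simp: C_ops m_assoc l_distr r_distr smult_m_left smult_m_right star_star
        star_add star_smult star_mult)
qed (auto elim!: carrier_CE simp: C_ops M.a_ac sm_add_l sm_add_r sm_assoc)

sublocale C: star_algebra C by (rule star_algebra_C)

lemma diff_C: "\<lbrakk>X \<in> CS; Y \<in> CS\<rbrakk> \<Longrightarrow> cls X \<ominus>\<^bsub>C\<^esub> cls Y = cls (\<lambda>n. X n \<ominus> Y n)"
  by (simp add: C.minus_sm C_ops minus_sm)

lemma CS_diff [simp]: "\<lbrakk>X \<in> CS; Y \<in> CS\<rbrakk> \<Longrightarrow> (\<lambda>n. X n \<ominus> Y n) \<in> CS"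
  by (simp add: minus_sm)

lemma pre_cstar_C: "pre_cstar_algebra C"
proof (intro pre_cstar_algebra.intro star_algebra_C pre_cstar_algebra_axioms.intro)
  show "cstar_seminorm C (nrm C)"
  proof (rule cstar_seminorm.intro; (elim carrier_CE)?; simp add: C_ops)
    fix X assume X: "X \<in> CS"
    show "0 \<le> nrm C (cls X)"
      by (rule LIMSEQ_le_const[OF nrm_C[OF X]]) (use X nonneg in auto)
    show "nrm C (cls (\<lambda>n. c \<odot> X n)) = cmod c * nrm C (cls X)" for c
      by (rule nrm_C_eq) (use X tendsto_mult[OF tendsto_const nrm_C[OF X]] in \<open>simp_all add: homogeneous\<close>)
    show "nrm C (cls (\<lambda>n. star B (X n))) = nrm C (cls X)"
      by (rule nrm_C_eq) (use X nrm_C[OF X] in \<open>simp_all add: star_isometric\<close>)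
    show "nrm C (cls (\<lambda>n. star B (X n) \<otimes> X n)) = (nrm C (cls X))\<^sup>2"
      by (rule nrm_C_eq) (use X tendsto_power[OF nrm_C[OF X], of 2] in \<open>simp_all add: cstar_identity\<close>)
    fix Y assume Y: "Y \<in> CS"
    show "nrm C (cls (\<lambda>n. X n \<oplus> Y n)) \<le> nrm C (cls X) + nrm C (cls Y)"
      by (rule LIMSEQ_le[OF nrm_C tendsto_add[OF nrm_C[OF X] nrm_C[OF Y]]])
        (use X Y in \<open>auto intro!: exI[of _ 0] triangle\<close>)
    show "nrm C (cls (\<lambda>n. X n \<otimes> Y n)) \<le> nrm C (cls X) * nrm C (cls Y)"
      by (rule LIMSEQ_le[OF nrm_C tendsto_mult[OF nrm_C[OF X] nrm_C[OF Y]]])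
        (use X Y in \<open>auto intro!: exI[of _ 0] submultiplicative\<close>)
  qed
  show "U = \<zero>\<^bsub>C\<^esub>" if U: "U \<in> carrier C" "nrm C U = 0" for U
  proof -
    obtain X where X: "X \<in> CS" "U = cls X" using U(1) by (rule carrier_CE)
    have "(X, \<lambda>n. \<zero>) \<in> cauchy_rel B p"
      using nrm_C[OF X(1)] U X by (simp add: cauchy_rel_def)
    then show ?thesis using X cls_eq_iff by (simp add: zero_C)
  qed
qed

abbreviation "emb b \<equiv> cls (\<lambda>n. b)"

lemma star_hom_emb: "star_hom B C (\<lambda>b. emb b)"
  by (auto simp: star_hom_def C_ops)

lemma nrm_emb: "b \<in> carrier B \<Longrightarrow> nrm C (emb b) = p b"
  by (rule nrm_C_eq) simp_all

lemma emb_slim: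
  assumes X: "X \<in> CS"
  shows "slim C (nrm C) (\<lambda>k. emb (X k)) (cls X)"
  unfolding slim_def
proof (intro conjI)
  interpret N: pre_cstar_algebra C by (rule pre_cstar_C)
  show "(\<lambda>k. nrm C (emb (X k) \<ominus>\<^bsub>C\<^esub> cls X)) \<longlonglongrightarrow> 0"
  proof (rule LIMSEQ_I)
    fix r :: real assume r: "0 < r"
    then have e: "r / 2 > 0" by simp
    obtain M where M: "\<And>m n. \<lbrakk>m \<ge> M; n \<ge> M\<rbrakk> \<Longrightarrow> p (X m \<ominus> X n) < r / 2"
      using CS_D[OF X e] by blast
    have "nrm C (emb (X k) \<ominus>\<^bsub>C\<^esub> cls X) \<le> r / 2" if "k \<ge> M" for k
    proof -
      have "(\<lambda>n. p (X k \<ominus> X n)) \<longlonglongrightarrow> nrm C (cls (\<lambda>n. X k \<ominus> X n))"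
        using X by (intro nrm_C) simp
      then have "nrm C (cls (\<lambda>n. X k \<ominus> X n)) \<le> r / 2"
        using M that by (intro LIMSEQ_le_const2[of _ _ "r / 2"]) (auto intro!: exI[of _ M] less_imp_le)
      then show ?thesis using X by (simp add: diff_C)
    qed
    then show "\<exists>M. \<forall>k\<ge>M. norm (nrm C (emb (X k) \<ominus>\<^bsub>C\<^esub> cls X) - 0) < r"
      using r X N.nonneg by (intro exI[of _ M]) (force simp: C.diff_closed)
  qed
qed (use X in auto)

lemma emb_dense:
  assumes "U \<in> carrier C"
  obtains X where "\<And>n. X n \<in> carrier B" "slim C (nrm C) (\<lambda>k. emb (X k)) U"
proof -
  obtain X where X: "X \<in> CS" "U = cls X" using assms by (rule carrier_CE)
  show thesis by (rule that[of X]) (use X emb_slim in auto)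
qed

text \<open>Choosing b n in B within 1 / (n + 1) of the n-th term turns a Cauchy sequence of classes
  into one Cauchy sequence b in B; the class of b is the limit.\<close>

theorem cstar_algebra_completion: "cstar_algebra C"
proof -
  interpret N: pre_cstar_algebra C by (rule pre_cstar_C)
  show ?thesis
  proof (rule N.cstar_algebraI)
    fix U assume U: "U \<in> cauchy_seqs C (nrm C)"
    then have UC [simp]: "U n \<in> carrier C" for n by (auto simp: cauchy_seqs_def)
    have "\<exists>b\<in>carrier B. nrm C (emb b \<ominus>\<^bsub>C\<^esub> U n) < 1 / real (Suc n)" for n
    proof -
      obtain X where X: "\<And>k. X k \<in> carrier B" "slim C (nrm C) (\<lambda>k. emb (X k)) (U n)"
        using emb_dense[OF UC] by blast
      have "\<forall>\<^sub>F k in sequentially. nrm C (emb (X k) \<ominus>\<^bsub>C\<^esub> U n) < 1 / real (Suc n)"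
        using X(2) by (intro order_tendstoD(2)[of _ 0]) (auto simp: slim_def)
      then show ?thesis using X(1) by (auto simp: eventually_sequentially)
    qed
    then obtain b where b [simp]: "\<And>n. b n \<in> carrier B"
      and bU: "\<And>n. nrm C (emb (b n) \<ominus>\<^bsub>C\<^esub> U n) < 1 / real (Suc n)" by metis
    have inv0: "(\<lambda>n. 1 / real (Suc n)) \<longlonglongrightarrow> 0" using LIMSEQ_Suc[OF lim_1_over_n] by simp
    have "b \<in> CS"
      unfolding cauchy_seqs_def
    proof (intro CollectI conjI allI impI)
      fix e :: real assume e: "e > 0"
      have "\<forall>e>0. \<exists>M. \<forall>m\<ge>M. \<forall>n\<ge>M. nrm C (U m \<ominus>\<^bsub>C\<^esub> U n) < e"
        using U by (simp add: cauchy_seqs_def)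
      moreover have "e / 3 > 0" using e by simp
      ultimately obtain M where M: "\<And>m n. \<lbrakk>m \<ge> M; n \<ge> M\<rbrakk> \<Longrightarrow> nrm C (U m \<ominus>\<^bsub>C\<^esub> U n) < e / 3"
        by meson
      obtain L where L: "\<And>n. n \<ge> L \<Longrightarrow> 1 / real (Suc n) < e / 3"
        using order_tendstoD(2)[OF inv0, of "e / 3"] e by (auto simp: eventually_sequentially)
      have "p (b m \<ominus> b n) < e" if "m \<ge> max M L" "n \<ge> max M L" for m n
      proof -
        have "p (b m \<ominus> b n) = nrm C (emb (b m) \<ominus>\<^bsub>C\<^esub> emb (b n))"
          by (simp add: diff_C nrm_emb)
        also have "\<dots> \<le> nrm C (emb (b m) \<ominus>\<^bsub>C\<^esub> U m) + nrm C (U m \<ominus>\<^bsub>C\<^esub> U n) + nrm C (emb (b n) \<ominus>\<^bsub>C\<^esub> U n)"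
          using N.N.p_diff_triangle[of "emb (b m)" "U m" "emb (b n)"]
            N.N.p_diff_triangle[of "U m" "U n" "emb (b n)"] N.N.p_diff_comm[of "U n" "emb (b n)"] by simp
        also have "\<dots> < e / 3 + e / 3 + e / 3"
          using that M[of m n] bU[of m] bU[of n] L[of m] L[of n] by (intro add_strict_mono) auto
        finally show ?thesis by simp
      qed
      then show "\<exists>N. \<forall>m\<ge>N. \<forall>n\<ge>N. p (b m \<ominus> b n) < e" by blast
    qed auto
    moreover have "slim C (nrm C) U (cls b)"
    proof (rule N.N.slim_squeeze)
      show "(\<lambda>n. 1 / real (Suc n) + nrm C (emb (b n) \<ominus>\<^bsub>C\<^esub> cls b)) \<longlonglongrightarrow> 0"
        using emb_slim[OF \<open>b \<in> CS\<close>] inv0 by (intro tendsto_add_zero) (auto simp: slim_def)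
      show "nrm C (U n \<ominus>\<^bsub>C\<^esub> cls b) \<le> 1 / real (Suc n) + nrm C (emb (b n) \<ominus>\<^bsub>C\<^esub> cls b)" for n
        using N.N.p_diff_triangle[of "U n" "emb (b n)" "cls b"] N.N.p_diff_comm[of "U n" "emb (b n)"]
          bU[of n] \<open>b \<in> CS\<close> by simp
    qed (use \<open>b \<in> CS\<close> in auto)
    ultimately show "\<exists>V. slim C (nrm C) U V" by blast
  qed
qed

end

section \<open>The algebraic partial crossed product\<close>

lemma star_isomorphism_imp_star_hom: "star_isomorphism A B \<phi> \<Longrightarrow> star_hom A B \<phi>"
  by (auto simp: star_isomorphism_def star_hom_def bij_betw_def)

lemma (in star_algebra) finsum_in_ideal:
  assumes J: "two_sided_ideal J A" and "finite S" "\<And>s. s \<in> S \<Longrightarrow> f s \<in> J"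
  shows "finsum A f S \<in> J"
  using assms(2,3)
proof (induction S)
  case empty then show ?case using two_sided_idealD(2)[OF J] by simp
next
  case (insert s S)
  then have "f \<in> S \<rightarrow> carrier A" "f s \<in> carrier A" using two_sided_idealD(1)[OF J] by auto
  then show ?case using insert by (simp add: two_sided_idealD(3)[OF J])
qed

context partial_action
begin

lemma I_two_sided: "s \<in> carrier \<Gamma> \<Longrightarrow> two_sided_ideal (I s) A"
  using ideal closed_ideal_two_sided by blast

lemma I_carrier: "\<lbrakk>s \<in> carrier \<Gamma>; x \<in> I s\<rbrakk> \<Longrightarrow> x \<in> carrier A"
  using two_sided_idealD(1)[OF I_two_sided] by blast

lemma I_closed [simp]:
  assumes "s \<in> carrier \<Gamma>"
  shows "\<zero>\<^bsub>A\<^esub> \<in> I s" "\<lbrakk>x \<in> I s; y \<in> I s\<rbrakk> \<Longrightarrow> x \<oplus>\<^bsub>A\<^esub> y \<in> I s" "x \<in> I s \<Longrightarrow> c \<odot>\<^bsub>A\<^esub> x \<in> I s"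
    "\<lbrakk>a \<in> carrier A; x \<in> I s\<rbrakk> \<Longrightarrow> a \<otimes>\<^bsub>A\<^esub> x \<in> I s" "\<lbrakk>a \<in> carrier A; x \<in> I s\<rbrakk> \<Longrightarrow> x \<otimes>\<^bsub>A\<^esub> a \<in> I s"
    "x \<in> I s \<Longrightarrow> star A x \<in> I s"
  using two_sided_idealD[OF I_two_sided[OF assms]] closed_ideal_star[OF ideal[OF assms]] by auto

lemma theta_hom: "s \<in> carrier \<Gamma> \<Longrightarrow> star_hom (A\<lparr>carrier := I (inv\<^bsub>\<Gamma>\<^esub> s)\<rparr>) (A\<lparr>carrier := I s\<rparr>) (\<theta> s)"
  by (intro star_isomorphism_imp_star_hom iso)

lemma theta_closed [simp]: "\<lbrakk>s \<in> carrier \<Gamma>; x \<in> I (inv\<^bsub>\<Gamma>\<^esub> s)\<rbrakk> \<Longrightarrow> \<theta> s x \<in> I s"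
  and theta_add: "\<lbrakk>s \<in> carrier \<Gamma>; x \<in> I (inv\<^bsub>\<Gamma>\<^esub> s); y \<in> I (inv\<^bsub>\<Gamma>\<^esub> s)\<rbrakk> \<Longrightarrow> \<theta> s (x \<oplus>\<^bsub>A\<^esub> y) = \<theta> s x \<oplus>\<^bsub>A\<^esub> \<theta> s y"
  and theta_smult: "\<lbrakk>s \<in> carrier \<Gamma>; x \<in> I (inv\<^bsub>\<Gamma>\<^esub> s)\<rbrakk> \<Longrightarrow> \<theta> s (c \<odot>\<^bsub>A\<^esub> x) = c \<odot>\<^bsub>A\<^esub> \<theta> s x"
  and theta_mult: "\<lbrakk>s \<in> carrier \<Gamma>; x \<in> I (inv\<^bsub>\<Gamma>\<^esub> s); y \<in> I (inv\<^bsub>\<Gamma>\<^esub> s)\<rbrakk> \<Longrightarrow> \<theta> s (x \<otimes>\<^bsub>A\<^esub> y) = \<theta> s x \<otimes>\<^bsub>A\<^esub> \<theta> s y"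
  and theta_star: "\<lbrakk>s \<in> carrier \<Gamma>; x \<in> I (inv\<^bsub>\<Gamma>\<^esub> s)\<rbrakk> \<Longrightarrow> \<theta> s (star A x) = star A (\<theta> s x)"
  using star_homD[OF theta_hom] by auto

lemma theta_carrier [simp]: "\<lbrakk>s \<in> carrier \<Gamma>; x \<in> I (inv\<^bsub>\<Gamma>\<^esub> s)\<rbrakk> \<Longrightarrow> \<theta> s x \<in> carrier A"
  using theta_closed I_carrier by blast

lemma theta_inv_closed [simp]: "\<lbrakk>s \<in> carrier \<Gamma>; x \<in> I s\<rbrakk> \<Longrightarrow> \<theta> (inv\<^bsub>\<Gamma>\<^esub> s) x \<in> I (inv\<^bsub>\<Gamma>\<^esub> s)"
  by simp

lemma theta_zero [simp]: "s \<in> carrier \<Gamma> \<Longrightarrow> \<theta> s \<zero>\<^bsub>A\<^esub> = \<zero>\<^bsub>A\<^esub>"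
  using theta_smult[of s "\<zero>\<^bsub>A\<^esub>" 0] by simp

lemma theta_inv [simp]: "\<lbrakk>s \<in> carrier \<Gamma>; x \<in> I (inv\<^bsub>\<Gamma>\<^esub> s)\<rbrakk> \<Longrightarrow> \<theta> (inv\<^bsub>\<Gamma>\<^esub> s) (\<theta> s x) = x"
  using mult_action[of s "inv\<^bsub>\<Gamma>\<^esub> s" x] one_action[of x] I_carrier[of "inv\<^bsub>\<Gamma>\<^esub> s" x] by simp

lemma theta_inv' [simp]: "\<lbrakk>s \<in> carrier \<Gamma>; x \<in> I s\<rbrakk> \<Longrightarrow> \<theta> s (\<theta> (inv\<^bsub>\<Gamma>\<^esub> s) x) = x"
  using theta_inv[of "inv\<^bsub>\<Gamma>\<^esub> s" x] by simp

text \<open>The axiom on domains, read at the point \<open>\<theta> s x\<close> with the inverses of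
  s and t in place of s and t.\<close>

lemma theta_dom:
  assumes "s \<in> carrier \<Gamma>" "t \<in> carrier \<Gamma>" "x \<in> I (inv\<^bsub>\<Gamma>\<^esub> s)" "x \<in> I t"
  shows "\<theta> s x \<in> I (s \<otimes>\<^bsub>\<Gamma>\<^esub> t)"
  using mult_domain[of "inv\<^bsub>\<Gamma>\<^esub> s" "inv\<^bsub>\<Gamma>\<^esub> t" "\<theta> s x"] assms by (simp add: \<Gamma>.inv_mult_group)

text \<open>The axiom asks that \<open>\<theta> s x\<close> lie in the domain of \<theta> t. Here x
  is asked to lie in the domain for the product index instead, and \<open>theta_dom\<close>
  mediates.\<close>

lemma theta_comp:
  assumes "s \<in> carrier \<Gamma>" "t \<in> carrier \<Gamma>" "x \<in> I (inv\<^bsub>\<Gamma>\<^esub> s)" "x \<in> I (inv\<^bsub>\<Gamma>\<^esub> (t \<otimes>\<^bsub>\<Gamma>\<^esub> s))"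
  shows "\<theta> t (\<theta> s x) = \<theta> (t \<otimes>\<^bsub>\<Gamma>\<^esub> s) x"
proof -
  have "s \<otimes>\<^bsub>\<Gamma>\<^esub> inv\<^bsub>\<Gamma>\<^esub> (t \<otimes>\<^bsub>\<Gamma>\<^esub> s) = inv\<^bsub>\<Gamma>\<^esub> t"
    using assms by (simp add: \<Gamma>.inv_mult_group \<Gamma>.m_assoc[symmetric])
  then have "\<theta> s x \<in> I (inv\<^bsub>\<Gamma>\<^esub> t)"
    using theta_dom[of s "inv\<^bsub>\<Gamma>\<^esub> (t \<otimes>\<^bsub>\<Gamma>\<^esub> s)" x] assms by simp
  then show ?thesis using mult_action[of s t x] assms by simp
qed

text \<open>The norm pulled back along \<theta> s is a C*-seminorm on the domain of \<theta> s,
  which is itself a C*-algebra; so it is at most the norm there. Isometry follows by applying this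
  to the inverse as well.\<close>

lemma nrm_theta_le:
  assumes s: "s \<in> carrier \<Gamma>" and x: "x \<in> I (inv\<^bsub>\<Gamma>\<^esub> s)"
  shows "nrm A (\<theta> s x) \<le> nrm A x"
proof -
  interpret J: cstar_algebra "A\<lparr>carrier := I (inv\<^bsub>\<Gamma>\<^esub> s)\<rparr>"
    by (rule cstar_algebra_closed_ideal) (use s ideal in simp)
  interpret K: cstar_algebra "A\<lparr>carrier := I s\<rparr>"
    by (rule cstar_algebra_closed_ideal) (use s ideal in simp)
  have "cstar_seminorm (A\<lparr>carrier := I (inv\<^bsub>\<Gamma>\<^esub> s)\<rparr>) (\<lambda>x. nrm (A\<lparr>carrier := I s\<rparr>) (\<theta> s x))"
    by (rule cstar_seminorm_pullback[OF J.star_algebra_axioms theta_hom[OF s] K.cstar_seminorm_axioms])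
  from J.cstar_seminorm_le_norm[OF this, of x] x show ?thesis by simp
qed

lemma nrm_theta:
  assumes s: "s \<in> carrier \<Gamma>" and x: "x \<in> I (inv\<^bsub>\<Gamma>\<^esub> s)"
  shows "nrm A (\<theta> s x) = nrm A x"
  using nrm_theta_le[OF s x] nrm_theta_le[of "inv\<^bsub>\<Gamma>\<^esub> s" "\<theta> s x"] s x by simp

text \<open>Both sides lie in the ideal \<open>I s\<close>, on which left multiplication by elements of \<open>I s\<close> is
  faithful, and \<open>w \<in> I s\<close> can be moved inside \<open>\<theta> s\<close>.\<close>

lemma theta_left_mult:
  assumes s: "s \<in> carrier \<Gamma>" and a: "a \<in> carrier A" and b: "b \<in> I s" and c: "c \<in> carrier A"
  shows "\<theta> s (\<theta> (inv\<^bsub>\<Gamma>\<^esub> s) (a \<otimes>\<^bsub>A\<^esub> b) \<otimes>\<^bsub>A\<^esub> c) = a \<otimes>\<^bsub>A\<^esub> \<theta> s (\<theta> (inv\<^bsub>\<Gamma>\<^esub> s) b \<otimes>\<^bsub>A\<^esub> c)"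
proof -
  have move: "w \<otimes>\<^bsub>A\<^esub> \<theta> s (\<theta> (inv\<^bsub>\<Gamma>\<^esub> s) y \<otimes>\<^bsub>A\<^esub> c) = \<theta> s (\<theta> (inv\<^bsub>\<Gamma>\<^esub> s) (w \<otimes>\<^bsub>A\<^esub> y) \<otimes>\<^bsub>A\<^esub> c)"
    if w: "w \<in> I s" and y: "y \<in> I s" for w y
  proof -
    have wy: "w \<in> carrier A" "y \<in> carrier A" "\<theta> (inv\<^bsub>\<Gamma>\<^esub> s) w \<in> carrier A" "\<theta> (inv\<^bsub>\<Gamma>\<^esub> s) y \<in> carrier A"
      using w y s I_carrier[OF s] by auto
    have "\<theta> s (\<theta> (inv\<^bsub>\<Gamma>\<^esub> s) (w \<otimes>\<^bsub>A\<^esub> y) \<otimes>\<^bsub>A\<^esub> c)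
      = \<theta> s (\<theta> (inv\<^bsub>\<Gamma>\<^esub> s) w \<otimes>\<^bsub>A\<^esub> (\<theta> (inv\<^bsub>\<Gamma>\<^esub> s) y \<otimes>\<^bsub>A\<^esub> c))"
      using s w y c wy by (simp add: theta_mult m_assoc)
    also have "\<dots> = \<theta> s (\<theta> (inv\<^bsub>\<Gamma>\<^esub> s) w) \<otimes>\<^bsub>A\<^esub> \<theta> s (\<theta> (inv\<^bsub>\<Gamma>\<^esub> s) y \<otimes>\<^bsub>A\<^esub> c)"
      using s w y c by (intro theta_mult) auto
    finally show ?thesis using s w by simp
  qed
  define L where "L = \<theta> s (\<theta> (inv\<^bsub>\<Gamma>\<^esub> s) (a \<otimes>\<^bsub>A\<^esub> b) \<otimes>\<^bsub>A\<^esub> c)"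
  define R where "R = a \<otimes>\<^bsub>A\<^esub> \<theta> s (\<theta> (inv\<^bsub>\<Gamma>\<^esub> s) b \<otimes>\<^bsub>A\<^esub> c)"
  have mem: "L \<in> I s" "R \<in> I s" using s a b c by (simp_all add: L_def R_def)
  have memA: "L \<in> carrier A" "R \<in> carrier A" using mem I_carrier s by auto
  have "L \<ominus>\<^bsub>A\<^esub> R = \<zero>\<^bsub>A\<^esub>"
  proof (rule closed_ideal_nondegenerate[OF _ ideal[OF s]])
    show "L \<ominus>\<^bsub>A\<^esub> R \<in> I s" using mem s memA by (simp add: minus_sm)
    fix w assume w: "w \<in> I s"
    have wA: "w \<in> carrier A" using w s I_carrier by blast
    have bA: "b \<in> carrier A" using b s I_carrier by blast
    have "w \<otimes>\<^bsub>A\<^esub> L = \<theta> s (\<theta> (inv\<^bsub>\<Gamma>\<^esub> s) ((w \<otimes>\<^bsub>A\<^esub> a) \<otimes>\<^bsub>A\<^esub> b) \<otimes>\<^bsub>A\<^esub> c)"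
      unfolding L_def using s a b w wA bA by (subst move) (simp_all add: m_assoc)
    also have "\<dots> = (w \<otimes>\<^bsub>A\<^esub> a) \<otimes>\<^bsub>A\<^esub> \<theta> s (\<theta> (inv\<^bsub>\<Gamma>\<^esub> s) b \<otimes>\<^bsub>A\<^esub> c)"
      using s a b w by (subst move) simp_all
    also have "\<dots> = w \<otimes>\<^bsub>A\<^esub> R"
      unfolding R_def using s a b c wA by (intro m_assoc) simp_all
    finally show "w \<otimes>\<^bsub>A\<^esub> (L \<ominus>\<^bsub>A\<^esub> R) = \<zero>\<^bsub>A\<^esub>" using wA memA by (simp add: mult_diff_r)
  qed
  then show ?thesis using diff_eq_zero[OF memA] by (simp add: L_def R_def)
qed

section \<open>The *-algebra structure of the algebraic crossed product\<close>

abbreviation "X \<equiv> algebraic_crossed_product A \<Gamma> I \<theta>"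
abbreviation "\<delta> a s \<equiv> (\<lambda>t. if t = s then a else \<zero>\<^bsub>A\<^esub>)"

lemma X_carrier:
  "f \<in> carrier X \<longleftrightarrow> (\<forall>s\<in>carrier \<Gamma>. f s \<in> I s) \<and> (\<forall>s. s \<notin> carrier \<Gamma> \<longrightarrow> f s = \<zero>\<^bsub>A\<^esub>) \<and>
     finite {s. f s \<noteq> \<zero>\<^bsub>A\<^esub>}"
  by (simp add: algebraic_crossed_product_def)

lemma X_ops: "\<zero>\<^bsub>X\<^esub> = (\<lambda>r. \<zero>\<^bsub>A\<^esub>)" "f \<oplus>\<^bsub>X\<^esub> g = (\<lambda>r. f r \<oplus>\<^bsub>A\<^esub> g r)" "c \<odot>\<^bsub>X\<^esub> f = (\<lambda>r. c \<odot>\<^bsub>A\<^esub> f r)"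
  "star X f = (\<lambda>r. if r \<in> carrier \<Gamma> then \<theta> r (star A (f (inv\<^bsub>\<Gamma>\<^esub> r))) else \<zero>\<^bsub>A\<^esub>)"
  by (simp_all add: algebraic_crossed_product_def)

lemma X_I: "\<lbrakk>f \<in> carrier X; s \<in> carrier \<Gamma>\<rbrakk> \<Longrightarrow> f s \<in> I s"
  and X_outside: "\<lbrakk>f \<in> carrier X; s \<notin> carrier \<Gamma>\<rbrakk> \<Longrightarrow> f s = \<zero>\<^bsub>A\<^esub>"
  and X_finite: "f \<in> carrier X \<Longrightarrow> finite {s. f s \<noteq> \<zero>\<^bsub>A\<^esub>}"
  by (auto simp: X_carrier)

lemma X_A [simp]: "f \<in> carrier X \<Longrightarrow> f s \<in> carrier A"
  using X_I[of f s] X_outside[of f s] I_carrier[of s "f s"] by (cases "s \<in> carrier \<Gamma>") simp_all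

lemma X_support: "f \<in> carrier X \<Longrightarrow> {s. f s \<noteq> \<zero>\<^bsub>A\<^esub>} \<subseteq> carrier \<Gamma>"
  using X_outside by blast

lemma delta_closed [simp]: "\<lbrakk>s \<in> carrier \<Gamma>; a \<in> I s\<rbrakk> \<Longrightarrow> \<delta> a s \<in> carrier X"
  by (auto simp: X_carrier intro: finite_subset[of _ "{s}"])

lemma X_zero [simp]: "\<zero>\<^bsub>X\<^esub> \<in> carrier X"
  by (simp add: X_carrier X_ops)

lemma X_add [simp]:
  assumes "f \<in> carrier X" "g \<in> carrier X"
  shows "f \<oplus>\<^bsub>X\<^esub> g \<in> carrier X"
proof -
  have "finite {s. f s \<oplus>\<^bsub>A\<^esub> g s \<noteq> \<zero>\<^bsub>A\<^esub>}"
    by (rule finite_subset[OF _ finite_UnI[OF X_finite[OF assms(1)] X_finite[OF assms(2)]]]) auto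
  then show ?thesis using assms by (auto simp: X_carrier X_ops)
qed

lemma X_smult [simp]:
  assumes "f \<in> carrier X"
  shows "c \<odot>\<^bsub>X\<^esub> f \<in> carrier X"
proof -
  have "finite {s. c \<odot>\<^bsub>A\<^esub> f s \<noteq> \<zero>\<^bsub>A\<^esub>}"
    by (rule finite_subset[OF _ X_finite[OF assms]]) auto
  then show ?thesis using assms by (auto simp: X_carrier X_ops)
qed

lemma star_support:
  "{s. star X f s \<noteq> \<zero>\<^bsub>A\<^esub>} \<subseteq> (\<lambda>s. inv\<^bsub>\<Gamma>\<^esub> s) ` {s. f s \<noteq> \<zero>\<^bsub>A\<^esub>}"
proof
  fix s assume "s \<in> {s. star X f s \<noteq> \<zero>\<^bsub>A\<^esub>}"
  then have "s \<in> carrier \<Gamma>" "f (inv\<^bsub>\<Gamma>\<^esub> s) \<noteq> \<zero>\<^bsub>A\<^esub>" by (auto simp: X_ops split: if_splits)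
  then show "s \<in> (\<lambda>s. inv\<^bsub>\<Gamma>\<^esub> s) ` {s. f s \<noteq> \<zero>\<^bsub>A\<^esub>}"
    by (intro image_eqI[of _ _ "inv\<^bsub>\<Gamma>\<^esub> s"]) auto
qed

lemma X_star [simp]:
  assumes "f \<in> carrier X"
  shows "star X f \<in> carrier X"
proof -
  have "finite {s. star X f s \<noteq> \<zero>\<^bsub>A\<^esub>}" 
    by (rule finite_surj[OF X_finite[OF assms] star_support])
  moreover have "\<forall>s\<in>carrier \<Gamma>. star X f s \<in> I s" using assms X_I by (auto simp: X_ops)
  moreover have "\<forall>s. s \<notin> carrier \<Gamma> \<longrightarrow> star X f s = \<zero>\<^bsub>A\<^esub>" by (simp add: X_ops)
  ultimately show ?thesis by (simp add: X_carrier)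
qed

lemma term_in:
  assumes "a \<in> I s" "b \<in> I (inv\<^bsub>\<Gamma>\<^esub> s \<otimes>\<^bsub>\<Gamma>\<^esub> r)" "s \<in> carrier \<Gamma>" "r \<in> carrier \<Gamma>"
  shows "\<theta> s (\<theta> (inv\<^bsub>\<Gamma>\<^esub> s) a \<otimes>\<^bsub>A\<^esub> b) \<in> I r"
proof -
  have b: "b \<in> carrier A" by (rule I_carrier[OF _ assms(2)]) (use assms in simp)
  have "\<theta> s (\<theta> (inv\<^bsub>\<Gamma>\<^esub> s) a \<otimes>\<^bsub>A\<^esub> b) \<in> I (s \<otimes>\<^bsub>\<Gamma>\<^esub> (inv\<^bsub>\<Gamma>\<^esub> s \<otimes>\<^bsub>\<Gamma>\<^esub> r))"
    using assms b by (intro theta_dom) simp_all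
  then show ?thesis using assms by (simp add: \<Gamma>.m_assoc[symmetric])
qed

abbreviation "summand f g r s \<equiv> \<theta> s (\<theta> (inv\<^bsub>\<Gamma>\<^esub> s) (f s) \<otimes>\<^bsub>A\<^esub> g (inv\<^bsub>\<Gamma>\<^esub> s \<otimes>\<^bsub>\<Gamma>\<^esub> r))"

lemma summand_in: "\<lbrakk>f \<in> carrier X; g \<in> carrier X; s \<in> carrier \<Gamma>; r \<in> carrier \<Gamma>\<rbrakk> \<Longrightarrow> summand f g r s \<in> I r"
  by (rule term_in) (simp_all add: X_I)

lemma summand_A [simp]: "\<lbrakk>f \<in> carrier X; g \<in> carrier X; s \<in> carrier \<Gamma>; r \<in> carrier \<Gamma>\<rbrakk> \<Longrightarrow> summand f g r s \<in> carrier A"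
  by (rule I_carrier[OF _ summand_in])

text \<open>The index set may be any finite set containing the support of f, which lets the sums for
  different functions be taken over a common set.\<close>

lemma mult_X:
  assumes f: "f \<in> carrier X" and g: "g \<in> carrier X" and S: "finite S" "S \<subseteq> carrier \<Gamma>" "{s. f s \<noteq> \<zero>\<^bsub>A\<^esub>} \<subseteq> S"
    and r: "r \<in> carrier \<Gamma>"
  shows "(f \<otimes>\<^bsub>X\<^esub> g) r = finsum A (summand f g r) S"
proof -
  have "(f \<otimes>\<^bsub>X\<^esub> g) r = finsum A (summand f g r) {s \<in> carrier \<Gamma>. f s \<noteq> \<zero>\<^bsub>A\<^esub>}"
    using r by (simp add: algebraic_crossed_product_def)
  also have "\<dots> = finsum A (summand f g r) S"
  proof (rule M.add.finprod_mono_neutral_cong_left)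
    show "summand f g r i = \<zero>\<^bsub>A\<^esub>" if "i \<in> S - {s \<in> carrier \<Gamma>. f s \<noteq> \<zero>\<^bsub>A\<^esub>}" for i
      using that S r g by (auto simp: subset_eq)
  qed (use S f g r in \<open>auto simp: subset_eq\<close>)
  finally show ?thesis .
qed

lemma mult_X_outside: "r \<notin> carrier \<Gamma> \<Longrightarrow> (f \<otimes>\<^bsub>X\<^esub> g) r = \<zero>\<^bsub>A\<^esub>"
  by (simp add: algebraic_crossed_product_def)

text \<open>Gives finiteness of the support of a product, and later locates the support of
  \<open>star X F \<otimes> F\<close> for F living over a single element of H.\<close>

lemma mult_support:
  assumes f: "f \<in> carrier X" and g: "g \<in> carrier X"
  shows "{r. (f \<otimes>\<^bsub>X\<^esub> g) r \<noteq> \<zero>\<^bsub>A\<^esub>} \<subseteq> (\<lambda>(s, t). s \<otimes>\<^bsub>\<Gamma>\<^esub> t) ` ({s. f s \<noteq> \<zero>\<^bsub>A\<^esub>} \<times> {t. g t \<noteq> \<zero>\<^bsub>A\<^esub>})"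
proof
  let ?S = "{s. f s \<noteq> \<zero>\<^bsub>A\<^esub>}"
  have S: "finite ?S" "?S \<subseteq> carrier \<Gamma>" using f by (simp_all add: X_finite X_support)
  note eq = mult_X[OF f g S subset_refl]
  fix r assume "r \<in> {r. (f \<otimes>\<^bsub>X\<^esub> g) r \<noteq> \<zero>\<^bsub>A\<^esub>}"
  then have fg: "(f \<otimes>\<^bsub>X\<^esub> g) r \<noteq> \<zero>\<^bsub>A\<^esub>" by simp
  then have r: "r \<in> carrier \<Gamma>" using mult_X_outside by blast
  have "\<exists>s\<in>?S. summand f g r s \<noteq> \<zero>\<^bsub>A\<^esub>"
    using fg M.add.finprod_one_eqI[of ?S "summand f g r"] eq[OF r] by auto
  then obtain s where s: "s \<in> ?S" "summand f g r s \<noteq> \<zero>\<^bsub>A\<^esub>" by blast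
  have s': "s \<in> carrier \<Gamma>" using s(1) S by blast
  have "g (inv\<^bsub>\<Gamma>\<^esub> s \<otimes>\<^bsub>\<Gamma>\<^esub> r) \<noteq> \<zero>\<^bsub>A\<^esub>"
  proof
    assume "g (inv\<^bsub>\<Gamma>\<^esub> s \<otimes>\<^bsub>\<Gamma>\<^esub> r) = \<zero>\<^bsub>A\<^esub>"
    then show False using s(2) s' X_I[OF f s'] by simp
  qed
  then show "r \<in> (\<lambda>(s, t). s \<otimes>\<^bsub>\<Gamma>\<^esub> t) ` (?S \<times> {t. g t \<noteq> \<zero>\<^bsub>A\<^esub>})"
    using s(1) r s' by (intro image_eqI[of _ _ "(s, inv\<^bsub>\<Gamma>\<^esub> s \<otimes>\<^bsub>\<Gamma>\<^esub> r)"]) (auto simp: \<Gamma>.m_assoc[symmetric])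
qed

lemma X_mult [simp]:
  assumes f: "f \<in> carrier X" and g: "g \<in> carrier X"
  shows "f \<otimes>\<^bsub>X\<^esub> g \<in> carrier X"
proof -
  let ?S = "{s. f s \<noteq> \<zero>\<^bsub>A\<^esub>}"
  have S: "finite ?S" "?S \<subseteq> carrier \<Gamma>" using f by (simp_all add: X_finite X_support)
  note eq = mult_X[OF f g S subset_refl]
  have "(f \<otimes>\<^bsub>X\<^esub> g) r \<in> I r" if r: "r \<in> carrier \<Gamma>" for r
    unfolding eq[OF r] using S r f g by (intro finsum_in_ideal[OF I_two_sided]) (auto intro: summand_in)
  moreover have "finite {r. (f \<otimes>\<^bsub>X\<^esub> g) r \<noteq> \<zero>\<^bsub>A\<^esub>}"
    by (rule finite_subset[OF mult_support[OF f g]]) (use f g in \<open>simp add: X_finite\<close>)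
  ultimately show ?thesis using mult_X_outside by (simp add: X_carrier)
qed

lemma mult_add_l:
  assumes f: "f \<in> carrier X" and f': "f' \<in> carrier X" and g: "g \<in> carrier X"
  shows "(f \<oplus>\<^bsub>X\<^esub> f') \<otimes>\<^bsub>X\<^esub> g = (f \<otimes>\<^bsub>X\<^esub> g) \<oplus>\<^bsub>X\<^esub> (f' \<otimes>\<^bsub>X\<^esub> g)"
proof
  fix r
  let ?S = "{s. f s \<noteq> \<zero>\<^bsub>A\<^esub>} \<union> {s. f' s \<noteq> \<zero>\<^bsub>A\<^esub>}"
  have S: "finite ?S" "?S \<subseteq> carrier \<Gamma>" using f f' X_support by (simp_all add: X_finite)
  show "((f \<oplus>\<^bsub>X\<^esub> f') \<otimes>\<^bsub>X\<^esub> g) r = ((f \<otimes>\<^bsub>X\<^esub> g) \<oplus>\<^bsub>X\<^esub> (f' \<otimes>\<^bsub>X\<^esub> g)) r"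
  proof (cases "r \<in> carrier \<Gamma>")
    case r: True
    have supp: "{s. (f \<oplus>\<^bsub>X\<^esub> f') s \<noteq> \<zero>\<^bsub>A\<^esub>} \<subseteq> ?S" by (auto simp: X_ops)
    have "((f \<oplus>\<^bsub>X\<^esub> f') \<otimes>\<^bsub>X\<^esub> g) r = finsum A (summand (f \<oplus>\<^bsub>X\<^esub> f') g r) ?S"
      by (rule mult_X[OF X_add[OF f f'] g S supp r])
    also have "\<dots> = finsum A (\<lambda>s. summand f g r s \<oplus>\<^bsub>A\<^esub> summand f' g r s) ?S"
    proof (rule M.finsum_cong'[OF refl])
      show "(\<lambda>s. summand f g r s \<oplus>\<^bsub>A\<^esub> summand f' g r s) \<in> ?S \<rightarrow> carrier A"
        using S(2) f f' g r by auto
      fix s assume "s \<in> ?S"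
      then have s: "s \<in> carrier \<Gamma>" using S(2) by blast
      have "f s \<in> I s" "f' s \<in> I s" "g (inv\<^bsub>\<Gamma>\<^esub> s \<otimes>\<^bsub>\<Gamma>\<^esub> r) \<in> carrier A"
        using f f' g s by (simp_all add: X_I)
      then show "summand (f \<oplus>\<^bsub>X\<^esub> f') g r s = summand f g r s \<oplus>\<^bsub>A\<^esub> summand f' g r s"
        using s by (simp add: X_ops theta_add l_distr)
    qed
    also have "\<dots> = finsum A (summand f g r) ?S \<oplus>\<^bsub>A\<^esub> finsum A (summand f' g r) ?S"
      by (rule M.finsum_addf) (use S(2) f f' g r in auto)
    also have "\<dots> = ((f \<otimes>\<^bsub>X\<^esub> g) \<oplus>\<^bsub>X\<^esub> (f' \<otimes>\<^bsub>X\<^esub> g)) r"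
      unfolding X_ops(2) using mult_X[OF f g S _ r] mult_X[OF f' g S _ r] by simp
    finally show ?thesis .
  qed (simp add: X_ops mult_X_outside)
qed

lemma mult_add_r:
  assumes f: "f \<in> carrier X" and g: "g \<in> carrier X" and g': "g' \<in> carrier X"
  shows "f \<otimes>\<^bsub>X\<^esub> (g \<oplus>\<^bsub>X\<^esub> g') = (f \<otimes>\<^bsub>X\<^esub> g) \<oplus>\<^bsub>X\<^esub> (f \<otimes>\<^bsub>X\<^esub> g')"
proof
  fix r
  let ?S = "{s. f s \<noteq> \<zero>\<^bsub>A\<^esub>}"
  have S: "finite ?S" "?S \<subseteq> carrier \<Gamma>" using f X_support by (simp_all add: X_finite)
  show "(f \<otimes>\<^bsub>X\<^esub> (g \<oplus>\<^bsub>X\<^esub> g')) r = ((f \<otimes>\<^bsub>X\<^esub> g) \<oplus>\<^bsub>X\<^esub> (f \<otimes>\<^bsub>X\<^esub> g')) r"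
  proof (cases "r \<in> carrier \<Gamma>")
    case r: True
    have "(f \<otimes>\<^bsub>X\<^esub> (g \<oplus>\<^bsub>X\<^esub> g')) r = finsum A (summand f (g \<oplus>\<^bsub>X\<^esub> g') r) ?S"
      by (rule mult_X[OF f X_add[OF g g'] S subset_refl r])
    also have "\<dots> = finsum A (\<lambda>s. summand f g r s \<oplus>\<^bsub>A\<^esub> summand f g' r s) ?S"
    proof (rule M.finsum_cong'[OF refl])
      show "(\<lambda>s. summand f g r s \<oplus>\<^bsub>A\<^esub> summand f g' r s) \<in> ?S \<rightarrow> carrier A"
        using S(2) f g g' r by auto
      fix s assume "s \<in> ?S"
      then have s: "s \<in> carrier \<Gamma>" using S(2) by blast
      have "f s \<in> I s" "g (inv\<^bsub>\<Gamma>\<^esub> s \<otimes>\<^bsub>\<Gamma>\<^esub> r) \<in> carrier A" "g' (inv\<^bsub>\<Gamma>\<^esub> s \<otimes>\<^bsub>\<Gamma>\<^esub> r) \<in> carrier A"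
        using f g g' s by (simp_all add: X_I)
      then show "summand f (g \<oplus>\<^bsub>X\<^esub> g') r s = summand f g r s \<oplus>\<^bsub>A\<^esub> summand f g' r s"
        using s by (simp add: X_ops theta_add r_distr)
    qed
    also have "\<dots> = finsum A (summand f g r) ?S \<oplus>\<^bsub>A\<^esub> finsum A (summand f g' r) ?S"
      by (rule M.finsum_addf) (use S(2) f g g' r in auto)
    also have "\<dots> = ((f \<otimes>\<^bsub>X\<^esub> g) \<oplus>\<^bsub>X\<^esub> (f \<otimes>\<^bsub>X\<^esub> g')) r"
      unfolding X_ops(2) using mult_X[OF f g S _ r] mult_X[OF f g' S _ r] by simp
    finally show ?thesis .
  qed (simp add: X_ops mult_X_outside)
qed

lemma mult_smult:
  assumes f: "f \<in> carrier X" and g: "g \<in> carrier X"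
  shows "(c \<odot>\<^bsub>X\<^esub> f) \<otimes>\<^bsub>X\<^esub> g = c \<odot>\<^bsub>X\<^esub> (f \<otimes>\<^bsub>X\<^esub> g)" (is "?L = ?R")
    and "f \<otimes>\<^bsub>X\<^esub> (c \<odot>\<^bsub>X\<^esub> g) = c \<odot>\<^bsub>X\<^esub> (f \<otimes>\<^bsub>X\<^esub> g)" (is "?L' = ?R")
proof -
  let ?S = "{s. f s \<noteq> \<zero>\<^bsub>A\<^esub>}"
  have S: "finite ?S" "?S \<subseteq> carrier \<Gamma>" using f X_support by (simp_all add: X_finite)
  have supp: "{s. (c \<odot>\<^bsub>X\<^esub> f) s \<noteq> \<zero>\<^bsub>A\<^esub>} \<subseteq> ?S" by (auto simp: X_ops)
  have R: "?R r = finsum A (\<lambda>s. c \<odot>\<^bsub>A\<^esub> summand f g r s) ?S" if r: "r \<in> carrier \<Gamma>" for r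
    unfolding X_ops(3) mult_X[OF f g S subset_refl r]
    using S f g r by (intro finsum_smult_ldistr) auto
  have mem: "f s \<in> I s" "g (inv\<^bsub>\<Gamma>\<^esub> s \<otimes>\<^bsub>\<Gamma>\<^esub> r) \<in> carrier A" if "s \<in> carrier \<Gamma>" for s r
    using f g that by (simp_all add: X_I)
  have "?L r = ?R r" if r: "r \<in> carrier \<Gamma>" for r
    unfolding R[OF r] mult_X[OF X_smult[OF f] g S supp r]
    by (rule M.finsum_cong'[OF refl])
      (use S(2) f g r mem in \<open>auto simp: X_ops(3) theta_smult smult_m_left subset_eq\<close>)
  moreover have "?L' r = ?R r" if r: "r \<in> carrier \<Gamma>" for r
    unfolding R[OF r] mult_X[OF f X_smult[OF g] S subset_refl r]
    by (rule M.finsum_cong'[OF refl])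
      (use S(2) f g r mem in \<open>auto simp: X_ops(3) theta_smult smult_m_right subset_eq\<close>)
  moreover have "?L r = ?R r" "?L' r = ?R r" if "r \<notin> carrier \<Gamma>" for r
    using that by (simp_all add: X_ops(3) mult_X_outside)
  ultimately show "?L = ?R" "?L' = ?R" by blast+
qed

lemma mult_zero_X [simp]:
  assumes "f \<in> carrier X"
  shows "\<zero>\<^bsub>X\<^esub> \<otimes>\<^bsub>X\<^esub> f = \<zero>\<^bsub>X\<^esub>" "f \<otimes>\<^bsub>X\<^esub> \<zero>\<^bsub>X\<^esub> = \<zero>\<^bsub>X\<^esub>"
proof -
  have z: "0 \<odot>\<^bsub>X\<^esub> g = \<zero>\<^bsub>X\<^esub>" if "g \<in> carrier X" for g using that by (simp add: X_ops)
  show "\<zero>\<^bsub>X\<^esub> \<otimes>\<^bsub>X\<^esub> f = \<zero>\<^bsub>X\<^esub>" "f \<otimes>\<^bsub>X\<^esub> \<zero>\<^bsub>X\<^esub> = \<zero>\<^bsub>X\<^esub>"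
    using mult_smult[of "\<zero>\<^bsub>X\<^esub>" f 0] mult_smult[of f "\<zero>\<^bsub>X\<^esub>" 0] assms z[of "\<zero>\<^bsub>X\<^esub>"]
      z[of "\<zero>\<^bsub>X\<^esub> \<otimes>\<^bsub>X\<^esub> f"] z[of "f \<otimes>\<^bsub>X\<^esub> \<zero>\<^bsub>X\<^esub>"] by simp_all
qed

text \<open>The predicate Q carries a condition on coefficients into the step for a single \<delta>.
  With membership in a smaller ideal for Q this becomes induction over an ideal of the crossed
  product.\<close>

lemma delta_induct_values [consumes 2, case_names zero delta add]:
  assumes f: "f \<in> carrier X" and Q: "\<And>s. s \<in> carrier \<Gamma> \<Longrightarrow> Q s (f s)" and zero: "P \<zero>\<^bsub>X\<^esub>"
    and delta: "\<And>a s. \<lbrakk>s \<in> carrier \<Gamma>; a \<in> I s; Q s a\<rbrakk> \<Longrightarrow> P (\<delta> a s)"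
    and add: "\<And>f g. \<lbrakk>f \<in> carrier X; g \<in> carrier X; P f; P g\<rbrakk> \<Longrightarrow> P (f \<oplus>\<^bsub>X\<^esub> g)"
  shows "P f"
proof -
  have "finite S \<Longrightarrow> f \<in> carrier X \<Longrightarrow> {s. f s \<noteq> \<zero>\<^bsub>A\<^esub>} \<subseteq> S \<Longrightarrow> (\<forall>s\<in>S \<inter> carrier \<Gamma>. Q s (f s)) \<Longrightarrow> P f" for S f
  proof (induction S arbitrary: f rule: finite_induct)
    case empty
    then have "f = \<zero>\<^bsub>X\<^esub>" by (auto simp: X_ops)
    then show ?case using zero by simp
  next
    case (insert s S)
    show ?case
    proof (cases "s \<in> carrier \<Gamma>")
      case s: True
      let ?g = "f(s := \<zero>\<^bsub>A\<^esub>)"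
      have "finite {t. ?g t \<noteq> \<zero>\<^bsub>A\<^esub>}"
        by (rule finite_subset[OF _ X_finite[OF insert.prems(1)]]) auto
      then have g: "?g \<in> carrier X" using insert.prems(1) by (auto simp: X_carrier)
      have d: "f s \<in> I s" by (rule X_I) fact+
      have "P ?g" by (rule insert.IH[OF g]) (use insert.prems insert.hyps in auto)
      moreover have "f = ?g \<oplus>\<^bsub>X\<^esub> \<delta> (f s) s"
        using insert.prems(1) by (auto simp: X_ops fun_eq_iff)
      ultimately show ?thesis using add[OF g delta_closed[OF s d]] delta[OF s d] insert.prems(3) s by simp
    next
      case False
      then have "f s = \<zero>\<^bsub>A\<^esub>" using insert.prems(1) by (simp add: X_outside)
      then show ?thesis using insert by (intro insert.IH) auto
    qed
  qed
  then show ?thesis using X_finite[OF f] f Q by blast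
qed

lemma delta_induct [consumes 1, case_names zero delta add]:
  assumes "f \<in> carrier X" "P \<zero>\<^bsub>X\<^esub>" "\<And>a s. \<lbrakk>s \<in> carrier \<Gamma>; a \<in> I s\<rbrakk> \<Longrightarrow> P (\<delta> a s)"
    and "\<And>f g. \<lbrakk>f \<in> carrier X; g \<in> carrier X; P f; P g\<rbrakk> \<Longrightarrow> P (f \<oplus>\<^bsub>X\<^esub> g)"
  shows "P f"
  by (rule delta_induct_values[of f "\<lambda>_ _. True"]) (use assms in auto)

lemma delta_mult:
  assumes s: "s \<in> carrier \<Gamma>" and t: "t \<in> carrier \<Gamma>" and a: "a \<in> I s" and b: "b \<in> I t"
  shows "\<delta> a s \<otimes>\<^bsub>X\<^esub> \<delta> b t = \<delta> (\<theta> s (\<theta> (inv\<^bsub>\<Gamma>\<^esub> s) a \<otimes>\<^bsub>A\<^esub> b)) (s \<otimes>\<^bsub>\<Gamma>\<^esub> t)"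
proof
  fix r
  show "(\<delta> a s \<otimes>\<^bsub>X\<^esub> \<delta> b t) r = \<delta> (\<theta> s (\<theta> (inv\<^bsub>\<Gamma>\<^esub> s) a \<otimes>\<^bsub>A\<^esub> b)) (s \<otimes>\<^bsub>\<Gamma>\<^esub> t) r"
  proof (cases "r \<in> carrier \<Gamma>")
    case r: True
    have "(\<delta> a s \<otimes>\<^bsub>X\<^esub> \<delta> b t) r = finsum A (summand (\<delta> a s) (\<delta> b t) r) {s}"
      by (rule mult_X) (use assms r in auto)
    also have "\<dots> = summand (\<delta> a s) (\<delta> b t) r s"
      using M.add.finprod_insert[of "{}" s "summand (\<delta> a s) (\<delta> b t) r"] summand_A[of "\<delta> a s" "\<delta> b t" s r] assms r
      by (simp split del: if_split)
    also have "\<dots> = \<theta> s (\<theta> (inv\<^bsub>\<Gamma>\<^esub> s) a \<otimes>\<^bsub>A\<^esub> (if inv\<^bsub>\<Gamma>\<^esub> s \<otimes>\<^bsub>\<Gamma>\<^esub> r = t then b else \<zero>\<^bsub>A\<^esub>))"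
      by simp
    also have "\<dots> = \<delta> (\<theta> s (\<theta> (inv\<^bsub>\<Gamma>\<^esub> s) a \<otimes>\<^bsub>A\<^esub> b)) (s \<otimes>\<^bsub>\<Gamma>\<^esub> t) r"
      using s t r a by (auto simp: \<Gamma>.m_assoc[symmetric])
    finally show ?thesis .
  next
    case False
    then have "r \<noteq> s \<otimes>\<^bsub>\<Gamma>\<^esub> t" using s t by auto
    then show ?thesis using False by (simp add: mult_X_outside)
  qed
qed

lemma delta_star:
  assumes s: "s \<in> carrier \<Gamma>" and a: "a \<in> I s"
  shows "star X (\<delta> a s) = \<delta> (\<theta> (inv\<^bsub>\<Gamma>\<^esub> s) (star A a)) (inv\<^bsub>\<Gamma>\<^esub> s)"
  using s a by (auto simp: X_ops fun_eq_iff)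

text \<open>By additivity in each factor only products of three \<delta> remain. There the two sides
  differ by whether a' is multiplied before or after the map for t is applied. That is the
  multiplier identity \<open>theta_left_mult\<close>, so associativity rests on the nondegeneracy of
  closed ideals.\<close>

lemma mult_assoc_X:
  assumes "f \<in> carrier X" "g \<in> carrier X" "h \<in> carrier X"
  shows "(f \<otimes>\<^bsub>X\<^esub> g) \<otimes>\<^bsub>X\<^esub> h = f \<otimes>\<^bsub>X\<^esub> (g \<otimes>\<^bsub>X\<^esub> h)"
proof -
  have base: "(\<delta> a s \<otimes>\<^bsub>X\<^esub> \<delta> b t) \<otimes>\<^bsub>X\<^esub> \<delta> c r = \<delta> a s \<otimes>\<^bsub>X\<^esub> (\<delta> b t \<otimes>\<^bsub>X\<^esub> \<delta> c r)"
    if s: "s \<in> carrier \<Gamma>" and t: "t \<in> carrier \<Gamma>" and r: "r \<in> carrier \<Gamma>"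
      and a: "a \<in> I s" and b: "b \<in> I t" and c: "c \<in> I r" for a b c s t r
  proof -
    let ?s = "inv\<^bsub>\<Gamma>\<^esub> s" and ?t = "inv\<^bsub>\<Gamma>\<^esub> t"
    define a' where "a' = \<theta> ?s a"
    have a': "a' \<in> I ?s" "a' \<in> carrier A" using a s by (simp_all add: a'_def)
    have bA: "b \<in> carrier A" "c \<in> carrier A" using b t c r I_carrier by auto
    have ab: "a' \<otimes>\<^bsub>A\<^esub> b \<in> I ?s" "a' \<otimes>\<^bsub>A\<^esub> b \<in> I t" using a' b bA s t by simp_all
    have ab_st: "\<theta> s (a' \<otimes>\<^bsub>A\<^esub> b) \<in> I (s \<otimes>\<^bsub>\<Gamma>\<^esub> t)" using ab s t by (intro theta_dom) auto
    have inv_st: "inv\<^bsub>\<Gamma>\<^esub> (s \<otimes>\<^bsub>\<Gamma>\<^esub> t) = ?t \<otimes>\<^bsub>\<Gamma>\<^esub> ?s" using s t by (simp add: \<Gamma>.inv_mult_group)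
    have eq1: "\<theta> (inv\<^bsub>\<Gamma>\<^esub> (s \<otimes>\<^bsub>\<Gamma>\<^esub> t)) (\<theta> s (a' \<otimes>\<^bsub>A\<^esub> b)) = \<theta> ?t (a' \<otimes>\<^bsub>A\<^esub> b)"
      using theta_comp[of s "?t \<otimes>\<^bsub>\<Gamma>\<^esub> ?s" "a' \<otimes>\<^bsub>A\<^esub> b"] ab s t by (simp add: inv_st \<Gamma>.m_assoc)
    define y where "y = \<theta> ?t (a' \<otimes>\<^bsub>A\<^esub> b) \<otimes>\<^bsub>A\<^esub> c"
    have y1: "y \<in> I ?t" using ab t bA by (simp add: y_def)
    have "\<theta> ?t (a' \<otimes>\<^bsub>A\<^esub> b) \<in> I (?t \<otimes>\<^bsub>\<Gamma>\<^esub> ?s)" using ab s t by (intro theta_dom) auto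
    then have y2: "y \<in> I (inv\<^bsub>\<Gamma>\<^esub> (s \<otimes>\<^bsub>\<Gamma>\<^esub> t))" using s t bA by (simp add: y_def inv_st)
    have "\<theta> (s \<otimes>\<^bsub>\<Gamma>\<^esub> t) y = \<theta> s (\<theta> t y)" using theta_comp[OF t s y1 y2] by simp
    also have "\<theta> t y = a' \<otimes>\<^bsub>A\<^esub> \<theta> t (\<theta> ?t b \<otimes>\<^bsub>A\<^esub> c)"
      unfolding y_def by (rule theta_left_mult) (use t a' b bA in simp_all)
    finally have eq2: "\<theta> (s \<otimes>\<^bsub>\<Gamma>\<^esub> t) y = \<theta> s (a' \<otimes>\<^bsub>A\<^esub> \<theta> t (\<theta> ?t b \<otimes>\<^bsub>A\<^esub> c))" .
    have bc: "\<theta> t (\<theta> ?t b \<otimes>\<^bsub>A\<^esub> c) \<in> I (t \<otimes>\<^bsub>\<Gamma>\<^esub> r)"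
      using b c bA t r by (intro theta_dom) auto
    have "(\<delta> a s \<otimes>\<^bsub>X\<^esub> \<delta> b t) \<otimes>\<^bsub>X\<^esub> \<delta> c r = \<delta> (\<theta> s (a' \<otimes>\<^bsub>A\<^esub> b)) (s \<otimes>\<^bsub>\<Gamma>\<^esub> t) \<otimes>\<^bsub>X\<^esub> \<delta> c r"
      by (simp only: delta_mult[OF s t a b] a'_def)
    also have "\<dots> = \<delta> (\<theta> (s \<otimes>\<^bsub>\<Gamma>\<^esub> t) (\<theta> (inv\<^bsub>\<Gamma>\<^esub> (s \<otimes>\<^bsub>\<Gamma>\<^esub> t)) (\<theta> s (a' \<otimes>\<^bsub>A\<^esub> b)) \<otimes>\<^bsub>A\<^esub> c)) (s \<otimes>\<^bsub>\<Gamma>\<^esub> t \<otimes>\<^bsub>\<Gamma>\<^esub> r)"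
      by (rule delta_mult[OF _ r ab_st c]) (use s t in simp)
    also have "\<dots> = \<delta> (\<theta> s (a' \<otimes>\<^bsub>A\<^esub> \<theta> t (\<theta> ?t b \<otimes>\<^bsub>A\<^esub> c))) (s \<otimes>\<^bsub>\<Gamma>\<^esub> (t \<otimes>\<^bsub>\<Gamma>\<^esub> r))"
      unfolding eq1 y_def[symmetric] eq2 using s t r by (simp add: \<Gamma>.m_assoc)
    also have "\<dots> = \<delta> a s \<otimes>\<^bsub>X\<^esub> \<delta> (\<theta> t (\<theta> ?t b \<otimes>\<^bsub>A\<^esub> c)) (t \<otimes>\<^bsub>\<Gamma>\<^esub> r)"
      unfolding a'_def by (rule delta_mult[symmetric, OF s _ a bc]) (use t r in simp)
    also have "\<dots> = \<delta> a s \<otimes>\<^bsub>X\<^esub> (\<delta> b t \<otimes>\<^bsub>X\<^esub> \<delta> c r)"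
      by (simp only: delta_mult[OF t r b c])
    finally show ?thesis .
  qed
  \<comment> \<open>Additivity is used for one factor at a time, starting with the last.\<close>
  have h1: "(\<delta> a s \<otimes>\<^bsub>X\<^esub> \<delta> b t) \<otimes>\<^bsub>X\<^esub> h = \<delta> a s \<otimes>\<^bsub>X\<^esub> (\<delta> b t \<otimes>\<^bsub>X\<^esub> h)"
    if st: "s \<in> carrier \<Gamma>" "t \<in> carrier \<Gamma>" "a \<in> I s" "b \<in> I t" for a b s t
    using assms(3)
  proof (induction h rule: delta_induct)
    case (add f g)
    then show ?case using st by (simp add: mult_add_r split del: if_split)
  qed (use st base in \<open>simp_all split del: if_split\<close>)
  have h2: "(\<delta> a s \<otimes>\<^bsub>X\<^esub> g) \<otimes>\<^bsub>X\<^esub> h = \<delta> a s \<otimes>\<^bsub>X\<^esub> (g \<otimes>\<^bsub>X\<^esub> h)"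
    if st: "s \<in> carrier \<Gamma>" "a \<in> I s" for a s
    using assms(2)
  proof (induction g rule: delta_induct)
    case (add f g)
    then show ?case using st assms(3) by (simp add: mult_add_r mult_add_l split del: if_split)
  qed (use st assms(3) h1 in \<open>simp_all split del: if_split\<close>)
  show ?thesis
    using assms(1)
  proof (induction f rule: delta_induct)
    case (add f g)
    then show ?case using assms(2,3) by (simp add: mult_add_l split del: if_split)
  qed (use assms(2,3) h2 in \<open>simp_all split del: if_split\<close>)
qed

lemma star_add_X: "\<lbrakk>f \<in> carrier X; g \<in> carrier X\<rbrakk> \<Longrightarrow> star X (f \<oplus>\<^bsub>X\<^esub> g) = star X f \<oplus>\<^bsub>X\<^esub> star X g"
  using X_I by (auto simp: X_ops fun_eq_iff star_add theta_add)

lemma star_smult_X: "f \<in> carrier X \<Longrightarrow> star X (c \<odot>\<^bsub>X\<^esub> f) = cnj c \<odot>\<^bsub>X\<^esub> star X f"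
  using X_I by (auto simp: X_ops fun_eq_iff star_smult theta_smult)

lemma star_star_X: "f \<in> carrier X \<Longrightarrow> star X (star X f) = f"
  using X_I by (auto simp: X_ops fun_eq_iff X_outside theta_star[symmetric] star_star)

text \<open>On two \<delta> the indices match since (s t)^-1 = t^-1 s^-1; on coefficients the map
  for (s t)^-1 undoes \<theta> s and leaves the map for t^-1.\<close>

lemma star_mult_X:
  assumes "f \<in> carrier X" "g \<in> carrier X"
  shows "star X (f \<otimes>\<^bsub>X\<^esub> g) = star X g \<otimes>\<^bsub>X\<^esub> star X f"
proof -
  have [simp]: "star X \<zero>\<^bsub>X\<^esub> = \<zero>\<^bsub>X\<^esub>" by (auto simp: X_ops)
  have base: "star X (\<delta> a s \<otimes>\<^bsub>X\<^esub> \<delta> b t) = star X (\<delta> b t) \<otimes>\<^bsub>X\<^esub> star X (\<delta> a s)"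
    if s: "s \<in> carrier \<Gamma>" and t: "t \<in> carrier \<Gamma>" and a: "a \<in> I s" and b: "b \<in> I t" for a b s t
  proof -
    let ?s = "inv\<^bsub>\<Gamma>\<^esub> s" and ?t = "inv\<^bsub>\<Gamma>\<^esub> t"
    define a' where "a' = \<theta> ?s a"
    have a': "a' \<in> I ?s" "a' \<in> carrier A" using a s by (simp_all add: a'_def)
    have bA: "b \<in> carrier A" using b t I_carrier by auto
    have ab: "a' \<otimes>\<^bsub>A\<^esub> b \<in> I ?s" "a' \<otimes>\<^bsub>A\<^esub> b \<in> I t" using a' b bA s t by simp_all
    have ab_st: "\<theta> s (a' \<otimes>\<^bsub>A\<^esub> b) \<in> I (s \<otimes>\<^bsub>\<Gamma>\<^esub> t)" using ab s t by (intro theta_dom) auto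
    have inv_st: "inv\<^bsub>\<Gamma>\<^esub> (s \<otimes>\<^bsub>\<Gamma>\<^esub> t) = ?t \<otimes>\<^bsub>\<Gamma>\<^esub> ?s" using s t by (simp add: \<Gamma>.inv_mult_group)
    have "\<theta> (?t \<otimes>\<^bsub>\<Gamma>\<^esub> ?s) (\<theta> s (star A (a' \<otimes>\<^bsub>A\<^esub> b))) = \<theta> ?t (star A (a' \<otimes>\<^bsub>A\<^esub> b))"
      using theta_comp[of s "?t \<otimes>\<^bsub>\<Gamma>\<^esub> ?s" "star A (a' \<otimes>\<^bsub>A\<^esub> b)"] ab s t by (simp add: inv_st \<Gamma>.m_assoc)
    then have eq: "\<theta> (?t \<otimes>\<^bsub>\<Gamma>\<^esub> ?s) (star A (\<theta> s (a' \<otimes>\<^bsub>A\<^esub> b))) = \<theta> ?t (star A b \<otimes>\<^bsub>A\<^esub> star A a')"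
      using theta_star[OF s ab(1)] star_mult[OF a'(2) bA] by simp
    have e1: "\<theta> (inv\<^bsub>\<Gamma>\<^esub> ?t) (\<theta> ?t (star A b)) = star A b" and e2: "\<theta> ?s (star A a) = star A a'"
      using s t a b by (simp_all add: a'_def theta_star)
    have "star X (\<delta> a s \<otimes>\<^bsub>X\<^esub> \<delta> b t) = star X (\<delta> (\<theta> s (a' \<otimes>\<^bsub>A\<^esub> b)) (s \<otimes>\<^bsub>\<Gamma>\<^esub> t))"
      by (simp only: delta_mult[OF s t a b] a'_def)
    also have "\<dots> = \<delta> (\<theta> (inv\<^bsub>\<Gamma>\<^esub> (s \<otimes>\<^bsub>\<Gamma>\<^esub> t)) (star A (\<theta> s (a' \<otimes>\<^bsub>A\<^esub> b)))) (inv\<^bsub>\<Gamma>\<^esub> (s \<otimes>\<^bsub>\<Gamma>\<^esub> t))"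
      by (rule delta_star[OF _ ab_st]) (use s t in simp)
    also have "\<dots> = \<delta> (\<theta> ?t (\<theta> (inv\<^bsub>\<Gamma>\<^esub> ?t) (\<theta> ?t (star A b)) \<otimes>\<^bsub>A\<^esub> \<theta> ?s (star A a))) (?t \<otimes>\<^bsub>\<Gamma>\<^esub> ?s)"
      unfolding inv_st eq e1 e2 ..
    also have "\<dots> = \<delta> (\<theta> ?t (star A b)) ?t \<otimes>\<^bsub>X\<^esub> \<delta> (\<theta> ?s (star A a)) ?s"
      by (rule delta_mult[symmetric]) (use s t a b in simp_all)
    also have "\<dots> = star X (\<delta> b t) \<otimes>\<^bsub>X\<^esub> star X (\<delta> a s)"
      by (simp only: delta_star[OF s a] delta_star[OF t b])
    finally show ?thesis .
  qed
  have h1: "star X (\<delta> a s \<otimes>\<^bsub>X\<^esub> g) = star X g \<otimes>\<^bsub>X\<^esub> star X (\<delta> a s)"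
    if st: "s \<in> carrier \<Gamma>" "a \<in> I s" for a s
    using assms(2)
  proof (induction g rule: delta_induct)
    case (add f g)
    then show ?case using st by (simp add: mult_add_r mult_add_l star_add_X split del: if_split)
  qed (use st base in \<open>simp_all split del: if_split\<close>)
  show ?thesis
    using assms(1)
  proof (induction f rule: delta_induct)
    case (add f g)
    then show ?case using assms(2) by (simp add: mult_add_l mult_add_r star_add_X split del: if_split)
  qed (use assms(2) h1 in \<open>simp_all split del: if_split\<close>)
qed

lemma star_algebra_X: "star_algebra X"
proof (rule star_algebraI)
  show "star_algebra_axioms X"
    unfolding star_algebra_axioms_def
    by (auto simp: mult_assoc_X mult_add_l mult_add_r mult_smult star_star_X star_add_X star_smult_X star_mult_X)
qed (simp_all, simp_all add: X_ops fun_eq_iff M.a_ac sm_add_l sm_add_r sm_assoc)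

end

section \<open>Extension of \<open>C\<^sup>*\<close>-seminorms\<close>

text \<open>The extension is the operator seminorm of left multiplication on \<open>J\<close>.\<close>

lemma (in star_algebra) extend_cstar_seminorm_from_ideal:
  assumes J: "two_sided_ideal J A" and JS: "star_closed_subset J A"
    and p: "cstar_seminorm (A\<lparr>carrier := J\<rparr>) p"
    and bdd: "\<And>b. b \<in> carrier A \<Longrightarrow> \<exists>K. \<forall>j\<in>J. p (b \<otimes> j) \<le> K * p j"
  obtains P where "cstar_seminorm A P" "\<And>j. j \<in> J \<Longrightarrow> P j = p j"
proof -
  interpret p: seminormed_star_algebra "A\<lparr>carrier := J\<rparr>" p
    by (rule star_algebra.seminormed_of_cstar_seminorm[OF star_subalgebra[OF JS] p])
  note pc = cstar_seminorm.cstar_identity[OF p, simplified]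
  note [simp] = two_sided_idealD[OF J]
  have sJ [simp]: "star A j \<in> J" if "j \<in> J" for j using JS that by (auto simp: star_closed_subset_def)
  have p0 [simp]: "p \<zero> = 0" using p.p_zero by simp
  have pn: "0 \<le> p j" if "j \<in> J" for j using p.nonneg that by simp
  define S where "S = (\<lambda>b. {p (b \<otimes> j) |j. j \<in> J \<and> p j \<le> 1})"
  define P where "P = (\<lambda>b. Sup (S b))"
  have ne: "S b \<noteq> {}" for b
    unfolding S_def using p0 by (auto intro!: exI[of _ "\<zero>"])
  have bd: "bdd_above (S b)" if b: "b \<in> carrier A" for b
  proof -
    obtain K where K: "\<And>j. j \<in> J \<Longrightarrow> p (b \<otimes> j) \<le> K * p j" using bdd[OF b] by blast
    have "p (b \<otimes> j) \<le> \<bar>K\<bar>" if j: "j \<in> J" "p j \<le> 1" for j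
    proof -
      have "K * p j \<le> \<bar>K\<bar> * p j" using pn[OF j(1)] by (intro mult_right_mono) auto
      also have "\<dots> \<le> \<bar>K\<bar> * 1" using j by (intro mult_left_mono) auto
      finally show ?thesis using K[OF j(1)] by simp
    qed
    then show ?thesis unfolding S_def by (auto intro!: bdd_aboveI[of _ "\<bar>K\<bar>"])
  qed
  have P_ge: "p (b \<otimes> j) \<le> P b * p j" if b: "b \<in> carrier A" and j: "j \<in> J" for b j
  proof (cases "p j = 0")
    \<comment> \<open>Rescaling j is impossible here, but the assumed bound already gives
      \<open>p (b \<otimes> j) \<le> 0\<close>.\<close>
    case True
    obtain K where "p (b \<otimes> j) \<le> K * p j" using bdd[OF b] j by blast
    then show ?thesis using True by simp
  next
    case False
    then have pj: "p j > 0" using pn[OF j] by simp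
    let ?c = "complex_of_real (1 / p j)"
    have h: "p (?c \<odot> x) = p x / p j" if "x \<in> J" for x
      using p.homogeneous[of x ?c] that pj by (simp add: norm_divide)
    have "p (b \<otimes> (?c \<odot> j)) \<le> P b"
      unfolding P_def by (rule cSup_upper[OF _ bd[OF b]]) (use b j pj h in \<open>auto simp: S_def\<close>)
    moreover have "p (b \<otimes> (?c \<odot> j)) = p (b \<otimes> j) / p j"
      using h[of "b \<otimes> j"] b j smult_m_right[of b j ?c] by simp
    ultimately show ?thesis using pj by (simp add: divide_le_eq)
  qed
  have P_le: "P b \<le> C" if b: "b \<in> carrier A" and C: "0 \<le> C" "\<And>j. j \<in> J \<Longrightarrow> p (b \<otimes> j) \<le> C * p j" for b C
    unfolding P_def
  proof (rule cSup_least[OF ne])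
    fix r assume "r \<in> S b"
    then obtain j where j: "j \<in> J" "p j \<le> 1" "r = p (b \<otimes> j)" by (auto simp: S_def)
    have "C * p j \<le> C * 1" using j C by (intro mult_left_mono) auto
    then show "r \<le> C" using C(2)[OF j(1)] j by simp
  qed
  have P_nonneg: "0 \<le> P b" if b: "b \<in> carrier A" for b
  proof -
    have "p (b \<otimes> \<zero>) \<le> P b"
      unfolding P_def by (rule cSup_upper[OF _ bd[OF b]]) (auto simp: S_def intro!: exI[of _ "\<zero>"])
    then show ?thesis using b by simp
  qed
  have P_triangle: "P (b \<oplus> c) \<le> P b + P c" if [simp]: "b \<in> carrier A" "c \<in> carrier A" for b c
  proof (rule P_le)
    fix j assume j: "j \<in> J"
    have "p ((b \<oplus> c) \<otimes> j) \<le> p (b \<otimes> j) + p (c \<otimes> j)"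
      using p.triangle[of "b \<otimes> j" "c \<otimes> j"] j by (simp add: l_distr)
    then show "p ((b \<oplus> c) \<otimes> j) \<le> (P b + P c) * p j"
      using P_ge[of b j] P_ge[of c j] j by (simp add: distrib_right)
  qed (use P_nonneg in auto)
  have P_smult: "P (c \<odot> b) \<le> cmod c * P b" if [simp]: "b \<in> carrier A" for b c
  proof (rule P_le)
    fix j assume j: "j \<in> J"
    have "p (c \<odot> b \<otimes> j) = cmod c * p (b \<otimes> j)"
      using p.homogeneous[of "b \<otimes> j" c] j by (simp add: smult_m_left)
    then show "p (c \<odot> b \<otimes> j) \<le> cmod c * P b * p j"
      using P_ge[of b j] j by (simp add: mult_left_mono mult.assoc)
  qed (use P_nonneg in auto)
  have P_mult: "P (b \<otimes> c) \<le> P b * P c" if [simp]: "b \<in> carrier A" "c \<in> carrier A" for b c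
  proof (rule P_le)
    fix j assume j: "j \<in> J"
    have "p (b \<otimes> c \<otimes> j) \<le> P b * p (c \<otimes> j)"
      using P_ge[of b "c \<otimes> j"] j by (simp add: m_assoc)
    also have "\<dots> \<le> P b * (P c * p j)" using j by (intro mult_left_mono P_ge P_nonneg) auto
    finally show "p (b \<otimes> c \<otimes> j) \<le> P b * P c * p j" by (simp add: mult.assoc)
  qed (use P_nonneg in auto)
  \<comment> \<open>The C*-identity of p, applied to \<open>b \<otimes> j\<close> in J, produces the
    factor \<open>star A b \<otimes> b\<close> between \<open>star A j\<close> and j, where its own
    operator bound applies. The square root serves as a bound for b.\<close>
  have P_sq: "(P b)\<^sup>2 \<le> P (star A b \<otimes> b)" if [simp]: "b \<in> carrier A" for b
  proof -
    have "P b \<le> sqrt (P (star A b \<otimes> b))"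
    proof (rule P_le)
      fix j assume j: "j \<in> J"
      have "(p (b \<otimes> j))\<^sup>2 = p (star A j \<otimes> (star A b \<otimes> b \<otimes> j))"
        using pc[of "b \<otimes> j"] j by (simp add: star_mult m_assoc)
      also have "\<dots> \<le> p j * p (star A b \<otimes> b \<otimes> j)"
        using p.submultiplicative[of "star A j" "star A b \<otimes> b \<otimes> j"] j p.star_isometric[of j] by simp
      also have "\<dots> \<le> p j * (P (star A b \<otimes> b) * p j)"
        using j by (intro mult_left_mono P_ge pn) auto
      finally have "(p (b \<otimes> j))\<^sup>2 \<le> (sqrt (P (star A b \<otimes> b)) * p j)\<^sup>2"
        using P_nonneg[of "star A b \<otimes> b"] by (simp add: power_mult_distrib power2_eq_square ac_simps)
      then show "p (b \<otimes> j) \<le> sqrt (P (star A b \<otimes> b)) * p j"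
        by (rule power2_le_imp_le) (use j P_nonneg pn in \<open>auto intro!: mult_nonneg_nonneg\<close>)
    qed (use P_nonneg in auto)
    then have "(P b)\<^sup>2 \<le> (sqrt (P (star A b \<otimes> b)))\<^sup>2"
      using P_nonneg[of b] by (intro power_mono) auto
    then show ?thesis using P_nonneg[of "star A b \<otimes> b"] by simp
  qed
  \<comment> \<open>\<open>P_sq\<close> and \<open>P_mult\<close> bound the square of
    \<open>P b\<close> by the product of \<open>P (star A b)\<close> and \<open>P b\<close>; then
    divide.\<close>
  have P_star_le: "P b \<le> P (star A b)" if [simp]: "b \<in> carrier A" for b
  proof (cases "P b = 0")
    case False
    then have "P b > 0" using P_nonneg[of b] by simp
    moreover have "P b * P b \<le> P (star A b) * P b"
      using order_trans[OF P_sq P_mult, of b] by (simp add: power2_eq_square)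
    ultimately show ?thesis by simp
  qed (simp add: P_nonneg)
  have P_star: "P (star A b) = P b" if "b \<in> carrier A" for b
    using P_star_le[of b] P_star_le[of "star A b"] that by (simp add: star_star)
  have "cstar_seminorm A P"
  proof
    fix b c x y
    show "P (c \<odot> b) = cmod c * P b" if b: "b \<in> carrier A"
    proof (cases "c = 0")
      case True
      then show ?thesis using P_smult[OF b, of c] P_nonneg[of "c \<odot> b"] b by simp
    next
      case False
      have "P b \<le> cmod (1 / c) * P (c \<odot> b)"
        using P_smult[of "c \<odot> b" "1 / c"] b False by (simp add: sm_assoc)
      then have "cmod c * P b \<le> P (c \<odot> b)" using False by (simp add: norm_divide field_simps)
      then show ?thesis using P_smult[OF b, of c] by simp
    qed
    show "P (star A b \<otimes> b) = (P b)\<^sup>2" if "b \<in> carrier A"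
      using P_sq[of b] P_mult[of "star A b" b] that by (simp add: P_star power2_eq_square)
  qed (simp_all add: P_nonneg P_triangle P_mult P_star)
  \<comment> \<open>For the lower bound j is tested at \<open>star A j\<close>: the C*-identity
    turns \<open>p (j \<otimes> star A j)\<close> into the square of \<open>p j\<close>.\<close>
  moreover have "P j = p j" if j: "j \<in> J" for j
  proof (rule antisym)
    show "P j \<le> p j"
      using j pn p.submultiplicative[of j] by (intro P_le) auto
    show "p j \<le> P j"
    proof (cases "p j = 0")
      case False
      then have "p j > 0" using pn[OF j] by simp
      moreover have "p j * p j \<le> P j * p j"
        using pc[of "star A j"] P_ge[of j "star A j"] j p.star_isometric[of j]
        by (simp add: star_star power2_eq_square)
      ultimately show ?thesis by simp
    qed (use P_nonneg j in simp)
  qed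
  ultimately show thesis by (rule that)
qed

text \<open>A supremum of reals says nothing about an unbounded set, hence the hypothesis; the zero
  seminorm keeps the set nonempty. The C*-identity survives because squaring is monotone on
  nonnegative reals.\<close>

lemma (in star_algebra) max_seminorm:
  assumes bdd: "\<And>x. x \<in> carrier A \<Longrightarrow> \<exists>K. \<forall>p. cstar_seminorm A p \<longrightarrow> p x \<le> K"
  shows cstar_seminorm_max: "cstar_seminorm A (max_seminorm A)"
    and max_seminorm_upper: "\<lbrakk>cstar_seminorm A p; x \<in> carrier A\<rbrakk> \<Longrightarrow> p x \<le> max_seminorm A x"
    and max_seminorm_least: "(\<And>p. cstar_seminorm A p \<Longrightarrow> p x \<le> K) \<Longrightarrow> max_seminorm A x \<le> K"
proof -
  let ?M = "max_seminorm A"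
  have zero: "cstar_seminorm A (\<lambda>_. 0)" by unfold_locales auto
  show least: "?M x \<le> K" if "\<And>p. cstar_seminorm A p \<Longrightarrow> p x \<le> K" for x K
    unfolding max_seminorm_def by (rule cSup_least) (use zero that in auto)
  show upper: "p x \<le> ?M x" if p: "cstar_seminorm A p" and x: "x \<in> carrier A" for p x
    unfolding max_seminorm_def
  proof (rule cSup_upper)
    obtain K where K: "\<And>p. cstar_seminorm A p \<Longrightarrow> p x \<le> K" using bdd[OF x] by blast
    show "bdd_above {p x |p. cstar_seminorm A p}" by (rule bdd_aboveI[of _ K]) (use K in blast)
  qed (use p in blast)
  have nn: "0 \<le> ?M x" if "x \<in> carrier A" for x using upper[OF zero that] .
  have smult_le: "?M (c \<odot> x) \<le> cmod c * ?M x" if "x \<in> carrier A" for c x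
  proof (rule least)
    fix p assume p: "cstar_seminorm A p"
    show "p (c \<odot> x) \<le> cmod c * ?M x"
      using that by (simp add: cstar_seminorm.homogeneous[OF p] mult_left_mono upper[OF p])
  qed
  show "cstar_seminorm A ?M"
  proof
    fix x y c assume x: "x \<in> carrier A"
    show "0 \<le> ?M x" by (rule nn[OF x])
    show "?M (c \<odot> x) = cmod c * ?M x"
    proof (cases "c = 0")
      case True
      then show ?thesis using smult_le[OF x, of c] nn[of "c \<odot> x"] x by simp
    next
      case False
      have "?M x \<le> cmod (1 / c) * ?M (c \<odot> x)"
        using smult_le[of "c \<odot> x" "1 / c"] x False by (simp add: sm_assoc)
      then have "cmod c * ?M x \<le> ?M (c \<odot> x)" using False by (simp add: norm_divide field_simps)
      then show ?thesis using smult_le[OF x, of c] by simp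
    qed
    have "{p (star A x) |p. cstar_seminorm A p} = {p x |p. cstar_seminorm A p}"
      using cstar_seminorm.star_isometric[OF _ x] by (metis (mono_tags, lifting))
    then show "?M (star A x) = ?M x" by (simp add: max_seminorm_def)
    show "?M (star A x \<otimes> x) = (?M x)\<^sup>2"
    proof (rule antisym)
      show "?M (star A x \<otimes> x) \<le> (?M x)\<^sup>2"
      proof (rule least)
        fix p assume p: "cstar_seminorm A p"
        show "p (star A x \<otimes> x) \<le> (?M x)\<^sup>2"
          using cstar_seminorm.nonneg[OF p x]
          by (simp add: cstar_seminorm.cstar_identity[OF p x] power_mono upper[OF p x])
      qed
      have "?M x \<le> sqrt (?M (star A x \<otimes> x))"
      proof (rule least)
        fix p assume p: "cstar_seminorm A p"
        show "p x \<le> sqrt (?M (star A x \<otimes> x))"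
          using upper[OF p, of "star A x \<otimes> x"] x
          by (intro real_le_rsqrt) (simp add: cstar_seminorm.cstar_identity[OF p x])
      qed
      then have "(?M x)\<^sup>2 \<le> (sqrt (?M (star A x \<otimes> x)))\<^sup>2" using nn[OF x] by (rule power_mono)
      then show "(?M x)\<^sup>2 \<le> ?M (star A x \<otimes> x)" using nn[of "star A x \<otimes> x"] x by simp
    qed
    assume y: "y \<in> carrier A"
    show "?M (x \<oplus> y) \<le> ?M x + ?M y"
    proof (rule least)
      fix p assume p: "cstar_seminorm A p"
      show "p (x \<oplus> y) \<le> ?M x + ?M y"
        using cstar_seminorm.triangle[OF p x y] upper[OF p x] upper[OF p y] by linarith
    qed
    show "?M (x \<otimes> y) \<le> ?M x * ?M y"
    proof (rule least)
      fix p assume p: "cstar_seminorm A p"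
      show "p (x \<otimes> y) \<le> ?M x * ?M y"
        by (rule order_trans[OF cstar_seminorm.submultiplicative[OF p x y]])
          (intro mult_mono upper[OF p] x y nn cstar_seminorm.nonneg[OF p])
    qed
  qed
qed

section \<open>Bounds for C*-seminorms on the algebraic crossed product\<close>

context partial_action
begin

sublocale X: star_algebra X by (rule star_algebra_X)

lemma delta_one_hom: "star_hom A X (\<lambda>a. \<delta> a \<one>\<^bsub>\<Gamma>\<^esub>)"
proof -
  have mult: "\<delta> (a \<otimes>\<^bsub>A\<^esub> b) \<one>\<^bsub>\<Gamma>\<^esub> = \<delta> a \<one>\<^bsub>\<Gamma>\<^esub> \<otimes>\<^bsub>X\<^esub> \<delta> b \<one>\<^bsub>\<Gamma>\<^esub>" if "a \<in> carrier A" "b \<in> carrier A" for a b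
    using delta_mult[of "\<one>\<^bsub>\<Gamma>\<^esub>" "\<one>\<^bsub>\<Gamma>\<^esub>" a b] that one_domain one_action by (auto cong: if_cong)
  have star: "\<delta> (star A a) \<one>\<^bsub>\<Gamma>\<^esub> = star X (\<delta> a \<one>\<^bsub>\<Gamma>\<^esub>)" if "a \<in> carrier A" for a
    using delta_star[of "\<one>\<^bsub>\<Gamma>\<^esub>" a] that one_domain one_action by (auto cong: if_cong)
  have "\<delta> a \<one>\<^bsub>\<Gamma>\<^esub> \<in> carrier X" if "a \<in> carrier A" for a
    using that one_domain by simp
  then show ?thesis
    unfolding star_hom_def using mult star by (auto simp: X_ops(2,3) fun_eq_iff)
qed

text \<open>The point is the index: the element lies over the identity, that is in the copy of A,
  where the norm estimates for C*-algebras apply.\<close>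

lemma star_delta_mult_delta:
  assumes s: "s \<in> carrier \<Gamma>" and a: "a \<in> I s"
  shows "star X (\<delta> a s) \<otimes>\<^bsub>X\<^esub> \<delta> a s = \<delta> (\<theta> (inv\<^bsub>\<Gamma>\<^esub> s) (star A a \<otimes>\<^bsub>A\<^esub> a)) \<one>\<^bsub>\<Gamma>\<^esub>"
proof -
  have "star X (\<delta> a s) \<otimes>\<^bsub>X\<^esub> \<delta> a s = \<delta> (\<theta> (inv\<^bsub>\<Gamma>\<^esub> s) (star A a)) (inv\<^bsub>\<Gamma>\<^esub> s) \<otimes>\<^bsub>X\<^esub> \<delta> a s"
    by (simp only: delta_star[OF s a])
  also have "\<dots> = \<delta> (\<theta> (inv\<^bsub>\<Gamma>\<^esub> s) (\<theta> (inv\<^bsub>\<Gamma>\<^esub> (inv\<^bsub>\<Gamma>\<^esub> s)) (\<theta> (inv\<^bsub>\<Gamma>\<^esub> s) (star A a)) \<otimes>\<^bsub>A\<^esub> a)) (inv\<^bsub>\<Gamma>\<^esub> s \<otimes>\<^bsub>\<Gamma>\<^esub> s)"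
    by (rule delta_mult) (use s a in simp_all)
  also have "\<dots> = \<delta> (\<theta> (inv\<^bsub>\<Gamma>\<^esub> s) (star A a \<otimes>\<^bsub>A\<^esub> a)) \<one>\<^bsub>\<Gamma>\<^esub>"
    using s a by (simp cong: if_cong)
  finally show ?thesis .
qed

text \<open>Sums of bounded operators are bounded, so a single \<delta> suffices; call it d. The
  C*-identity reduces the bound for d to one for \<open>star X d \<otimes> d\<close>, which is a
  self-adjoint element c of A placed over the identity. There
  \<open>selfadjoint_multiplier_bound\<close> applies with any r above the norm of c, and d gets the
  bound \<open>sqrt r\<close>.\<close>

lemma left_mult_bounded:
  assumes J: "two_sided_ideal J X" "star_closed_subset J X"
    and p: "cstar_seminorm (X\<lparr>carrier := J\<rparr>) p" and b: "b \<in> carrier X"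
  shows "\<exists>K. \<forall>j\<in>J. p (b \<otimes>\<^bsub>X\<^esub> j) \<le> K * p j"
  using b
proof (induction b rule: delta_induct)
  case zero
  have "p \<zero>\<^bsub>X\<^esub> = 0"
    using seminormed_star_algebra.p_zero[OF star_algebra.seminormed_of_cstar_seminorm[OF X.star_subalgebra[OF J(2)] p]] by simp
  then show ?case using two_sided_idealD(1)[OF J(1)] by (intro exI[of _ 0]) simp
next
  case (add f g)
  then obtain K L where K: "\<And>j. j \<in> J \<Longrightarrow> p (f \<otimes>\<^bsub>X\<^esub> j) \<le> K * p j"
    and L: "\<And>j. j \<in> J \<Longrightarrow> p (g \<otimes>\<^bsub>X\<^esub> j) \<le> L * p j" by blast
  have "p ((f \<oplus>\<^bsub>X\<^esub> g) \<otimes>\<^bsub>X\<^esub> j) \<le> (K + L) * p j" if j: "j \<in> J" for j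
    using cstar_seminorm.triangle[OF p, of "f \<otimes>\<^bsub>X\<^esub> j" "g \<otimes>\<^bsub>X\<^esub> j"] K[OF j] L[OF j] add.hyps j
      two_sided_idealD[OF J(1)] by (simp add: X.l_distr distrib_right)
  then show ?case by blast
next
  case (delta a s)
  interpret p: cstar_seminorm "X\<lparr>carrier := J\<rparr>" p by fact
  note [simp] = two_sided_idealD[OF J(1)]
  have sJ [simp]: "star X j \<in> J" if "j \<in> J" for j using J(2) that by (auto simp: star_closed_subset_def)
  define d where "d = \<delta> a s"
  define c where "c = \<theta> (inv\<^bsub>\<Gamma>\<^esub> s) (star A a \<otimes>\<^bsub>A\<^esub> a)"
  define r where "r = nrm A c + 1"
  have aA: "a \<in> carrier A" using delta I_carrier by blast
  have d: "d \<in> carrier X" using delta by (simp add: d_def)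
  have c: "c \<in> carrier A" "star A c = c"
    using delta aA by (simp_all add: c_def theta_star[symmetric] star_mult star_star)
  have r0: "r > 0" using N.nonneg[OF c(1)] by (simp add: r_def)
  have dd: "star X d \<otimes>\<^bsub>X\<^esub> d = \<delta> c \<one>\<^bsub>\<Gamma>\<^esub>"
    unfolding d_def c_def by (rule star_delta_mult_delta) fact+
  have "p (d \<otimes>\<^bsub>X\<^esub> j) \<le> sqrt r * p j" if j: "j \<in> J" for j
  proof (rule power2_le_imp_le)
    have dj: "\<delta> c \<one>\<^bsub>\<Gamma>\<^esub> \<in> carrier X" using c one_domain by simp
    have "(p (d \<otimes>\<^bsub>X\<^esub> j))\<^sup>2 = p (star X j \<otimes>\<^bsub>X\<^esub> (\<delta> c \<one>\<^bsub>\<Gamma>\<^esub> \<otimes>\<^bsub>X\<^esub> j))"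
      using p.cstar_identity[of "d \<otimes>\<^bsub>X\<^esub> j"] j d by (simp add: X.star_mult X.m_assoc flip: dd)
    also have "\<dots> \<le> p j * p (\<delta> c \<one>\<^bsub>\<Gamma>\<^esub> \<otimes>\<^bsub>X\<^esub> j)"
      using p.submultiplicative[of "star X j" "\<delta> c \<one>\<^bsub>\<Gamma>\<^esub> \<otimes>\<^bsub>X\<^esub> j"] p.star_isometric[of j] j dj by simp
    also have "\<dots> \<le> p j * (r * p j)"
    proof (rule mult_left_mono)
      show "p (\<delta> c \<one>\<^bsub>\<Gamma>\<^esub> \<otimes>\<^bsub>X\<^esub> j) \<le> r * p j"
      proof (rule selfadjoint_multiplier_bound[OF X.star_algebra_axioms J(2) p delta_one_hom])
        show "\<delta> a \<one>\<^bsub>\<Gamma>\<^esub> \<otimes>\<^bsub>X\<^esub> j \<in> J" if "a \<in> carrier A" "j \<in> J" for a j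
          using that one_domain by simp
      qed (use c j in \<open>simp_all add: r_def\<close>)
      show "0 \<le> p j" using p.nonneg j by simp
    qed
    finally show "(p (d \<otimes>\<^bsub>X\<^esub> j))\<^sup>2 \<le> (sqrt r * p j)\<^sup>2"
      using r0 by (simp add: power_mult_distrib) (simp add: power2_eq_square ac_simps)
    show "0 \<le> sqrt r * p j" using r0 p.nonneg[of j] j by simp
  qed
  then show ?case unfolding d_def by blast
qed

lemma extend_cstar_seminorm_X:
  assumes "two_sided_ideal J X" "star_closed_subset J X" "cstar_seminorm (X\<lparr>carrier := J\<rparr>) p"
  obtains P where "cstar_seminorm X P" "\<And>j. j \<in> J \<Longrightarrow> P j = p j"
  using X.extend_cstar_seminorm_from_ideal[OF assms left_mult_bounded[OF assms]] by blast

text \<open>A submultiplicative *-norm that dominates every C*-seminorm. It makes the maximal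
  seminorm finite and is the norm in which density of the comparison map and the extension of
  seminorms are measured.\<close>

definition ell1 :: "('s \<Rightarrow> 'a) \<Rightarrow> real" where
  "ell1 f = (\<Sum>s | f s \<noteq> \<zero>\<^bsub>A\<^esub>. nrm A (f s))"

lemma ell1_eq: "\<lbrakk>finite S; {s. f s \<noteq> \<zero>\<^bsub>A\<^esub>} \<subseteq> S\<rbrakk> \<Longrightarrow> ell1 f = (\<Sum>s\<in>S. nrm A (f s))"
  unfolding ell1_def by (rule sum.mono_neutral_left) auto

lemma ell1_nonneg: "f \<in> carrier X \<Longrightarrow> 0 \<le> ell1 f"
  unfolding ell1_def by (intro sum_nonneg N.nonneg) simp

lemma ell1_delta: "ell1 (\<delta> a s) = nrm A a"
  by (subst ell1_eq[of "{s}"]) auto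

lemma ell1_triangle:
  assumes f: "f \<in> carrier X" and g: "g \<in> carrier X"
  shows "ell1 (f \<oplus>\<^bsub>X\<^esub> g) \<le> ell1 f + ell1 g"
proof -
  let ?S = "{s. f s \<noteq> \<zero>\<^bsub>A\<^esub>} \<union> {s. g s \<noteq> \<zero>\<^bsub>A\<^esub>}"
  have S: "finite ?S" using f g by (simp add: X_finite)
  have "ell1 (f \<oplus>\<^bsub>X\<^esub> g) = (\<Sum>s\<in>?S. nrm A (f s \<oplus>\<^bsub>A\<^esub> g s))"
    by (subst ell1_eq[OF S]) (auto simp: X_ops)
  also have "\<dots> \<le> (\<Sum>s\<in>?S. nrm A (f s) + nrm A (g s))"
    using f g by (intro sum_mono N.triangle) auto
  also have "\<dots> = ell1 f + ell1 g"
    by (simp add: sum.distrib ell1_eq[OF S, of f] ell1_eq[OF S, of g])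
  finally show ?thesis .
qed

lemma nrm_finsum_le:
  assumes "finite S" "\<And>s. s \<in> S \<Longrightarrow> f s \<in> carrier A"
  shows "nrm A (finsum A f S) \<le> (\<Sum>s\<in>S. nrm A (f s))"
  using assms
proof (induction S)
  case (insert s S)
  then have mem: "f \<in> S \<rightarrow> carrier A" "f s \<in> carrier A" by auto
  have "nrm A (finsum A f S) \<le> (\<Sum>s\<in>S. nrm A (f s))" using insert by simp
  moreover have "nrm A (f s \<oplus>\<^bsub>A\<^esub> finsum A f S) \<le> nrm A (f s) + nrm A (finsum A f S)"
    using mem by (intro N.triangle) auto
  ultimately show ?case using insert.hyps mem by simp
qed simp

text \<open>As \<theta> is isometric, the coefficient at r is at most the sum over s of |f s|
  |g(s^-1 r)|. For fixed s the map from r to s^-1 r is injective, so summing over r gives at most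
  the l1-norm of g.\<close>

lemma ell1_mult:
  assumes f: "f \<in> carrier X" and g: "g \<in> carrier X"
  shows "ell1 (f \<otimes>\<^bsub>X\<^esub> g) \<le> ell1 f * ell1 g"
proof -
  let ?S = "{s. f s \<noteq> \<zero>\<^bsub>A\<^esub>}" and ?R = "{r. (f \<otimes>\<^bsub>X\<^esub> g) r \<noteq> \<zero>\<^bsub>A\<^esub>}"
  have S: "finite ?S" "?S \<subseteq> carrier \<Gamma>" using f by (simp_all add: X_finite X_support)
  have R: "finite ?R" "?R \<subseteq> carrier \<Gamma>" using X_mult[OF f g] by (simp_all only: X_finite X_support)
  have inner: "(\<Sum>r\<in>?R. nrm A (g (inv\<^bsub>\<Gamma>\<^esub> s \<otimes>\<^bsub>\<Gamma>\<^esub> r))) \<le> ell1 g" if s: "s \<in> ?S" for s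
  proof -
    have s': "s \<in> carrier \<Gamma>" using s S by blast
    have inj: "inj_on (\<lambda>r. inv\<^bsub>\<Gamma>\<^esub> s \<otimes>\<^bsub>\<Gamma>\<^esub> r) ?R"
    proof (rule inj_onI)
      fix r r' assume r: "r \<in> ?R" "r' \<in> ?R" and eq: "inv\<^bsub>\<Gamma>\<^esub> s \<otimes>\<^bsub>\<Gamma>\<^esub> r = inv\<^bsub>\<Gamma>\<^esub> s \<otimes>\<^bsub>\<Gamma>\<^esub> r'"
      have "r \<in> carrier \<Gamma>" "r' \<in> carrier \<Gamma>" using r R(2) by blast+
      then show "r = r'" using s' arg_cong[OF eq, of "\<lambda>x. s \<otimes>\<^bsub>\<Gamma>\<^esub> x"] by (simp add: \<Gamma>.m_assoc[symmetric])
    qed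
    let ?T = "(\<lambda>r. inv\<^bsub>\<Gamma>\<^esub> s \<otimes>\<^bsub>\<Gamma>\<^esub> r) ` ?R \<union> {s. g s \<noteq> \<zero>\<^bsub>A\<^esub>}"
    have T: "finite ?T" using R g by (simp add: X_finite)
    have "(\<Sum>r\<in>?R. nrm A (g (inv\<^bsub>\<Gamma>\<^esub> s \<otimes>\<^bsub>\<Gamma>\<^esub> r))) = (\<Sum>t\<in>(\<lambda>r. inv\<^bsub>\<Gamma>\<^esub> s \<otimes>\<^bsub>\<Gamma>\<^esub> r) ` ?R. nrm A (g t))"
      using sum.reindex[OF inj, of "\<lambda>t. nrm A (g t)"] by simp
    also have "\<dots> \<le> (\<Sum>t\<in>?T. nrm A (g t))"
      by (rule sum_mono2[OF T]) (use g N.nonneg in auto)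
    also have "\<dots> = ell1 g" by (rule ell1_eq[symmetric, OF T]) auto
    finally show ?thesis .
  qed
  have summand_le: "nrm A (summand f g r s) \<le> nrm A (f s) * nrm A (g (inv\<^bsub>\<Gamma>\<^esub> s \<otimes>\<^bsub>\<Gamma>\<^esub> r))" if s: "s \<in> ?S" for r s
  proof -
    have s': "s \<in> carrier \<Gamma>" using s S by blast
    have fs: "f s \<in> I s" "g (inv\<^bsub>\<Gamma>\<^esub> s \<otimes>\<^bsub>\<Gamma>\<^esub> r) \<in> carrier A" using f g s' by (simp_all add: X_I)
    have "nrm A (summand f g r s) = nrm A (\<theta> (inv\<^bsub>\<Gamma>\<^esub> s) (f s) \<otimes>\<^bsub>A\<^esub> g (inv\<^bsub>\<Gamma>\<^esub> s \<otimes>\<^bsub>\<Gamma>\<^esub> r))"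
      by (rule nrm_theta) (use s' fs in simp_all)
    also have "\<dots> \<le> nrm A (\<theta> (inv\<^bsub>\<Gamma>\<^esub> s) (f s)) * nrm A (g (inv\<^bsub>\<Gamma>\<^esub> s \<otimes>\<^bsub>\<Gamma>\<^esub> r))"
      by (rule N.submultiplicative) (use s' fs in simp_all)
    also have "nrm A (\<theta> (inv\<^bsub>\<Gamma>\<^esub> s) (f s)) = nrm A (f s)" by (rule nrm_theta) (use s' fs in simp_all)
    finally show ?thesis .
  qed
  have "ell1 (f \<otimes>\<^bsub>X\<^esub> g) = (\<Sum>r\<in>?R. nrm A (finsum A (summand f g r) ?S))"
    unfolding ell1_def
  proof (rule sum.cong[OF refl])
    fix r assume "r \<in> ?R"
    then have "r \<in> carrier \<Gamma>" using R(2) by blast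
    then show "nrm A ((f \<otimes>\<^bsub>X\<^esub> g) r) = nrm A (finsum A (summand f g r) ?S)"
      using mult_X[OF f g S subset_refl] by simp
  qed
  also have "\<dots> \<le> (\<Sum>r\<in>?R. \<Sum>s\<in>?S. nrm A (summand f g r s))"
    by (intro sum_mono nrm_finsum_le summand_A[OF f g] S(1) subsetD[OF S(2)] subsetD[OF R(2)])
  also have "\<dots> \<le> (\<Sum>r\<in>?R. \<Sum>s\<in>?S. nrm A (f s) * nrm A (g (inv\<^bsub>\<Gamma>\<^esub> s \<otimes>\<^bsub>\<Gamma>\<^esub> r)))"
    by (intro sum_mono summand_le)
  also have "\<dots> = (\<Sum>s\<in>?S. nrm A (f s) * (\<Sum>r\<in>?R. nrm A (g (inv\<^bsub>\<Gamma>\<^esub> s \<otimes>\<^bsub>\<Gamma>\<^esub> r))))"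
    by (subst sum.swap) (simp add: sum_distrib_left)
  also have "\<dots> \<le> (\<Sum>s\<in>?S. nrm A (f s) * ell1 g)"
    using f by (intro sum_mono mult_left_mono inner N.nonneg) auto
  also have "\<dots> = ell1 f * ell1 g" by (simp add: ell1_def sum_distrib_right)
  finally show ?thesis .
qed

lemma ell1_star:
  assumes f: "f \<in> carrier X"
  shows "ell1 (star X f) = ell1 f"
proof -
  let ?S = "{s. f s \<noteq> \<zero>\<^bsub>A\<^esub>}"
  have S: "finite ?S" "?S \<subseteq> carrier \<Gamma>" using f by (simp_all add: X_finite X_support)
  have inj: "inj_on (\<lambda>s. inv\<^bsub>\<Gamma>\<^esub> s) ?S" 
  proof (rule inj_onI)
    fix s t assume st: "s \<in> ?S" "t \<in> ?S" and eq: "inv\<^bsub>\<Gamma>\<^esub> s = inv\<^bsub>\<Gamma>\<^esub> t"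
    have "s \<in> carrier \<Gamma>" "t \<in> carrier \<Gamma>" using st S(2) by blast+
    then show "s = t" using arg_cong[OF eq, of "\<lambda>x. inv\<^bsub>\<Gamma>\<^esub> x"] by simp
  qed
  have "ell1 (star X f) = (\<Sum>s\<in>(\<lambda>s. inv\<^bsub>\<Gamma>\<^esub> s) ` ?S. nrm A (star X f s))"
    by (rule ell1_eq[OF _ star_support]) (use S in simp)
  also have "\<dots> = (\<Sum>s\<in>?S. nrm A (star X f (inv\<^bsub>\<Gamma>\<^esub> s)))" by (simp add: sum.reindex[OF inj])
  also have "\<dots> = (\<Sum>s\<in>?S. nrm A (f s))"
  proof (rule sum.cong[OF refl])
    fix s assume "s \<in> ?S"
    then have s: "s \<in> carrier \<Gamma>" using S(2) by blast
    have fs: "f s \<in> I s" using f s by (rule X_I)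
    have "nrm A (\<theta> (inv\<^bsub>\<Gamma>\<^esub> s) (star A (f s))) = nrm A (star A (f s))"
      by (rule nrm_theta) (use s fs in simp_all)
    then show "nrm A (star X f (inv\<^bsub>\<Gamma>\<^esub> s)) = nrm A (f s)"
      using s f by (simp add: X_ops N.star_isometric)
  qed
  finally show ?thesis by (simp add: ell1_def)
qed

lemma seminormed_ell1: "seminormed_star_algebra X ell1"
proof (intro seminormed_star_algebra.intro X.star_algebra_axioms seminormed_star_algebra_axioms.intro)
  fix f c assume f: "f \<in> carrier X"
  have "ell1 (c \<odot>\<^bsub>X\<^esub> f) = (\<Sum>s | f s \<noteq> \<zero>\<^bsub>A\<^esub>. nrm A (c \<odot>\<^bsub>A\<^esub> f s))"
    by (subst ell1_eq[OF X_finite[OF f]]) (auto simp: X_ops)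
  then show "ell1 (c \<odot>\<^bsub>X\<^esub> f) = cmod c * ell1 f"
    using f by (simp add: ell1_def N.homogeneous sum_distrib_left)
qed (simp_all add: ell1_nonneg ell1_triangle ell1_mult ell1_star)

text \<open>The C*-identity moves the square of the \<delta> into the copy of A, where the
  restriction of p is a C*-seminorm and thus at most the norm; since \<theta> is isometric, the norm
  found is that of \<open>star A a \<otimes> a\<close>.\<close>

lemma cstar_seminorm_delta_le:
  assumes p: "cstar_seminorm X p" and s: "s \<in> carrier \<Gamma>" and a: "a \<in> I s"
  shows "p (\<delta> a s) \<le> nrm A a"
proof (rule power2_le_imp_le)
  let ?c = "\<theta> (inv\<^bsub>\<Gamma>\<^esub> s) (star A a \<otimes>\<^bsub>A\<^esub> a)"
  have aA: "a \<in> carrier A" using s a I_carrier by blast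
  have c: "?c \<in> carrier A" using s a aA by simp
  have "(p (\<delta> a s))\<^sup>2 = p (\<delta> ?c \<one>\<^bsub>\<Gamma>\<^esub>)"
    using cstar_seminorm.cstar_identity[OF p delta_closed[OF s a]] by (simp only: star_delta_mult_delta[OF s a])
  also have "\<dots> \<le> nrm A ?c"
    by (rule cstar_seminorm_le_norm[OF cstar_seminorm_pullback[OF star_algebra_axioms delta_one_hom p] c])
  also have "\<dots> = nrm A (star A a \<otimes>\<^bsub>A\<^esub> a)" by (rule nrm_theta) (use s a aA in simp_all)
  finally show "(p (\<delta> a s))\<^sup>2 \<le> (nrm A a)\<^sup>2" using aA by (simp add: cstar_identity)
  show "0 \<le> nrm A a" using aA by (rule N.nonneg)
qed

text \<open>Recovers the norm of a coefficient over any s from a coefficient over the identity. It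
  is applied to H acting on A \<rtimes> G, in \<open>cstar_seminorm_lift_le\<close>.\<close>

lemma nrm_inv_delta_sq:
  assumes s: "s \<in> carrier \<Gamma>" and a: "a \<in> I s"
  shows "nrm A ((star X (\<delta> a s) \<otimes>\<^bsub>X\<^esub> \<delta> a s) \<one>\<^bsub>\<Gamma>\<^esub>) = (nrm A a)\<^sup>2"
proof -
  have aA: "a \<in> carrier A" using s a I_carrier by blast
  have "nrm A (\<theta> (inv\<^bsub>\<Gamma>\<^esub> s) (star A a \<otimes>\<^bsub>A\<^esub> a)) = nrm A (star A a \<otimes>\<^bsub>A\<^esub> a)"
    by (rule nrm_theta) (use s a aA in simp_all)
  then show ?thesis using aA by (simp add: star_delta_mult_delta[OF s a] cstar_identity)
qed

lemma cstar_seminorm_le_ell1: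
  assumes p: "cstar_seminorm X p" and f: "f \<in> carrier X"
  shows "p f \<le> ell1 f"
proof -
  interpret p: seminormed_star_algebra X p by (rule X.seminormed_of_cstar_seminorm[OF p])
  have "p f \<le> (\<Sum>s\<in>S. nrm A (f s))" if "finite S" "f \<in> carrier X" "{s. f s \<noteq> \<zero>\<^bsub>A\<^esub>} \<subseteq> S" for S f
    using that
  proof (induction S arbitrary: f rule: finite_induct)
    case empty
    then have "f = \<zero>\<^bsub>X\<^esub>" by (auto simp: X_ops)
    then show ?case by simp
  next
    case (insert s S)
    let ?g = "f(s := \<zero>\<^bsub>A\<^esub>)"
    have "finite {t. ?g t \<noteq> \<zero>\<^bsub>A\<^esub>}"
      by (rule finite_subset[OF _ X_finite[OF insert.prems(1)]]) auto
    then have g: "?g \<in> carrier X" using insert.prems(1) by (auto simp: X_carrier)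
    have "p ?g \<le> (\<Sum>t\<in>S. nrm A (?g t))" by (rule insert.IH[OF g]) (use insert.prems in auto)
    also have "\<dots> = (\<Sum>t\<in>S. nrm A (f t))" using insert.hyps by (intro sum.cong) auto
    finally have pg: "p ?g \<le> (\<Sum>t\<in>S. nrm A (f t))" .
    show ?case
    proof (cases "s \<in> carrier \<Gamma>")
      case s: True
      have d: "f s \<in> I s" by (rule X_I) fact+
      have "f = ?g \<oplus>\<^bsub>X\<^esub> \<delta> (f s) s" using insert.prems(1) by (auto simp: X_ops fun_eq_iff)
      then have "p f \<le> p ?g + p (\<delta> (f s) s)" using p.triangle[OF g delta_closed[OF s d]] by simp
      then show ?thesis using pg cstar_seminorm_delta_le[OF p s d] insert.hyps by simp
    next
      case False
      then have "f s = \<zero>\<^bsub>A\<^esub>" using insert.prems(1) by (simp add: X_outside)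
      then have "?g = f" by auto
      then show ?thesis using pg \<open>f s = \<zero>\<^bsub>A\<^esub>\<close> insert.hyps by simp
    qed
  qed
  then show ?thesis using X_finite[OF f] f unfolding ell1_def by blast
qed

lemma bounded_cstar_seminorms: "f \<in> carrier X \<Longrightarrow> \<exists>K. \<forall>p. cstar_seminorm X p \<longrightarrow> p f \<le> K"
  using cstar_seminorm_le_ell1 by blast

lemma cstar_seminorm_max_X: "cstar_seminorm X (max_seminorm X)"
  by (rule X.cstar_seminorm_max[OF bounded_cstar_seminorms])

lemma max_seminorm_upper_X: "\<lbrakk>cstar_seminorm X p; f \<in> carrier X\<rbrakk> \<Longrightarrow> p f \<le> max_seminorm X f"
  by (rule X.max_seminorm_upper[OF bounded_cstar_seminorms])

lemma max_seminorm_least_X: "(\<And>p. cstar_seminorm X p \<Longrightarrow> p f \<le> K) \<Longrightarrow> max_seminorm X f \<le> K"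
  by (rule X.max_seminorm_least[OF bounded_cstar_seminorms])

text \<open>Products and involutions need checking on single \<delta> only, where both sides are
  explicit formulas.\<close>

lemma star_hom_from_deltas:
  assumes B: "star_algebra B" and closed: "\<And>f. f \<in> carrier X \<Longrightarrow> \<phi> f \<in> carrier B"
    and add: "\<And>f g. \<lbrakk>f \<in> carrier X; g \<in> carrier X\<rbrakk> \<Longrightarrow> \<phi> (f \<oplus>\<^bsub>X\<^esub> g) = \<phi> f \<oplus>\<^bsub>B\<^esub> \<phi> g"
    and smult: "\<And>c f. f \<in> carrier X \<Longrightarrow> \<phi> (c \<odot>\<^bsub>X\<^esub> f) = c \<odot>\<^bsub>B\<^esub> \<phi> f"
    and delta_mult: "\<And>a s b t. \<lbrakk>s \<in> carrier \<Gamma>; t \<in> carrier \<Gamma>; a \<in> I s; b \<in> I t\<rbrakk> \<Longrightarrow>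
      \<phi> (\<delta> a s \<otimes>\<^bsub>X\<^esub> \<delta> b t) = \<phi> (\<delta> a s) \<otimes>\<^bsub>B\<^esub> \<phi> (\<delta> b t)"
    and delta_star: "\<And>a s. \<lbrakk>s \<in> carrier \<Gamma>; a \<in> I s\<rbrakk> \<Longrightarrow> \<phi> (star X (\<delta> a s)) = star B (\<phi> (\<delta> a s))"
  shows "star_hom X B \<phi>"
proof -
  interpret B: star_algebra B by fact
  have zero: "\<phi> \<zero>\<^bsub>X\<^esub> = \<zero>\<^bsub>B\<^esub>"
    using smult[OF X_zero, of 0] X.sm_zero_l[OF X_zero] B.sm_zero_l[OF closed[OF X_zero]] by simp
  have step: "\<phi> (\<delta> a s \<otimes>\<^bsub>X\<^esub> g) = \<phi> (\<delta> a s) \<otimes>\<^bsub>B\<^esub> \<phi> g"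
    if s: "s \<in> carrier \<Gamma>" "a \<in> I s" and g: "g \<in> carrier X" for a s g
    using g
  proof (induction g rule: delta_induct)
    case zero
    show ?case
      by (simp only: X.mult_zero_r[OF delta_closed[OF s]] \<open>\<phi> \<zero>\<^bsub>X\<^esub> = \<zero>\<^bsub>B\<^esub>\<close> B.mult_zero_r[OF closed[OF delta_closed[OF s]]])
  next
    case (delta b t) then show ?case using delta_mult s by blast
  next
    case (add f g)
    note d = delta_closed[OF s]
    show ?case
      by (simp only: X.r_distr[OF add.hyps d] assms(3)[OF X_mult[OF d add.hyps(1)] X_mult[OF d add.hyps(2)]]
          assms(3)[OF add.hyps] B.r_distr[OF closed[OF add.hyps(1)] closed[OF add.hyps(2)] closed[OF d]] add.IH)
  qed
  have "\<phi> (f \<otimes>\<^bsub>X\<^esub> g) = \<phi> f \<otimes>\<^bsub>B\<^esub> \<phi> g" if f: "f \<in> carrier X" and g: "g \<in> carrier X" for f g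
    using f
  proof (induction f rule: delta_induct)
    case zero
    show ?case
      by (simp only: X.mult_zero_l[OF g] \<open>\<phi> \<zero>\<^bsub>X\<^esub> = \<zero>\<^bsub>B\<^esub>\<close> B.mult_zero_l[OF closed[OF g]])
  next
    case (delta a s) then show ?case using step g by blast
  next
    case (add f f')
    show ?case
      by (simp only: X.l_distr[OF add.hyps g] assms(3)[OF X_mult[OF add.hyps(1) g] X_mult[OF add.hyps(2) g]]
          assms(3)[OF add.hyps] B.l_distr[OF closed[OF add.hyps(1)] closed[OF add.hyps(2)] closed[OF g]] add.IH)
  qed
  moreover have "\<phi> (star X f) = star B (\<phi> f)" if f: "f \<in> carrier X" for f
    using f
  proof (induction f rule: delta_induct)
    case zero
    show ?case by (simp only: X.star_zero \<open>\<phi> \<zero>\<^bsub>X\<^esub> = \<zero>\<^bsub>B\<^esub>\<close> B.star_zero)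
  next
    case (delta a s) then show ?case using delta_star by blast
  next
    case (add f g)
    show ?case
      by (simp only: X.star_add[OF add.hyps] assms(3)[OF X_star[OF add.hyps(1)] X_star[OF add.hyps(2)]]
          assms(3)[OF add.hyps] B.star_add[OF closed[OF add.hyps(1)] closed[OF add.hyps(2)]] add.IH)
  qed
  ultimately show ?thesis using closed add smult by (simp add: star_hom_def image_subset_iff)
qed

end

text \<open>The extension is the infimum of \<open>p b + N (x \<ominus> \<Phi> b)\<close> over b,
  which requires no choice of approximating sequences. The domination of p by N makes it agree with
  p on the image, also when \<Phi> is not injective. It is 1-Lipschitz for N, so the laws of a
  C*-seminorm pass from the dense image to X by limits.\<close>

lemma extend_cstar_seminorm_dense:
  assumes B: "star_algebra B" and X: "seminormed_star_algebra X N" and p: "cstar_seminorm B p"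
    and hom: "star_hom B X \<Phi>"
    and dense: "\<And>x e. \<lbrakk>x \<in> carrier X; (0::real) < e\<rbrakk> \<Longrightarrow> \<exists>b\<in>carrier B. N (x \<ominus>\<^bsub>X\<^esub> \<Phi> b) < e"
    and le: "\<And>b. b \<in> carrier B \<Longrightarrow> p b \<le> N (\<Phi> b)"
  obtains q where "cstar_seminorm X q" "\<And>b. b \<in> carrier B \<Longrightarrow> q (\<Phi> b) = p b"
proof -
  interpret B: star_algebra B by fact
  interpret X: seminormed_star_algebra X N by fact
  interpret pc: cstar_seminorm B p by fact
  interpret p: seminormed_star_algebra B p by (rule B.seminormed_of_cstar_seminorm[OF p])
  note hom_simps [simp] = star_homD[OF hom]
  define S where "S = (\<lambda>x. {p b + N (x \<ominus>\<^bsub>X\<^esub> \<Phi> b) |b. b \<in> carrier B})"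
  define q where "q = (\<lambda>x. Inf (S x))"
  have ne: "S x \<noteq> {}" for x using B.M.zero_closed unfolding S_def by blast
  have lower: "q x \<le> p b + N (x \<ominus>\<^bsub>X\<^esub> \<Phi> b)" if "x \<in> carrier X" "b \<in> carrier B" for x b
    unfolding q_def
  proof (rule cInf_lower)
    show "bdd_below (S x)"
      unfolding S_def using that by (intro bdd_belowI[of _ 0]) (auto intro!: add_nonneg_nonneg p.nonneg X.nonneg)
  qed (use that in \<open>auto simp: S_def\<close>)
  have greatest: "z \<le> q x" if "\<And>b. b \<in> carrier B \<Longrightarrow> z \<le> p b + N (x \<ominus>\<^bsub>X\<^esub> \<Phi> b)" for x z
    unfolding q_def by (rule cInf_greatest[OF ne]) (use that in \<open>auto simp: S_def\<close>)
  have q\<Phi>: "q (\<Phi> b) = p b" if b: "b \<in> carrier B" for b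
  proof (rule antisym)
    show "q (\<Phi> b) \<le> p b" using lower[of "\<Phi> b" b] b by simp
    show "p b \<le> q (\<Phi> b)"
    proof (rule greatest)
      fix c assume c: "c \<in> carrier B"
      have "p b \<le> p c + p (b \<ominus>\<^bsub>B\<^esub> c)" using p.p_rev_triangle[of b c] b c by linarith
      also have "p (b \<ominus>\<^bsub>B\<^esub> c) \<le> N (\<Phi> b \<ominus>\<^bsub>X\<^esub> \<Phi> c)"
        using le[of "b \<ominus>\<^bsub>B\<^esub> c"] b c by (simp add: star_hom_diff[OF B X.star_algebra_axioms hom])
      finally show "p b \<le> p c + N (\<Phi> b \<ominus>\<^bsub>X\<^esub> \<Phi> c)" by simp
    qed
  qed
  have lip: "q x \<le> q y + N (x \<ominus>\<^bsub>X\<^esub> y)" if [simp]: "x \<in> carrier X" "y \<in> carrier X" for x y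
  proof -
    have "q x - N (x \<ominus>\<^bsub>X\<^esub> y) \<le> q y"
    proof (rule greatest)
      fix b assume b: "b \<in> carrier B"
      show "q x - N (x \<ominus>\<^bsub>X\<^esub> y) \<le> p b + N (y \<ominus>\<^bsub>X\<^esub> \<Phi> b)"
        using lower[of x b] X.p_diff_triangle[of x y "\<Phi> b"] b by simp
    qed
    then show ?thesis by simp
  qed
  have cont: "(\<lambda>n. q (Y n)) \<longlonglongrightarrow> q y" if Y: "slim X N Y y" for Y y
  proof -
    note [simp] = slim_in[OF Y]
    have "(\<lambda>n. q (Y n) - q y) \<longlonglongrightarrow> 0"
    proof (rule Lim_null_comparison[OF always_eventually])
      show "(\<lambda>n. N (Y n \<ominus>\<^bsub>X\<^esub> y)) \<longlonglongrightarrow> 0" using Y by (simp add: slim_def)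
      show "\<forall>n. norm (q (Y n) - q y) \<le> N (Y n \<ominus>\<^bsub>X\<^esub> y)"
      proof
        fix n show "norm (q (Y n) - q y) \<le> N (Y n \<ominus>\<^bsub>X\<^esub> y)"
          using lip[of "Y n" y] lip[of y "Y n"] X.p_diff_comm[of y "Y n"] by (simp add: abs_le_iff)
      qed
    qed
    then show ?thesis by (simp add: LIM_zero_iff)
  qed
  have approx: "\<exists>b. (\<forall>n. b n \<in> carrier B) \<and> slim X N (\<lambda>n. \<Phi> (b n)) x" if x [simp]: "x \<in> carrier X" for x
  proof -
    have "\<forall>n. \<exists>b\<in>carrier B. N (x \<ominus>\<^bsub>X\<^esub> \<Phi> b) < 1 / real (Suc n)" using dense[OF x] by simp
    then obtain b where b: "\<And>n. b n \<in> carrier B" "\<And>n. N (x \<ominus>\<^bsub>X\<^esub> \<Phi> (b n)) < 1 / real (Suc n)" by metis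
    have "slim X N (\<lambda>n. \<Phi> (b n)) x"
    proof (rule X.slim_squeeze)
      show "(\<lambda>n. 1 / real (Suc n)) \<longlonglongrightarrow> 0" using LIMSEQ_Suc[OF lim_1_over_n] by simp
      show "N (\<Phi> (b n) \<ominus>\<^bsub>X\<^esub> x) \<le> 1 / real (Suc n)" for n
        using b[of n] X.p_diff_comm[of x "\<Phi> (b n)"] by simp
    qed (use b in simp_all)
    then show ?thesis using b by blast
  qed
  have "cstar_seminorm X q"
  proof
    fix x y c assume x: "x \<in> carrier X"
    obtain b where b [simp]: "\<And>n. b n \<in> carrier B" and bx: "slim X N (\<lambda>n. \<Phi> (b n)) x" using approx[OF x] by blast
    have lb: "(\<lambda>n. p (b n)) \<longlonglongrightarrow> q x" using cont[OF bx] by (simp add: q\<Phi>)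
    show "0 \<le> q x" by (rule greatest) (use x in \<open>auto intro!: add_nonneg_nonneg p.nonneg X.nonneg\<close>)
    have "(\<lambda>n. p (c \<odot>\<^bsub>B\<^esub> b n)) \<longlonglongrightarrow> q (c \<odot>\<^bsub>X\<^esub> x)"
      using cont[OF X.slim_smult[OF bx, of c]] q\<Phi>[of "c \<odot>\<^bsub>B\<^esub> b n" for n] by simp
    then show "q (c \<odot>\<^bsub>X\<^esub> x) = cmod c * q x"
      using tendsto_mult[OF tendsto_const lb, of "cmod c"] by (simp add: p.homogeneous LIMSEQ_unique)
    have "(\<lambda>n. p (star B (b n))) \<longlonglongrightarrow> q (star X x)"
      using cont[OF X.slim_star[OF bx]] q\<Phi>[of "star B (b n)" for n] by simp
    then show "q (star X x) = q x"
      using lb by (simp add: p.star_isometric LIMSEQ_unique)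
    have "(\<lambda>n. p (star B (b n) \<otimes>\<^bsub>B\<^esub> b n)) \<longlonglongrightarrow> q (star X x \<otimes>\<^bsub>X\<^esub> x)"
      using cont[OF X.slim_mult[OF X.slim_star[OF bx] bx]] q\<Phi>[of "star B (b n) \<otimes>\<^bsub>B\<^esub> b n" for n] by simp
    then show "q (star X x \<otimes>\<^bsub>X\<^esub> x) = (q x)\<^sup>2"
      using tendsto_power[OF lb, of 2] by (simp add: pc.cstar_identity LIMSEQ_unique)
    assume y: "y \<in> carrier X"
    obtain d where d [simp]: "\<And>n. d n \<in> carrier B" and dy: "slim X N (\<lambda>n. \<Phi> (d n)) y" using approx[OF y] by blast
    have ld: "(\<lambda>n. p (d n)) \<longlonglongrightarrow> q y" using cont[OF dy] by (simp add: q\<Phi>)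
    have "(\<lambda>n. p (b n \<oplus>\<^bsub>B\<^esub> d n)) \<longlonglongrightarrow> q (x \<oplus>\<^bsub>X\<^esub> y)"
      using cont[OF X.slim_add[OF bx dy]] q\<Phi>[of "b n \<oplus>\<^bsub>B\<^esub> d n" for n] by simp
    then show "q (x \<oplus>\<^bsub>X\<^esub> y) \<le> q x + q y"
      by (rule LIMSEQ_le[OF _ tendsto_add[OF lb ld]]) (auto intro!: exI[of _ 0] p.triangle)
    have "(\<lambda>n. p (b n \<otimes>\<^bsub>B\<^esub> d n)) \<longlonglongrightarrow> q (x \<otimes>\<^bsub>X\<^esub> y)"
      using cont[OF X.slim_mult[OF bx dy]] q\<Phi>[of "b n \<otimes>\<^bsub>B\<^esub> d n" for n] by simp
    then show "q (x \<otimes>\<^bsub>X\<^esub> y) \<le> q x * q y"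
      by (rule LIMSEQ_le[OF _ tendsto_mult[OF lb ld]]) (auto intro!: exI[of _ 0] p.submultiplicative)
  qed
  then show thesis using q\<Phi> by (rule that)
qed

section \<open>Isomorphisms from isometric relations\<close>

definition seq_closure :: "('a, 'm) cstar_alg_scheme \<Rightarrow> 'a set \<Rightarrow> 'a set" where
  "seq_closure A S = {x. \<exists>X. range X \<subseteq> S \<and> slim A (nrm A) X x}"

lemma seq_closureI: "\<lbrakk>\<And>n. X n \<in> S; slim A (nrm A) X x\<rbrakk> \<Longrightarrow> x \<in> seq_closure A S"
  by (auto simp: seq_closure_def)

lemma seq_closureE:
  assumes "x \<in> seq_closure A S"
  obtains X where "\<And>n. X n \<in> S" "slim A (nrm A) X x"
  using assms by (auto simp: seq_closure_def)

context cstar_algebra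
begin

lemma seq_closure_incl: "\<lbrakk>S \<subseteq> carrier A; x \<in> S\<rbrakk> \<Longrightarrow> x \<in> seq_closure A S"
  by (rule seq_closureI[of "\<lambda>_. x"]) (auto intro: N.slim_const)

text \<open>Approximating the n-th term within 1 / (n + 1) by an element of S shows that taking
  limits twice gives nothing new.\<close>

lemma seq_closure_closed:
  assumes X: "\<And>n. X n \<in> seq_closure A S" and x: "slim A (nrm A) X x" and S: "S \<subseteq> carrier A"
  shows "x \<in> seq_closure A S"
proof -
  note [simp] = slim_in[OF x]
  have "\<exists>s\<in>S. nrm A (s \<ominus> X n) < 1 / real (Suc n)" for n
  proof -
    obtain Y where Y: "\<And>k. Y k \<in> S" "slim A (nrm A) Y (X n)" using X[of n] by (rule seq_closureE) blast
    have "\<forall>\<^sub>F k in sequentially. nrm A (Y k \<ominus> X n) < 1 / real (Suc n)"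
      using Y(2) by (intro order_tendstoD(2)[of _ 0]) (auto simp: slim_def)
    then show ?thesis using Y(1) by (auto simp: eventually_sequentially)
  qed
  then obtain s where s: "\<And>n. s n \<in> S" and sX: "\<And>n. nrm A (s n \<ominus> X n) < 1 / real (Suc n)" by metis
  have sA [simp]: "s n \<in> carrier A" for n using s S by blast
  have "slim A (nrm A) s x"
  proof (rule N.slim_squeeze)
    show "(\<lambda>n. 1 / real (Suc n) + nrm A (X n \<ominus> x)) \<longlonglongrightarrow> 0"
      using x LIMSEQ_Suc[OF lim_1_over_n] by (intro tendsto_add_zero) (auto simp: slim_def)
    show "nrm A (s n \<ominus> x) \<le> 1 / real (Suc n) + nrm A (X n \<ominus> x)" for n
      using N.p_diff_triangle[of "s n" "X n" x] sX[of n] by simp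
  qed simp_all
  then show ?thesis using s by (intro seq_closureI)
qed

text \<open>Absorption is demanded only for factors from D, a set whose limits fill A: a product of
  two limits is the limit of the products.\<close>

lemma closed_ideal_seq_closure:
  assumes S: "star_closed_subset S A" and D: "\<And>a. a \<in> carrier A \<Longrightarrow> a \<in> seq_closure A D"
    and DS: "\<And>d s. \<lbrakk>d \<in> D; s \<in> S\<rbrakk> \<Longrightarrow> d \<otimes> s \<in> S \<and> s \<otimes> d \<in> S"
  shows "closed_two_sided_ideal (seq_closure A S) A"
  unfolding closed_two_sided_ideal_iff two_sided_ideal_def
proof (intro conjI ballI allI impI)
  have SA: "S \<subseteq> carrier A" using S by (simp add: star_closed_subset_def)
  show "seq_closure A S \<subseteq> carrier A" by (auto simp: seq_closure_def slim_def)
  show "\<zero> \<in> seq_closure A S"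
    using S by (intro seq_closure_incl[OF SA]) (simp add: star_closed_subset_def)
  show "x \<in> seq_closure A S" if "range X \<subseteq> seq_closure A S" "slim A (nrm A) X x" for X x
    using that by (intro seq_closure_closed[OF _ that(2) SA]) auto
  fix x assume "x \<in> seq_closure A S"
  then obtain X where X: "\<And>n. X n \<in> S" "slim A (nrm A) X x" by (rule seq_closureE) blast
  show "c \<odot> x \<in> seq_closure A S" for c
    by (rule seq_closureI[OF _ N.slim_smult[OF X(2)]]) (use X S in \<open>simp add: star_closed_subset_def\<close>)
  show "x \<oplus> y \<in> seq_closure A S" if y: "y \<in> seq_closure A S" for y
  proof -
    obtain Y where Y: "\<And>n. Y n \<in> S" "slim A (nrm A) Y y" using y by (rule seq_closureE) blast
    show ?thesis
      by (rule seq_closureI[OF _ N.slim_add[OF X(2) Y(2)]]) (use X Y S in \<open>simp add: star_closed_subset_def\<close>)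
  qed
  fix a assume "a \<in> carrier A"
  then have "a \<in> seq_closure A D" by (rule D)
  then obtain Y where Y: "\<And>n. Y n \<in> D" "slim A (nrm A) Y a" by (rule seq_closureE) blast
  show "a \<otimes> x \<in> seq_closure A S"
    by (rule seq_closureI[OF _ N.slim_mult[OF Y(2) X(2)]]) (use X Y DS in simp)
  show "x \<otimes> a \<in> seq_closure A S"
    by (rule seq_closureI[OF _ N.slim_mult[OF X(2) Y(2)]]) (use X Y DS in simp)
qed

end

text \<open>A norm-preserving relation that is closed under the operations is the graph of a partial
  isomorphism; its closure is the graph of an isomorphism between the closures of domain and range.\<close>

locale isometric_star_relation = C1: cstar_algebra C1 + C2: cstar_algebra C2
  for C1 :: "('a, 'm) cstar_alg_scheme" and C2 :: "('b, 'n) cstar_alg_scheme" +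
  fixes R :: "('a \<times> 'b) set"
  assumes rel_carrier: "(x, y) \<in> R \<Longrightarrow> x \<in> carrier C1 \<and> y \<in> carrier C2"
    and rel_zero: "(\<zero>\<^bsub>C1\<^esub>, \<zero>\<^bsub>C2\<^esub>) \<in> R"
    and rel_add: "\<lbrakk>(x, y) \<in> R; (x', y') \<in> R\<rbrakk> \<Longrightarrow> (x \<oplus>\<^bsub>C1\<^esub> x', y \<oplus>\<^bsub>C2\<^esub> y') \<in> R"
    and rel_smult: "(x, y) \<in> R \<Longrightarrow> (c \<odot>\<^bsub>C1\<^esub> x, c \<odot>\<^bsub>C2\<^esub> y) \<in> R"
    and rel_mult: "\<lbrakk>(x, y) \<in> R; (x', y') \<in> R\<rbrakk> \<Longrightarrow> (x \<otimes>\<^bsub>C1\<^esub> x', y \<otimes>\<^bsub>C2\<^esub> y') \<in> R"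
    and rel_star: "(x, y) \<in> R \<Longrightarrow> (star C1 x, star C2 y) \<in> R"
    and rel_iso: "(x, y) \<in> R \<Longrightarrow> nrm C1 x = nrm C2 y"
begin

lemma converse_relation: "isometric_star_relation C2 C1 (R\<inverse>)"
  using rel_carrier rel_zero rel_add rel_smult rel_mult rel_star rel_iso
  by unfold_locales (auto simp: rel_iso)

lemma rel_diff: "\<lbrakk>(x, y) \<in> R; (x', y') \<in> R\<rbrakk> \<Longrightarrow> (x \<ominus>\<^bsub>C1\<^esub> x', y \<ominus>\<^bsub>C2\<^esub> y') \<in> R"
  using rel_add[OF _ rel_smult[of x' y' "-1"], of x y] rel_carrier[of x y] rel_carrier[of x' y']
  by (simp add: C1.minus_sm C2.minus_sm)

text \<open>Y is Cauchy because differences of related pairs are related and hence have equal norms;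
  completeness of \<open>C2\<close> supplies the limit.\<close>

lemma limit_transfer:
  assumes XY: "\<And>n. (X n, Y n) \<in> R" and X: "slim C1 (nrm C1) X x"
  obtains y where "slim C2 (nrm C2) Y y"
proof -
  have "Y \<in> cauchy_seqs C2 (nrm C2)"
    using C1.slim_cauchy[OF X] XY rel_carrier rel_iso[OF rel_diff[OF XY XY]] by (auto simp: cauchy_seqs_def)
  then show thesis using that by (rule C2.cauchy_slim)
qed

definition closure_graph :: "('a \<times> 'b) set" where
  "closure_graph = {(x, y). \<exists>X Y. (\<forall>n. (X n, Y n) \<in> R) \<and> slim C1 (nrm C1) X x \<and> slim C2 (nrm C2) Y y}"

lemma graphI:
  "\<lbrakk>\<And>n. (X n, Y n) \<in> R; slim C1 (nrm C1) X x; slim C2 (nrm C2) Y y\<rbrakk> \<Longrightarrow> (x, y) \<in> closure_graph"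
  by (auto simp: closure_graph_def)

lemma graphE:
  assumes "(x, y) \<in> closure_graph"
  obtains X Y where "\<And>n. (X n, Y n) \<in> R" "slim C1 (nrm C1) X x" "slim C2 (nrm C2) Y y"
  using assms by (auto simp: closure_graph_def)

lemma rel_graph: "(x, y) \<in> R \<Longrightarrow> (x, y) \<in> closure_graph"
  by (rule graphI[of "\<lambda>_. x" "\<lambda>_. y"]) (auto intro: C1.N.slim_const C2.N.slim_const dest: rel_carrier)

lemma graph_carrier: "(x, y) \<in> closure_graph \<Longrightarrow> x \<in> carrier C1 \<and> y \<in> carrier C2"
  by (auto elim!: graphE dest: slim_in)

lemma graph_iso: "(x, y) \<in> closure_graph \<Longrightarrow> nrm C1 x = nrm C2 y"
proof (elim graphE)
  fix X Y assume XY: "\<And>n. (X n, Y n) \<in> R" "slim C1 (nrm C1) X x" "slim C2 (nrm C2) Y y"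
  have "(\<lambda>n. nrm C2 (Y n)) \<longlonglongrightarrow> nrm C1 x" using C1.N.slim_p[OF XY(2)] rel_iso[OF XY(1)] by simp
  then show ?thesis using C2.N.slim_p[OF XY(3)] LIMSEQ_unique by blast
qed

lemma graph_add: "\<lbrakk>(x, y) \<in> closure_graph; (x', y') \<in> closure_graph\<rbrakk> \<Longrightarrow> (x \<oplus>\<^bsub>C1\<^esub> x', y \<oplus>\<^bsub>C2\<^esub> y') \<in> closure_graph"
  by (elim graphE, rule graphI, rule rel_add, assumption+, erule C1.N.slim_add, assumption, erule C2.N.slim_add, assumption)

lemma graph_mult: "\<lbrakk>(x, y) \<in> closure_graph; (x', y') \<in> closure_graph\<rbrakk> \<Longrightarrow> (x \<otimes>\<^bsub>C1\<^esub> x', y \<otimes>\<^bsub>C2\<^esub> y') \<in> closure_graph"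
  by (elim graphE, rule graphI, rule rel_mult, assumption+, erule C1.N.slim_mult, assumption, erule C2.N.slim_mult, assumption)

lemma graph_smult: "(x, y) \<in> closure_graph \<Longrightarrow> (c \<odot>\<^bsub>C1\<^esub> x, c \<odot>\<^bsub>C2\<^esub> y) \<in> closure_graph"
  by (elim graphE, rule graphI, rule rel_smult, assumption, erule C1.N.slim_smult, erule C2.N.slim_smult)

lemma graph_star: "(x, y) \<in> closure_graph \<Longrightarrow> (star C1 x, star C2 y) \<in> closure_graph"
  by (elim graphE, rule graphI, rule rel_star, assumption, erule C1.N.slim_star, erule C2.N.slim_star)

lemma graph_diff: "\<lbrakk>(x, y) \<in> closure_graph; (x', y') \<in> closure_graph\<rbrakk> \<Longrightarrow> (x \<ominus>\<^bsub>C1\<^esub> x', y \<ominus>\<^bsub>C2\<^esub> y') \<in> closure_graph"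
  using graph_add[OF _ graph_smult[of x' y' "-1"], of x y] graph_carrier[of x y] graph_carrier[of x' y']
  by (simp add: C1.minus_sm C2.minus_sm)

text \<open>Single-valuedness is a consequence of isometry: two values at x differ by an element
  related to zero, which therefore has norm zero.\<close>

lemma graph_unique: "\<lbrakk>(x, y) \<in> closure_graph; (x, y') \<in> closure_graph\<rbrakk> \<Longrightarrow> y = y'"
  using graph_iso[OF graph_diff, of x y x y'] graph_carrier[of x y] graph_carrier[of x y']
    C2.definite[of "y \<ominus>\<^bsub>C2\<^esub> y'"] C2.diff_eq_zero[of y y'] by simp

lemma graph_inj: "\<lbrakk>(x, y) \<in> closure_graph; (x', y) \<in> closure_graph\<rbrakk> \<Longrightarrow> x = x'"
  using graph_iso[OF graph_diff, of x y x' y] graph_carrier[of x y] graph_carrier[of x' y]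
    C1.definite[of "x \<ominus>\<^bsub>C1\<^esub> x'"] C1.diff_eq_zero[of x x'] by simp

definition extension :: "'a \<Rightarrow> 'b" where
  "extension x = (THE y. (x, y) \<in> closure_graph)"

lemma extension_eq: "(x, y) \<in> closure_graph \<Longrightarrow> extension x = y"
  unfolding extension_def by (rule the_equality) (auto intro: graph_unique)

lemma domain_graph: "x \<in> seq_closure C1 (Domain R) \<longleftrightarrow> (\<exists>y. (x, y) \<in> closure_graph)"
proof
  assume "x \<in> seq_closure C1 (Domain R)"
  then obtain X where X: "\<And>n. X n \<in> Domain R" "slim C1 (nrm C1) X x" by (rule seq_closureE) blast
  then have "\<forall>n. \<exists>y. (X n, y) \<in> R" by blast
  then obtain Y where Y: "\<And>n. (X n, Y n) \<in> R" by metis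
  obtain y where "slim C2 (nrm C2) Y y" using limit_transfer[OF Y X(2)] .
  then show "\<exists>y. (x, y) \<in> closure_graph" using graphI[OF Y X(2)] by blast
next
  assume "\<exists>y. (x, y) \<in> closure_graph"
  then show "x \<in> seq_closure C1 (Domain R)" by (auto elim!: graphE intro: seq_closureI)
qed

lemma extension_graph: "x \<in> seq_closure C1 (Domain R) \<Longrightarrow> (x, extension x) \<in> closure_graph"
  using domain_graph extension_eq by blast

text \<open>The axioms on \<open>R\<close> are symmetric in the two algebras, so this is
  \<open>domain_graph\<close> for the converse relation.\<close>

lemma range_graph: "y \<in> seq_closure C2 (Range R) \<longleftrightarrow> (\<exists>x. (x, y) \<in> closure_graph)"
proof -
  interpret conv: isometric_star_relation C2 C1 "R\<inverse>" by (rule converse_relation)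
  have "(y, x) \<in> conv.closure_graph \<longleftrightarrow> (x, y) \<in> closure_graph" for x
    unfolding closure_graph_def conv.closure_graph_def by auto
  then show ?thesis using conv.domain_graph[of y] by simp
qed

lemma extension_rel: "(x, y) \<in> R \<Longrightarrow> extension x = y"
  by (intro extension_eq rel_graph)

lemma star_isomorphism_extension:
  "star_isomorphism (C1\<lparr>carrier := seq_closure C1 (Domain R)\<rparr>) (C2\<lparr>carrier := seq_closure C2 (Range R)\<rparr>) extension"
  unfolding star_isomorphism_def
proof (intro conjI ballI allI; simp)
  show "bij_betw extension (seq_closure C1 (Domain R)) (seq_closure C2 (Range R))"
  proof (rule bij_betwI')
    fix x x' assume x: "x \<in> seq_closure C1 (Domain R)" and x': "x' \<in> seq_closure C1 (Domain R)"
    show "(extension x = extension x') = (x = x')"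
      using extension_graph[OF x] extension_graph[OF x'] graph_inj by metis
  next
    show "extension x \<in> seq_closure C2 (Range R)" if "x \<in> seq_closure C1 (Domain R)" for x
      using extension_graph[OF that] range_graph by blast
    fix y assume "y \<in> seq_closure C2 (Range R)"
    then obtain x where x: "(x, y) \<in> closure_graph" using range_graph by blast
    then show "\<exists>x\<in>seq_closure C1 (Domain R). y = extension x"
      using domain_graph extension_eq by blast
  qed
qed (auto intro!: extension_eq graph_add graph_smult graph_mult graph_star extension_graph)

end

text \<open>Whatever \<Phi> identifies is at seminorm distance zero, so isometry makes the induced
  map on classes well defined and injective. It is onto because its range is closed and contains, by
  density of the image of \<Phi>, the classes of all constant sequences, which are dense.\<close>

lemma completion_isomorphism:
  assumes B: "cstar_seminormed B p" and X: "cstar_seminormed X q" and hom: "star_hom B X \<Phi>"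
    and iso: "\<And>b. b \<in> carrier B \<Longrightarrow> q (\<Phi> b) = p b"
    and dense: "\<And>x e. \<lbrakk>x \<in> carrier X; (0::real) < e\<rbrakk> \<Longrightarrow> \<exists>b\<in>carrier B. q (x \<ominus>\<^bsub>X\<^esub> \<Phi> b) < e"
  obtains \<phi> where "star_isomorphism (completion B p) (completion X q) \<phi>"
    "\<And>b. b \<in> carrier B \<Longrightarrow> \<phi> (cauchy_rel B p `` {\<lambda>n. b}) = cauchy_rel X q `` {\<lambda>n. \<Phi> b}"
proof -
  interpret B: cstar_seminormed B p by fact
  interpret X: cstar_seminormed X q by fact
  interpret C1: cstar_algebra "B.C" by (rule B.cstar_algebra_completion)
  interpret C2: cstar_algebra "X.C" by (rule X.cstar_algebra_completion)
  define i where "i = (\<lambda>b. B.emb b)"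
  define j where "j = (\<lambda>x. X.emb x)"
  have i: "star_hom B B.C i" unfolding i_def by (rule B.star_hom_emb)
  have j: "star_hom X X.C j" unfolding j_def by (rule X.star_hom_emb)
  note i_hom = star_homD[OF i] and j_hom = star_homD[OF j] and \<Phi>_hom = star_homD[OF hom]
  define R where "R = {(i b, j (\<Phi> b)) |b. b \<in> carrier B}"
  have R_I: "(i b, j (\<Phi> b)) \<in> R" if "b \<in> carrier B" for b using that by (auto simp: R_def)
  interpret R: isometric_star_relation B.C X.C R
  proof
    show "(\<zero>\<^bsub>B.C\<^esub>, \<zero>\<^bsub>X.C\<^esub>) \<in> R"
      using R_I[OF B.M.zero_closed] star_hom_zero[OF B.star_algebra_axioms B.star_algebra_C i]
        star_hom_zero[OF X.star_algebra_axioms X.star_algebra_C j]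
        star_hom_zero[OF B.star_algebra_axioms X.star_algebra_axioms hom] by simp
    fix x y assume "(x, y) \<in> R"
    then obtain b where b: "b \<in> carrier B" and xy: "x = i b" "y = j (\<Phi> b)" by (auto simp: R_def)
    show "x \<in> carrier B.C \<and> y \<in> carrier X.C" by (simp add: xy b i_hom(1) j_hom(1) \<Phi>_hom(1))
    have "nrm B.C x = p b" unfolding xy i_def by (rule B.nrm_emb[OF b])
    moreover have "nrm X.C y = q (\<Phi> b)" unfolding xy j_def by (rule X.nrm_emb[OF \<Phi>_hom(1)[OF b]])
    ultimately show "nrm B.C x = nrm X.C y" using iso[OF b] by simp
    show "(c \<odot>\<^bsub>B.C\<^esub> x, c \<odot>\<^bsub>X.C\<^esub> y) \<in> R" for c
      using R_I[of "c \<odot>\<^bsub>B\<^esub> b"] b by (simp add: xy i_hom j_hom \<Phi>_hom)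
    show "(star B.C x, star X.C y) \<in> R"
      using R_I[of "star B b"] b by (simp add: xy i_hom j_hom \<Phi>_hom)
    fix x' y' assume "(x', y') \<in> R"
    then obtain b' where b': "b' \<in> carrier B" and xy': "x' = i b'" "y' = j (\<Phi> b')" by (auto simp: R_def)
    show "(x \<oplus>\<^bsub>B.C\<^esub> x', y \<oplus>\<^bsub>X.C\<^esub> y') \<in> R"
      using R_I[of "b \<oplus>\<^bsub>B\<^esub> b'"] b b' by (simp add: xy xy' i_hom j_hom \<Phi>_hom)
    show "(x \<otimes>\<^bsub>B.C\<^esub> x', y \<otimes>\<^bsub>X.C\<^esub> y') \<in> R"
      using R_I[of "b \<otimes>\<^bsub>B\<^esub> b'"] b b' by (simp add: xy xy' i_hom j_hom \<Phi>_hom)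
  qed
  have cl_carrier: "seq_closure B.C (Domain R) \<subseteq> carrier B.C" "seq_closure X.C (Range R) \<subseteq> carrier X.C"
    by (auto simp: seq_closure_def slim_def)
  have dom: "seq_closure B.C (Domain R) = carrier B.C"
  proof
    show "carrier B.C \<subseteq> seq_closure B.C (Domain R)"
    proof
      fix U assume "U \<in> carrier B.C"
      then obtain b where b: "\<And>n. b n \<in> carrier B" "slim B.C (nrm B.C) (\<lambda>n. i (b n)) U"
        unfolding i_def by (rule B.emb_dense) blast
      show "U \<in> seq_closure B.C (Domain R)"
        by (rule seq_closureI[OF _ b(2)]) (use R_I[OF b(1)] in blast)
    qed
  qed (rule cl_carrier)
  have range: "seq_closure X.C (Range R) = carrier X.C"
  proof
    have RC: "Range R \<subseteq> carrier X.C" using R.rel_carrier by blast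
    have cl: "j x \<in> seq_closure X.C (Range R)" if x: "x \<in> carrier X" for x
    proof -
      have "\<forall>n. \<exists>b\<in>carrier B. q (x \<ominus>\<^bsub>X\<^esub> \<Phi> b) < 1 / real (Suc n)" using dense[OF x] by simp
      then obtain b where b: "\<And>n. b n \<in> carrier B" "\<And>n. q (x \<ominus>\<^bsub>X\<^esub> \<Phi> (b n)) < 1 / real (Suc n)" by metis
      note [simp] = x \<Phi>_hom(1)[OF b(1)]
      have "slim X.C (nrm X.C) (\<lambda>n. j (\<Phi> (b n))) (j x)"
      proof (rule C2.N.slim_squeeze)
        show "(\<lambda>n. 1 / real (Suc n)) \<longlonglongrightarrow> 0" using LIMSEQ_Suc[OF lim_1_over_n] by simp
        fix n
        have "j (\<Phi> (b n)) \<ominus>\<^bsub>X.C\<^esub> j x = j (\<Phi> (b n) \<ominus>\<^bsub>X\<^esub> x)"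
          using star_hom_diff[OF X.star_algebra_axioms X.star_algebra_C j, of "\<Phi> (b n)" x] by simp
        then have "nrm X.C (j (\<Phi> (b n)) \<ominus>\<^bsub>X.C\<^esub> j x) = q (\<Phi> (b n) \<ominus>\<^bsub>X\<^esub> x)"
          using X.nrm_emb[of "\<Phi> (b n) \<ominus>\<^bsub>X\<^esub> x"] unfolding j_def by simp
        then show "nrm X.C (j (\<Phi> (b n)) \<ominus>\<^bsub>X.C\<^esub> j x) \<le> 1 / real (Suc n)"
          using b(2)[of n] X.p_diff_comm[of x "\<Phi> (b n)"] by simp
      qed (simp_all add: j_hom(1))
      then show ?thesis by (rule seq_closureI[rotated]) (use R_I[OF b(1)] in blast)
    qed
    show "carrier X.C \<subseteq> seq_closure X.C (Range R)"
    proof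
      fix U assume "U \<in> carrier X.C"
      then obtain x where x: "\<And>n. x n \<in> carrier X" "slim X.C (nrm X.C) (\<lambda>n. j (x n)) U"
        unfolding j_def by (rule X.emb_dense) blast
      show "U \<in> seq_closure X.C (Range R)" by (rule C2.seq_closure_closed[OF cl[OF x(1)] x(2) RC])
    qed
  qed (rule cl_carrier)
  show thesis
  proof (rule that)
    show "star_isomorphism B.C X.C R.extension"
      using R.star_isomorphism_extension unfolding dom range by simp
    show "R.extension (B.emb b) = X.emb (\<Phi> b)" if "b \<in> carrier B" for b
      using R.extension_rel[OF R_I[OF that]] unfolding i_def j_def .
  qed
qed

section \<open>The action of \<open>H\<close> on \<open>A \<rtimes> G\<close>\<close>

locale semidirect_partial_action =
  G: group G + H: group H + T: partial_action A "semidirect_product G \<alpha> H" I \<theta>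
  for A :: "('a, 'm) cstar_alg_scheme"
    and G :: "('g, 'n) monoid_scheme" and H :: "('h, 'k) monoid_scheme"
    and \<alpha> :: "'h \<Rightarrow> 'g \<Rightarrow> 'g" and I :: "'g \<times> 'h \<Rightarrow> 'a set" and \<theta> :: "'g \<times> 'h \<Rightarrow> 'a \<Rightarrow> 'a" +
  assumes action: "\<alpha> \<in> hom H (AutoGroup G)"
    and domains: "\<lbrakk>g \<in> carrier G; h \<in> carrier H\<rbrakk> \<Longrightarrow> I (g, h) \<subseteq> I (g, \<one>\<^bsub>H\<^esub>) \<inter> I (\<one>\<^bsub>G\<^esub>, h)"
begin

abbreviation "\<Gamma> \<equiv> semidirect_product G \<alpha> H"

lemma \<Gamma>_simps [simp]: "carrier \<Gamma> = carrier G \<times> carrier H" "\<one>\<^bsub>\<Gamma>\<^esub> = (\<one>\<^bsub>G\<^esub>, \<one>\<^bsub>H\<^esub>)"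
  "(g, h) \<otimes>\<^bsub>\<Gamma>\<^esub> (g', h') = (g \<otimes>\<^bsub>G\<^esub> \<alpha> h g', h \<otimes>\<^bsub>H\<^esub> h')"
  by (simp_all add: semidirect_product_def)

lemma alpha_auto: "h \<in> carrier H \<Longrightarrow> \<alpha> h \<in> hom G G \<inter> Bij (carrier G)"
  using hom_in_carrier[OF action] by (simp add: AutoGroup_def auto_def)

lemma alpha_closed [simp]: "\<lbrakk>h \<in> carrier H; g \<in> carrier G\<rbrakk> \<Longrightarrow> \<alpha> h g \<in> carrier G"
  and alpha_mult: "\<lbrakk>h \<in> carrier H; g \<in> carrier G; g' \<in> carrier G\<rbrakk> \<Longrightarrow> \<alpha> h (g \<otimes>\<^bsub>G\<^esub> g') = \<alpha> h g \<otimes>\<^bsub>G\<^esub> \<alpha> h g'"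
  using alpha_auto[of h] by (auto simp: hom_def)

lemma alpha_comp: "\<lbrakk>h \<in> carrier H; h' \<in> carrier H; g \<in> carrier G\<rbrakk> \<Longrightarrow> \<alpha> (h \<otimes>\<^bsub>H\<^esub> h') g = \<alpha> h (\<alpha> h' g)"
  using hom_mult[OF action, of h h'] alpha_auto[of h] alpha_auto[of h']
  by (simp add: AutoGroup_def BijGroup_def compose_def)

lemma alpha_group_hom: "h \<in> carrier H \<Longrightarrow> group_hom G G (\<alpha> h)"
  using alpha_auto[of h] by (intro group_hom.intro group_hom_axioms.intro G.is_group) auto

lemma alpha_one_right [simp]: "h \<in> carrier H \<Longrightarrow> \<alpha> h \<one>\<^bsub>G\<^esub> = \<one>\<^bsub>G\<^esub>"
  and alpha_inv: "\<lbrakk>h \<in> carrier H; g \<in> carrier G\<rbrakk> \<Longrightarrow> \<alpha> h (inv\<^bsub>G\<^esub> g) = inv\<^bsub>G\<^esub> \<alpha> h g"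
  using group_hom.hom_one[OF alpha_group_hom] group_hom.hom_inv[OF alpha_group_hom] by auto

text \<open>An injective idempotent map is the identity.\<close>

lemma alpha_one [simp]:
  assumes g: "g \<in> carrier G"
  shows "\<alpha> \<one>\<^bsub>H\<^esub> g = g"
proof -
  have inj: "inj_on (\<alpha> \<one>\<^bsub>H\<^esub>) (carrier G)"
    using alpha_auto[of "\<one>\<^bsub>H\<^esub>"] by (auto simp: Bij_def bij_betw_def)
  have "\<alpha> \<one>\<^bsub>H\<^esub> (\<alpha> \<one>\<^bsub>H\<^esub> g) = \<alpha> \<one>\<^bsub>H\<^esub> g" using alpha_comp[of "\<one>\<^bsub>H\<^esub>" "\<one>\<^bsub>H\<^esub>" g] g by simp
  then show ?thesis using inj g by (auto dest: inj_onD)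
qed

lemma alpha_inv_cancel [simp]:
  "\<lbrakk>h \<in> carrier H; g \<in> carrier G\<rbrakk> \<Longrightarrow> \<alpha> h (\<alpha> (inv\<^bsub>H\<^esub> h) g) = g"
  "\<lbrakk>h \<in> carrier H; g \<in> carrier G\<rbrakk> \<Longrightarrow> \<alpha> (inv\<^bsub>H\<^esub> h) (\<alpha> h g) = g"
  by (simp_all add: alpha_comp[symmetric])

lemma inv_\<Gamma> [simp]:
  "\<lbrakk>g \<in> carrier G; h \<in> carrier H\<rbrakk> \<Longrightarrow> inv\<^bsub>\<Gamma>\<^esub> (g, h) = (inv\<^bsub>G\<^esub> (\<alpha> (inv\<^bsub>H\<^esub> h) g), inv\<^bsub>H\<^esub> h)"
  by (rule T.\<Gamma>.inv_equality) simp_all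

text \<open>For the inclusion that is not assumed, a in I(g, 1) \<inter> I(1, h) is moved by h^-1
  into I(k, h^-1), where k is the image of g under h^-1. There the assumed inclusion, used at this
  other group element, yields membership in I(k, 1), and moving back by h lands in I(g, h).\<close>

lemma I_eq: 
  assumes g: "g \<in> carrier G" and h: "h \<in> carrier H"
  shows "I (g, h) = I (g, \<one>\<^bsub>H\<^esub>) \<inter> I (\<one>\<^bsub>G\<^esub>, h)"
proof
  show "I (g, \<one>\<^bsub>H\<^esub>) \<inter> I (\<one>\<^bsub>G\<^esub>, h) \<subseteq> I (g, h)"
  proof
    fix a assume a: "a \<in> I (g, \<one>\<^bsub>H\<^esub>) \<inter> I (\<one>\<^bsub>G\<^esub>, h)"
    let ?k = "inv\<^bsub>H\<^esub> h"
    have "\<theta> (\<one>\<^bsub>G\<^esub>, ?k) a \<in> I (\<alpha> ?k g, ?k)"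
      using T.theta_dom[of "(\<one>\<^bsub>G\<^esub>, ?k)" "(g, \<one>\<^bsub>H\<^esub>)" a] a g h by simp
    then have "\<theta> (\<one>\<^bsub>G\<^esub>, ?k) a \<in> I (\<alpha> ?k g, \<one>\<^bsub>H\<^esub>)" "\<theta> (\<one>\<^bsub>G\<^esub>, ?k) a \<in> I (\<one>\<^bsub>G\<^esub>, ?k)"
      using domains[of "\<alpha> ?k g" ?k] g h by auto
    then show "a \<in> I (g, h)"
      using T.theta_dom[of "(\<one>\<^bsub>G\<^esub>, h)" "(\<alpha> ?k g, \<one>\<^bsub>H\<^esub>)" "\<theta> (\<one>\<^bsub>G\<^esub>, ?k) a"]
        T.theta_inv'[of "(\<one>\<^bsub>G\<^esub>, h)" a] a g h by simp
  qed
qed (use domains g h in blast)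

lemma I_memI: "\<lbrakk>g \<in> carrier G; h \<in> carrier H; x \<in> I (g, \<one>\<^bsub>H\<^esub>); x \<in> I (\<one>\<^bsub>G\<^esub>, h)\<rbrakk> \<Longrightarrow> x \<in> I (g, h)"
  using I_eq by blast

sublocale PG: partial_action A G "\<lambda>g. I (g, \<one>\<^bsub>H\<^esub>)" "\<lambda>g. \<theta> (g, \<one>\<^bsub>H\<^esub>)"
proof (intro partial_action.intro T.cstar_algebra_axioms G.is_group partial_action_axioms.intro)
  fix s t x
  show "closed_two_sided_ideal (I (s, \<one>\<^bsub>H\<^esub>)) A" if "s \<in> carrier G" using that T.ideal by simp
  show "star_isomorphism (A\<lparr>carrier := I (inv\<^bsub>G\<^esub> s, \<one>\<^bsub>H\<^esub>)\<rparr>) (A\<lparr>carrier := I (s, \<one>\<^bsub>H\<^esub>)\<rparr>) (\<theta> (s, \<one>\<^bsub>H\<^esub>))"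
    if "s \<in> carrier G" using that T.iso[of "(s, \<one>\<^bsub>H\<^esub>)"] by simp
  show "I (\<one>\<^bsub>G\<^esub>, \<one>\<^bsub>H\<^esub>) = carrier A" using T.one_domain by simp
  show "\<theta> (\<one>\<^bsub>G\<^esub>, \<one>\<^bsub>H\<^esub>) x = x" if "x \<in> carrier A" using that T.one_action by simp
  show "x \<in> I (inv\<^bsub>G\<^esub> (t \<otimes>\<^bsub>G\<^esub> s), \<one>\<^bsub>H\<^esub>)"
    if "s \<in> carrier G" "t \<in> carrier G" "x \<in> I (inv\<^bsub>G\<^esub> s, \<one>\<^bsub>H\<^esub>)" "\<theta> (s, \<one>\<^bsub>H\<^esub>) x \<in> I (inv\<^bsub>G\<^esub> t, \<one>\<^bsub>H\<^esub>)"
    using T.mult_domain[of "(s, \<one>\<^bsub>H\<^esub>)" "(t, \<one>\<^bsub>H\<^esub>)" x] that by simp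
  show "\<theta> (t \<otimes>\<^bsub>G\<^esub> s, \<one>\<^bsub>H\<^esub>) x = \<theta> (t, \<one>\<^bsub>H\<^esub>) (\<theta> (s, \<one>\<^bsub>H\<^esub>) x)"
    if "s \<in> carrier G" "t \<in> carrier G" "x \<in> I (inv\<^bsub>G\<^esub> s, \<one>\<^bsub>H\<^esub>)" "\<theta> (s, \<one>\<^bsub>H\<^esub>) x \<in> I (inv\<^bsub>G\<^esub> t, \<one>\<^bsub>H\<^esub>)"
    using T.mult_action[of "(s, \<one>\<^bsub>H\<^esub>)" "(t, \<one>\<^bsub>H\<^esub>)" x] that by simp
qed

text \<open>Both composites are the partial map at the group element (1, h) (g, 1) = (\<alpha> h g,
  1) (1, h). Its domain is I(g^-1, h^-1), and by \<open>I_eq\<close> the two memberships of x amount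
  to this domain.\<close>

lemma theta_commute:
  assumes g: "g \<in> carrier G" and h: "h \<in> carrier H"
    and x: "x \<in> I (\<one>\<^bsub>G\<^esub>, inv\<^bsub>H\<^esub> h)" "x \<in> I (inv\<^bsub>G\<^esub> g, \<one>\<^bsub>H\<^esub>)"
  shows "\<theta> (\<alpha> h g, \<one>\<^bsub>H\<^esub>) (\<theta> (\<one>\<^bsub>G\<^esub>, h) x) = \<theta> (\<alpha> h g, h) x"
    and "\<theta> (\<one>\<^bsub>G\<^esub>, h) (\<theta> (g, \<one>\<^bsub>H\<^esub>) x) = \<theta> (\<alpha> h g, h) x"
proof -
  have "x \<in> I (inv\<^bsub>G\<^esub> g, inv\<^bsub>H\<^esub> h)" by (rule I_memI) (use x g h in simp_all)
  then show "\<theta> (\<alpha> h g, \<one>\<^bsub>H\<^esub>) (\<theta> (\<one>\<^bsub>G\<^esub>, h) x) = \<theta> (\<alpha> h g, h) x"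
    and "\<theta> (\<one>\<^bsub>G\<^esub>, h) (\<theta> (g, \<one>\<^bsub>H\<^esub>) x) = \<theta> (\<alpha> h g, h) x"
    using T.theta_comp[of "(\<one>\<^bsub>G\<^esub>, h)" "(\<alpha> h g, \<one>\<^bsub>H\<^esub>)" x] T.theta_comp[of "(g, \<one>\<^bsub>H\<^esub>)" "(\<one>\<^bsub>G\<^esub>, h)" x]
      x g h by simp_all
qed

section \<open>The ideals attached to elements of H and the algebraic action on them\<close>

definition J0 :: "'h \<Rightarrow> ('g \<Rightarrow> 'a) set" where
  "J0 h = {f \<in> carrier PG.X. \<forall>g\<in>carrier G. f g \<in> I (\<one>\<^bsub>G\<^esub>, h)}"

lemma J0_carrier [simp]: "f \<in> J0 h \<Longrightarrow> f \<in> carrier PG.X"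
  by (simp add: J0_def)

text \<open>Here \<open>I_eq\<close> turns elements of \<open>J0 h\<close> into possible slices over
  h of functions on the semi-direct product.\<close>

lemma J0_I: "\<lbrakk>f \<in> J0 h; g \<in> carrier G; h \<in> carrier H\<rbrakk> \<Longrightarrow> f g \<in> I (g, h)"
  by (rule I_memI) (use PG.X_I[of f g] in \<open>simp_all add: J0_def del: J0_carrier\<close>)

lemma J0_K: "\<lbrakk>f \<in> J0 h; g \<in> carrier G\<rbrakk> \<Longrightarrow> f g \<in> I (\<one>\<^bsub>G\<^esub>, h)"
  by (simp add: J0_def del: J0_carrier)

lemma I_A: "\<lbrakk>g \<in> carrier G; h \<in> carrier H; x \<in> I (g, h)\<rbrakk> \<Longrightarrow> x \<in> carrier A"
  using T.I_carrier[of "(g, h)" x] by simp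

lemma I_sub: "\<lbrakk>g \<in> carrier G; h \<in> carrier H; x \<in> I (g, h)\<rbrakk> \<Longrightarrow> x \<in> I (g, \<one>\<^bsub>H\<^esub>)"
  "\<lbrakk>g \<in> carrier G; h \<in> carrier H; x \<in> I (g, h)\<rbrakk> \<Longrightarrow> x \<in> I (\<one>\<^bsub>G\<^esub>, h)"
  using domains by blast+

lemma delta_J0 [simp]: "\<lbrakk>g \<in> carrier G; h \<in> carrier H; a \<in> I (g, h)\<rbrakk> \<Longrightarrow> PG.\<delta> a g \<in> J0 h"
  using PG.delta_closed[of g a] I_sub[of g h a] T.I_closed(1)[of "(\<one>\<^bsub>G\<^esub>, h)"] by (simp add: J0_def del: J0_carrier)

lemma J0_zero [simp]: "h \<in> carrier H \<Longrightarrow> \<zero>\<^bsub>PG.X\<^esub> \<in> J0 h"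
  using PG.X_zero T.I_closed(1)[of "(\<one>\<^bsub>G\<^esub>, h)"] by (simp add: J0_def PG.X_ops(1) del: J0_carrier)

lemma J0_add [simp]: "\<lbrakk>h \<in> carrier H; f \<in> J0 h; f' \<in> J0 h\<rbrakk> \<Longrightarrow> f \<oplus>\<^bsub>PG.X\<^esub> f' \<in> J0 h"
  using PG.X_add[of f f'] T.I_closed(2)[of "(\<one>\<^bsub>G\<^esub>, h)"] by (simp add: J0_def PG.X_ops(2) del: J0_carrier)

lemma J0_smult [simp]: "\<lbrakk>h \<in> carrier H; f \<in> J0 h\<rbrakk> \<Longrightarrow> c \<odot>\<^bsub>PG.X\<^esub> f \<in> J0 h"
  using PG.X_smult[of f c] T.I_closed(3)[of "(\<one>\<^bsub>G\<^esub>, h)"] by (simp add: J0_def PG.X_ops(3) del: J0_carrier)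

lemma J0_star [simp]:
  assumes h: "h \<in> carrier H" and f: "f \<in> J0 h"
  shows "star PG.X f \<in> J0 h"
proof -
  have "star PG.X f g \<in> I (\<one>\<^bsub>G\<^esub>, h)" if g: "g \<in> carrier G" for g
  proof -
    have fi: "star A (f (inv\<^bsub>G\<^esub> g)) \<in> I (inv\<^bsub>G\<^esub> g, h)"
      using T.I_closed(6)[of "(inv\<^bsub>G\<^esub> g, h)"] J0_I[OF f _ h] g h by simp
    then have "star A (f (inv\<^bsub>G\<^esub> g)) \<in> I (inv\<^bsub>G\<^esub> g, \<one>\<^bsub>H\<^esub>)" using I_sub(1) g h by blast
    then show ?thesis
      using T.theta_dom[of "(g, \<one>\<^bsub>H\<^esub>)" "(inv\<^bsub>G\<^esub> g, h)"] fi g h by (simp add: PG.X_ops)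
  qed
  then show ?thesis using f PG.X_star[of f] by (simp add: J0_def del: J0_carrier)
qed

text \<open>Invariance of I(1, h) under G: the map at (s, 1) sends I(s^-1, h) into I(1, h), since
  (s, 1) (s^-1, h) = (1, h). So it suffices that the product to which this map is applied belongs to
  I(1, h).\<close>

lemma J0_mult [simp]:
  assumes h: "h \<in> carrier H" and f: "f \<in> J0 h" and b: "b \<in> carrier PG.X"
  shows "b \<otimes>\<^bsub>PG.X\<^esub> f \<in> J0 h" "f \<otimes>\<^bsub>PG.X\<^esub> b \<in> J0 h"
proof -
  note K = T.I_two_sided[of "(\<one>\<^bsub>G\<^esub>, h)"]
  have "(f1 \<otimes>\<^bsub>PG.X\<^esub> f2) r \<in> I (\<one>\<^bsub>G\<^esub>, h)"
    if f12: "f1 \<in> carrier PG.X" "f2 \<in> carrier PG.X" and r: "r \<in> carrier G"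
      and prod: "\<And>s. s \<in> carrier G \<Longrightarrow>
        \<theta> (inv\<^bsub>G\<^esub> s, \<one>\<^bsub>H\<^esub>) (f1 s) \<otimes>\<^bsub>A\<^esub> f2 (inv\<^bsub>G\<^esub> s \<otimes>\<^bsub>G\<^esub> r) \<in> I (\<one>\<^bsub>G\<^esub>, h)" for f1 f2 r
  proof -
    let ?S = "{s. f1 s \<noteq> \<zero>\<^bsub>A\<^esub>}"
    have S: "finite ?S" "?S \<subseteq> carrier G" using f12 by (simp_all add: PG.X_finite PG.X_support)
    have "PG.summand f1 f2 r s \<in> I (\<one>\<^bsub>G\<^esub>, h)" if s: "s \<in> carrier G" for s
    proof -
      let ?y = "\<theta> (inv\<^bsub>G\<^esub> s, \<one>\<^bsub>H\<^esub>) (f1 s) \<otimes>\<^bsub>A\<^esub> f2 (inv\<^bsub>G\<^esub> s \<otimes>\<^bsub>G\<^esub> r)"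
      have th: "\<theta> (inv\<^bsub>G\<^esub> s, \<one>\<^bsub>H\<^esub>) (f1 s) \<in> I (inv\<^bsub>G\<^esub> s, \<one>\<^bsub>H\<^esub>)"
        using PG.theta_inv_closed[of s "f1 s"] PG.X_I[OF f12(1) s] s by simp
      have y1: "?y \<in> I (inv\<^bsub>G\<^esub> s, \<one>\<^bsub>H\<^esub>)"
        using PG.I_closed(5)[of "inv\<^bsub>G\<^esub> s", OF _ _ th] s f12 by simp
      have "?y \<in> I (inv\<^bsub>G\<^esub> s, h)" by (rule I_memI) (use y1 prod[OF s] s h in simp_all)
      then have "\<theta> (s, \<one>\<^bsub>H\<^esub>) ?y \<in> I (\<one>\<^bsub>G\<^esub>, h)"
        using T.theta_dom[of "(s, \<one>\<^bsub>H\<^esub>)" "(inv\<^bsub>G\<^esub> s, h)" ?y] y1 s h by simp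
      then show ?thesis by simp
    qed
    then show ?thesis
      unfolding PG.mult_X[OF f12 S subset_refl r] using S K h
      by (intro T.finsum_in_ideal) auto
  qed note * = this
  have fA: "f \<in> carrier PG.X" using f by simp
  have "(b \<otimes>\<^bsub>PG.X\<^esub> f) r \<in> I (\<one>\<^bsub>G\<^esub>, h)" if r: "r \<in> carrier G" for r
  proof (rule *[OF b fA r])
    fix s assume s: "s \<in> carrier G"
    have "\<theta> (inv\<^bsub>G\<^esub> s, \<one>\<^bsub>H\<^esub>) (b s) \<in> carrier A"
      using PG.theta_carrier[of "inv\<^bsub>G\<^esub> s" "b s"] PG.X_I[OF b s] s by simp
    then show "\<theta> (inv\<^bsub>G\<^esub> s, \<one>\<^bsub>H\<^esub>) (b s) \<otimes>\<^bsub>A\<^esub> f (inv\<^bsub>G\<^esub> s \<otimes>\<^bsub>G\<^esub> r) \<in> I (\<one>\<^bsub>G\<^esub>, h)"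
      using T.I_closed(4)[of "(\<one>\<^bsub>G\<^esub>, h)"] J0_K[OF f] s r h by simp
  qed
  then show "b \<otimes>\<^bsub>PG.X\<^esub> f \<in> J0 h" using PG.X_mult[OF b fA] by (simp add: J0_def del: J0_carrier)
  have "(f \<otimes>\<^bsub>PG.X\<^esub> b) r \<in> I (\<one>\<^bsub>G\<^esub>, h)" if r: "r \<in> carrier G" for r
  proof (rule *[OF fA b r])
    fix s assume s: "s \<in> carrier G"
    have "\<theta> (inv\<^bsub>G\<^esub> s, \<one>\<^bsub>H\<^esub>) (f s) \<in> I (\<one>\<^bsub>G\<^esub>, h)"
      using T.theta_dom[of "(inv\<^bsub>G\<^esub> s, \<one>\<^bsub>H\<^esub>)" "(s, h)" "f s"] PG.X_I[OF fA s] J0_I[OF f s h] s h by simp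
    then show "\<theta> (inv\<^bsub>G\<^esub> s, \<one>\<^bsub>H\<^esub>) (f s) \<otimes>\<^bsub>A\<^esub> b (inv\<^bsub>G\<^esub> s \<otimes>\<^bsub>G\<^esub> r) \<in> I (\<one>\<^bsub>G\<^esub>, h)"
      using T.I_closed(5)[of "(\<one>\<^bsub>G\<^esub>, h)"] h b by simp
  qed
  then show "f \<otimes>\<^bsub>PG.X\<^esub> b \<in> J0 h" using PG.X_mult[OF fA b] by (simp add: J0_def del: J0_carrier)
qed

lemma J0_ideal: "h \<in> carrier H \<Longrightarrow> two_sided_ideal (J0 h) PG.X"
  by (auto simp: two_sided_ideal_def)

lemma J0_star_closed: "h \<in> carrier H \<Longrightarrow> star_closed_subset (J0 h) PG.X"
  by (auto simp: star_closed_subset_def)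

lemma J0_induct [consumes 2, case_names zero delta add]:
  assumes h: "h \<in> carrier H" and f: "f \<in> J0 h" and zero: "P \<zero>\<^bsub>PG.X\<^esub>"
    and delta: "\<And>a g. \<lbrakk>g \<in> carrier G; a \<in> I (g, h)\<rbrakk> \<Longrightarrow> P (PG.\<delta> a g)"
    and add: "\<And>f f'. \<lbrakk>f \<in> J0 h; f' \<in> J0 h; P f; P f'\<rbrakk> \<Longrightarrow> P (f \<oplus>\<^bsub>PG.X\<^esub> f')"
  shows "P f"
proof -
  have "f \<in> J0 h \<and> P f"
  proof (rule PG.delta_induct_values[of f "\<lambda>g a. a \<in> I (g, h)"])
    show "PG.\<delta> a g \<in> J0 h \<and> P (PG.\<delta> a g)" if "g \<in> carrier G" "a \<in> I (g, h)" for a g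
      using that h delta delta_J0 by blast
  qed (use h f zero add J0_I in \<open>auto simp del: PG.X_ops\<close>)
  then show ?thesis ..
qed

text \<open>The algebraic action of \<open>h\<close>: it sends \<open>a \<delta>\<^sub>g\<close> to \<open>\<theta>\<^bsub>(1,h)\<^esub> a \<delta>\<^bsub>\<alpha> h g\<^esub>\<close>.\<close>

definition E :: "'h \<Rightarrow> ('g \<Rightarrow> 'a) \<Rightarrow> 'g \<Rightarrow> 'a" where
  "E h f = (\<lambda>g. if g \<in> carrier G then \<theta> (\<one>\<^bsub>G\<^esub>, h) (f (\<alpha> (inv\<^bsub>H\<^esub> h) g)) else \<zero>\<^bsub>A\<^esub>)"

lemma theta_H_I:
  assumes "h \<in> carrier H" "g \<in> carrier G" "x \<in> I (g, inv\<^bsub>H\<^esub> h)"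
  shows "\<theta> (\<one>\<^bsub>G\<^esub>, h) x \<in> I (\<alpha> h g, h)"
  using T.theta_dom[of "(\<one>\<^bsub>G\<^esub>, h)" "(g, \<one>\<^bsub>H\<^esub>)" x] I_sub[of g "inv\<^bsub>H\<^esub> h" x] assms by simp

lemma theta_H_zero [simp]: "h \<in> carrier H \<Longrightarrow> \<theta> (\<one>\<^bsub>G\<^esub>, h) \<zero>\<^bsub>A\<^esub> = \<zero>\<^bsub>A\<^esub>"
  using T.theta_zero[of "(\<one>\<^bsub>G\<^esub>, h)"] by simp

lemma E_J0 [simp]:
  assumes h: "h \<in> carrier H" and f: "f \<in> J0 (inv\<^bsub>H\<^esub> h)"
  shows "E h f \<in> J0 h"
proof -
  have "E h f g \<in> I (g, h)" if g: "g \<in> carrier G" for g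
    using theta_H_I[OF h, of "\<alpha> (inv\<^bsub>H\<^esub> h) g"] J0_I[OF f] g h by (simp add: E_def)
  then have I: "E h f g \<in> I (g, \<one>\<^bsub>H\<^esub>)" "E h f g \<in> I (\<one>\<^bsub>G\<^esub>, h)" if "g \<in> carrier G" for g
    using that I_sub h by blast+
  have "{g. E h f g \<noteq> \<zero>\<^bsub>A\<^esub>} \<subseteq> \<alpha> h ` {g. f g \<noteq> \<zero>\<^bsub>A\<^esub>}"
  proof
    fix g assume "g \<in> {g. E h f g \<noteq> \<zero>\<^bsub>A\<^esub>}"
    then have "g \<in> carrier G" "f (\<alpha> (inv\<^bsub>H\<^esub> h) g) \<noteq> \<zero>\<^bsub>A\<^esub>" using h by (auto simp: E_def split: if_splits)
    then show "g \<in> \<alpha> h ` {g. f g \<noteq> \<zero>\<^bsub>A\<^esub>}" using h by (intro image_eqI[of _ _ "\<alpha> (inv\<^bsub>H\<^esub> h) g"]) auto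
  qed
  then have "finite {g. E h f g \<noteq> \<zero>\<^bsub>A\<^esub>}" using PG.X_finite[OF J0_carrier[OF f]] by (rule finite_surj[rotated])
  then show ?thesis using I by (auto simp: J0_def PG.X_carrier E_def simp del: J0_carrier)
qed

lemma E_delta:
  assumes h: "h \<in> carrier H" and g: "g \<in> carrier G"
  shows "E h (PG.\<delta> a g) = PG.\<delta> (\<theta> (\<one>\<^bsub>G\<^esub>, h) a) (\<alpha> h g)"
proof
  fix r
  have "r \<in> carrier G \<Longrightarrow> \<alpha> (inv\<^bsub>H\<^esub> h) r = g \<longleftrightarrow> r = \<alpha> h g" using h g by auto
  then show "E h (PG.\<delta> a g) r = PG.\<delta> (\<theta> (\<one>\<^bsub>G\<^esub>, h) a) (\<alpha> h g) r" using h g by (auto simp: E_def)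
qed

lemma E_add:
  assumes h: "h \<in> carrier H" and f: "f \<in> J0 (inv\<^bsub>H\<^esub> h)" "f' \<in> J0 (inv\<^bsub>H\<^esub> h)"
  shows "E h (f \<oplus>\<^bsub>PG.X\<^esub> f') = E h f \<oplus>\<^bsub>PG.X\<^esub> E h f'"
  using T.theta_add[of "(\<one>\<^bsub>G\<^esub>, h)"] J0_K[OF f(1)] J0_K[OF f(2)] h by (auto simp: E_def PG.X_ops fun_eq_iff)

lemma E_smult:
  assumes h: "h \<in> carrier H" and f: "f \<in> J0 (inv\<^bsub>H\<^esub> h)"
  shows "E h (c \<odot>\<^bsub>PG.X\<^esub> f) = c \<odot>\<^bsub>PG.X\<^esub> E h f"
  using T.theta_smult[of "(\<one>\<^bsub>G\<^esub>, h)"] J0_K[OF f] h by (auto simp: E_def PG.X_ops fun_eq_iff)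

lemma E_star:
  assumes h: "h \<in> carrier H" and f: "f \<in> J0 (inv\<^bsub>H\<^esub> h)"
  shows "E h (star PG.X f) = star PG.X (E h f)"
proof
  fix r
  show "E h (star PG.X f) r = star PG.X (E h f) r"
  proof (cases "r \<in> carrier G")
    case r: True
    define s where "s = \<alpha> (inv\<^bsub>H\<^esub> h) r"
    have s: "s \<in> carrier G" "\<alpha> h s = r" using r h by (simp_all add: s_def)
    define x where "x = f (inv\<^bsub>G\<^esub> s)"
    have x: "x \<in> I (inv\<^bsub>G\<^esub> s, inv\<^bsub>H\<^esub> h)" using J0_I[OF f, of "inv\<^bsub>G\<^esub> s"] s h by (simp add: x_def)
    then have x': "x \<in> I (\<one>\<^bsub>G\<^esub>, inv\<^bsub>H\<^esub> h)" "star A x \<in> I (inv\<^bsub>G\<^esub> s, \<one>\<^bsub>H\<^esub>)" "star A x \<in> I (\<one>\<^bsub>G\<^esub>, inv\<^bsub>H\<^esub> h)"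
      using I_sub[of "inv\<^bsub>G\<^esub> s" "inv\<^bsub>H\<^esub> h"] T.I_closed(6)[of "(inv\<^bsub>G\<^esub> s, inv\<^bsub>H\<^esub> h)" x] s h by simp_all
    have "\<theta> (r, \<one>\<^bsub>H\<^esub>) (\<theta> (\<one>\<^bsub>G\<^esub>, h) (star A x)) = \<theta> (\<one>\<^bsub>G\<^esub>, h) (\<theta> (s, \<one>\<^bsub>H\<^esub>) (star A x))"
      using theta_commute[OF s(1) h x'(3,2)] s by simp
    moreover have "\<theta> (\<one>\<^bsub>G\<^esub>, h) (star A x) = star A (\<theta> (\<one>\<^bsub>G\<^esub>, h) x)"
      using T.theta_star[of "(\<one>\<^bsub>G\<^esub>, h)" x] x' h by simp
    moreover have "E h (star PG.X f) r = \<theta> (\<one>\<^bsub>G\<^esub>, h) (\<theta> (s, \<one>\<^bsub>H\<^esub>) (star A x))"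
      using r s by (simp add: E_def PG.X_ops s_def[symmetric] x_def)
    moreover have "star PG.X (E h f) r = \<theta> (r, \<one>\<^bsub>H\<^esub>) (star A (\<theta> (\<one>\<^bsub>G\<^esub>, h) x))"
      using r h by (simp add: E_def PG.X_ops alpha_inv s_def x_def)
    ultimately show ?thesis by simp
  qed (simp add: E_def PG.X_ops)
qed

lemma E_mult:
  assumes h: "h \<in> carrier H" and f: "f \<in> J0 (inv\<^bsub>H\<^esub> h)" "f' \<in> J0 (inv\<^bsub>H\<^esub> h)"
  shows "E h (f \<otimes>\<^bsub>PG.X\<^esub> f') = E h f \<otimes>\<^bsub>PG.X\<^esub> E h f'"
proof -
  let ?k = "inv\<^bsub>H\<^esub> h"
  have k: "?k \<in> carrier H" using h by simp
  have E0: "E h \<zero>\<^bsub>PG.X\<^esub> = \<zero>\<^bsub>PG.X\<^esub>" using h by (auto simp: E_def PG.X_ops)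
  have base: "E h (PG.\<delta> a s \<otimes>\<^bsub>PG.X\<^esub> PG.\<delta> b t) = E h (PG.\<delta> a s) \<otimes>\<^bsub>PG.X\<^esub> E h (PG.\<delta> b t)"
    if s: "s \<in> carrier G" and t: "t \<in> carrier G" and a: "a \<in> I (s, ?k)" and b: "b \<in> I (t, ?k)" for a b s t
  proof -
    have a1: "a \<in> I (s, \<one>\<^bsub>H\<^esub>)" "a \<in> I (\<one>\<^bsub>G\<^esub>, ?k)" and b1: "b \<in> I (t, \<one>\<^bsub>H\<^esub>)" "b \<in> I (\<one>\<^bsub>G\<^esub>, ?k)"
      using I_sub s t a b k by blast+
    have th: "\<theta> (\<one>\<^bsub>G\<^esub>, h) a \<in> I (\<alpha> h s, \<one>\<^bsub>H\<^esub>)" "\<theta> (\<one>\<^bsub>G\<^esub>, h) b \<in> I (\<alpha> h t, \<one>\<^bsub>H\<^esub>)"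
      using I_sub(1) theta_H_I s t a b h by (metis alpha_closed)+
    define x where "x = \<theta> (inv\<^bsub>G\<^esub> s, \<one>\<^bsub>H\<^esub>) a"
    have x: "x \<in> I (inv\<^bsub>G\<^esub> s, \<one>\<^bsub>H\<^esub>)" using PG.theta_inv_closed[OF s a1(1)] by (simp add: x_def)
    have xK: "x \<in> I (\<one>\<^bsub>G\<^esub>, ?k)"
      using T.theta_dom[of "(inv\<^bsub>G\<^esub> s, \<one>\<^bsub>H\<^esub>)" "(s, ?k)" a] a a1 s k by (simp add: x_def)
    have xA: "x \<in> carrier A" "b \<in> carrier A" using I_A x b1 s t by (metis G.inv_closed H.one_closed)+
    have xb: "x \<otimes>\<^bsub>A\<^esub> b \<in> I (inv\<^bsub>G\<^esub> s, \<one>\<^bsub>H\<^esub>)" "x \<otimes>\<^bsub>A\<^esub> b \<in> I (\<one>\<^bsub>G\<^esub>, ?k)"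
      using PG.I_closed(5)[of "inv\<^bsub>G\<^esub> s" b x] T.I_closed(5)[of "(\<one>\<^bsub>G\<^esub>, ?k)" b x] x xK xA s k by simp_all
    \<comment> \<open>\<open>c1\<close> and \<open>c3\<close> carry the map at (1, h) past the maps
      for s^-1 and s, whose indices are thereby replaced by their images under \<alpha> h;
      \<open>c2\<close> is multiplicativity on the domain of the map at (1, h).\<close>
    have c1: "\<theta> (inv\<^bsub>G\<^esub> \<alpha> h s, \<one>\<^bsub>H\<^esub>) (\<theta> (\<one>\<^bsub>G\<^esub>, h) a) = \<theta> (\<one>\<^bsub>G\<^esub>, h) x"
      using theta_commute[of "inv\<^bsub>G\<^esub> s" h a] s h a1 by (simp add: alpha_inv x_def)
    have c2: "\<theta> (\<one>\<^bsub>G\<^esub>, h) x \<otimes>\<^bsub>A\<^esub> \<theta> (\<one>\<^bsub>G\<^esub>, h) b = \<theta> (\<one>\<^bsub>G\<^esub>, h) (x \<otimes>\<^bsub>A\<^esub> b)"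
      using T.theta_mult[of "(\<one>\<^bsub>G\<^esub>, h)" x b] xK b1 h by simp
    have c3: "\<theta> (\<alpha> h s, \<one>\<^bsub>H\<^esub>) (\<theta> (\<one>\<^bsub>G\<^esub>, h) (x \<otimes>\<^bsub>A\<^esub> b)) = \<theta> (\<one>\<^bsub>G\<^esub>, h) (\<theta> (s, \<one>\<^bsub>H\<^esub>) (x \<otimes>\<^bsub>A\<^esub> b))"
      using theta_commute[of s h "x \<otimes>\<^bsub>A\<^esub> b"] s h xb by simp
    have "E h (PG.\<delta> a s \<otimes>\<^bsub>PG.X\<^esub> PG.\<delta> b t) = E h (PG.\<delta> (\<theta> (s, \<one>\<^bsub>H\<^esub>) (x \<otimes>\<^bsub>A\<^esub> b)) (s \<otimes>\<^bsub>G\<^esub> t))"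
      by (simp only: PG.delta_mult[OF s t a1(1) b1(1)] x_def)
    also have "\<dots> = PG.\<delta> (\<theta> (\<one>\<^bsub>G\<^esub>, h) (\<theta> (s, \<one>\<^bsub>H\<^esub>) (x \<otimes>\<^bsub>A\<^esub> b))) (\<alpha> h (s \<otimes>\<^bsub>G\<^esub> t))"
      by (rule E_delta[OF h]) (use s t in simp)
    also have "\<dots> = PG.\<delta> (\<theta> (\<alpha> h s, \<one>\<^bsub>H\<^esub>) (\<theta> (inv\<^bsub>G\<^esub> \<alpha> h s, \<one>\<^bsub>H\<^esub>) (\<theta> (\<one>\<^bsub>G\<^esub>, h) a) \<otimes>\<^bsub>A\<^esub> \<theta> (\<one>\<^bsub>G\<^esub>, h) b)) (\<alpha> h s \<otimes>\<^bsub>G\<^esub> \<alpha> h t)"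
      unfolding c1 c2 c3 alpha_mult[OF h s t] ..
    also have "\<dots> = PG.\<delta> (\<theta> (\<one>\<^bsub>G\<^esub>, h) a) (\<alpha> h s) \<otimes>\<^bsub>PG.X\<^esub> PG.\<delta> (\<theta> (\<one>\<^bsub>G\<^esub>, h) b) (\<alpha> h t)"
      by (rule PG.delta_mult[symmetric]) (use h s t th in simp_all)
    finally show ?thesis by (simp only: E_delta[OF h s] E_delta[OF h t])
  qed
  have step: "E h (PG.\<delta> a s \<otimes>\<^bsub>PG.X\<^esub> f') = E h (PG.\<delta> a s) \<otimes>\<^bsub>PG.X\<^esub> E h f'"
    if s: "s \<in> carrier G" "a \<in> I (s, ?k)" for a s
    using k f(2)
  proof (induction f' rule: J0_induct)
    case zero
    have "PG.\<delta> a s \<in> J0 ?k" using s k by (intro delta_J0)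
    then have "PG.\<delta> a s \<in> carrier PG.X" "E h (PG.\<delta> a s) \<in> carrier PG.X" using h J0_carrier E_J0 by blast+
    then show ?case by (simp only: E0 PG.X.mult_zero_r)
  next
    case (delta b t) then show ?case using base s by blast
  next
    case (add f1 f2)
    have d: "PG.\<delta> a s \<in> J0 ?k" using s k by (intro delta_J0)
    have mem: "PG.\<delta> a s \<otimes>\<^bsub>PG.X\<^esub> f1 \<in> J0 ?k" "PG.\<delta> a s \<otimes>\<^bsub>PG.X\<^esub> f2 \<in> J0 ?k"
      "PG.\<delta> a s \<in> carrier PG.X" "f1 \<in> carrier PG.X" "f2 \<in> carrier PG.X"
      "E h (PG.\<delta> a s) \<in> carrier PG.X" "E h f1 \<in> carrier PG.X" "E h f2 \<in> carrier PG.X"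
      using d add.hyps h k J0_carrier E_J0 J0_mult by blast+
    show ?case
      using add.IH mem by (simp only: E_add[OF h] PG.X.r_distr add.hyps)
  qed
  show ?thesis
    using k f(1)
  proof (induction f rule: J0_induct)
    case zero
    then show ?case using J0_carrier[OF f(2)] J0_carrier[OF E_J0[OF h f(2)]] by (simp add: E0)
  next
    case (delta a s) then show ?case using step by blast
  next
    case (add f1 f2)
    have mem: "f1 \<otimes>\<^bsub>PG.X\<^esub> f' \<in> J0 ?k" "f2 \<otimes>\<^bsub>PG.X\<^esub> f' \<in> J0 ?k"
      "f' \<in> carrier PG.X" "f1 \<in> carrier PG.X" "f2 \<in> carrier PG.X"
      "E h f' \<in> carrier PG.X" "E h f1 \<in> carrier PG.X" "E h f2 \<in> carrier PG.X"
      using f(2) add.hyps h k J0_carrier E_J0 J0_mult by blast+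
    show ?case
      using add.IH mem by (simp only: E_add[OF h] PG.X.l_distr add.hyps)
  qed
qed

lemma E_hom: "h \<in> carrier H \<Longrightarrow> star_hom (PG.X\<lparr>carrier := J0 (inv\<^bsub>H\<^esub> h)\<rparr>) PG.X (E h)"
  using E_J0[THEN J0_carrier] by (auto simp: star_hom_def E_add E_smult E_mult E_star)

text \<open>Stated from the middle point f rather than from its preimage under \<open>E s\<close>:
  in \<open>eta_mult\<close> the approximants are found after the first map, in the intersection of
  \<open>J0 s\<close> and the domain of \<open>E t\<close>.\<close>

lemma E_comp:
  assumes s: "s \<in> carrier H" and t: "t \<in> carrier H" and f: "f \<in> J0 s" "f \<in> J0 (inv\<^bsub>H\<^esub> t)"
  shows "E (inv\<^bsub>H\<^esub> s) f \<in> J0 (inv\<^bsub>H\<^esub> (t \<otimes>\<^bsub>H\<^esub> s))" "E (t \<otimes>\<^bsub>H\<^esub> s) (E (inv\<^bsub>H\<^esub> s) f) = E t f"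
proof -
  have "E (inv\<^bsub>H\<^esub> s) f \<in> J0 (inv\<^bsub>H\<^esub> s)" using s f by simp
  then have c: "E (inv\<^bsub>H\<^esub> s) f \<in> carrier PG.X" by simp
  have "E (inv\<^bsub>H\<^esub> s) f g \<in> I (\<one>\<^bsub>G\<^esub>, inv\<^bsub>H\<^esub> (t \<otimes>\<^bsub>H\<^esub> s))" if g: "g \<in> carrier G" for g
  proof -
    have "f (\<alpha> s g) \<in> I (\<one>\<^bsub>G\<^esub>, inv\<^bsub>H\<^esub> t)" "f (\<alpha> s g) \<in> I (\<one>\<^bsub>G\<^esub>, s)" using f s g J0_K by simp_all
    then show ?thesis
      using T.theta_dom[of "(\<one>\<^bsub>G\<^esub>, inv\<^bsub>H\<^esub> s)" "(\<one>\<^bsub>G\<^esub>, inv\<^bsub>H\<^esub> t)" "f (\<alpha> s g)"] s t g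
      by (simp add: E_def H.inv_mult_group)
  qed
  then show "E (inv\<^bsub>H\<^esub> s) f \<in> J0 (inv\<^bsub>H\<^esub> (t \<otimes>\<^bsub>H\<^esub> s))" using c by (simp add: J0_def del: J0_carrier)
  show "E (t \<otimes>\<^bsub>H\<^esub> s) (E (inv\<^bsub>H\<^esub> s) f) = E t f"
  proof
    fix g
    show "E (t \<otimes>\<^bsub>H\<^esub> s) (E (inv\<^bsub>H\<^esub> s) f) g = E t f g"
    proof (cases "g \<in> carrier G")
      case g: True
      define x where "x = f (\<alpha> (inv\<^bsub>H\<^esub> t) g)"
      have x: "x \<in> I (\<one>\<^bsub>G\<^esub>, inv\<^bsub>H\<^esub> t)" "x \<in> I (\<one>\<^bsub>G\<^esub>, s)" using f t g J0_K by (simp_all add: x_def)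
      have "\<theta> (\<one>\<^bsub>G\<^esub>, t \<otimes>\<^bsub>H\<^esub> s) (\<theta> (\<one>\<^bsub>G\<^esub>, inv\<^bsub>H\<^esub> s) x) = \<theta> (\<one>\<^bsub>G\<^esub>, t) x"
        using T.theta_comp[of "(\<one>\<^bsub>G\<^esub>, inv\<^bsub>H\<^esub> s)" "(\<one>\<^bsub>G\<^esub>, t \<otimes>\<^bsub>H\<^esub> s)" x] x s t by (simp add: H.m_assoc)
      then show ?thesis using g s t by (simp add: E_def H.inv_mult_group alpha_comp x_def)
    qed (simp add: E_def)
  qed
qed

lemma E_one: "f \<in> carrier PG.X \<Longrightarrow> E \<one>\<^bsub>H\<^esub> f = f"
  using PG.one_action PG.X_A[of f] PG.X_outside[of f] by (auto simp: E_def fun_eq_iff)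

lemma J0_one: "J0 \<one>\<^bsub>H\<^esub> = carrier PG.X"
proof -
  have "f g \<in> I (\<one>\<^bsub>G\<^esub>, \<one>\<^bsub>H\<^esub>)" if "f \<in> carrier PG.X" for f g
    unfolding PG.one_domain using that by (rule PG.X_A)
  then show ?thesis unfolding J0_def by blast
qed

lemma E_inv_cancel: "\<lbrakk>h \<in> carrier H; f \<in> J0 h\<rbrakk> \<Longrightarrow> E h (E (inv\<^bsub>H\<^esub> h) f) = f"
  using E_comp(2)[of h "\<one>\<^bsub>H\<^esub>" f] E_one[of f] J0_one by simp

abbreviation "MG \<equiv> max_seminorm PG.X"

text \<open>Pulled back along \<open>E h\<close>, p becomes a C*-seminorm on the ideal alone; its
  extension P to the whole algebra is one of the seminorms over which \<open>MG\<close> takes the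
  supremum.\<close>

lemma MG_E_le:
  assumes h: "h \<in> carrier H" and f: "f \<in> J0 (inv\<^bsub>H\<^esub> h)"
  shows "MG (E h f) \<le> MG f"
proof (rule PG.max_seminorm_least_X)
  fix p assume p: "cstar_seminorm PG.X p"
  have k: "inv\<^bsub>H\<^esub> h \<in> carrier H" using h by simp
  have "cstar_seminorm (PG.X\<lparr>carrier := J0 (inv\<^bsub>H\<^esub> h)\<rparr>) (\<lambda>f. p (E h f))"
    by (rule cstar_seminorm_pullback[OF PG.X.star_subalgebra[OF J0_star_closed[OF k]] E_hom[OF h] p])
  then obtain P where P: "cstar_seminorm PG.X P" "\<And>f. f \<in> J0 (inv\<^bsub>H\<^esub> h) \<Longrightarrow> P f = p (E h f)"
    using PG.extend_cstar_seminorm_X[OF J0_ideal[OF k] J0_star_closed[OF k]] by blast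
  show "p (E h f) \<le> MG f" using PG.max_seminorm_upper_X[OF P(1), of f] P(2)[OF f] f by simp
qed

lemma MG_E:
  assumes h: "h \<in> carrier H" and f: "f \<in> J0 (inv\<^bsub>H\<^esub> h)"
  shows "MG (E h f) = MG f"
  using MG_E_le[OF h f] MG_E_le[of "inv\<^bsub>H\<^esub> h" "E h f"] E_inv_cancel[of "inv\<^bsub>H\<^esub> h" f] h f by simp

section \<open>The ideals and the action of H on the completion\<close>

sublocale CG: cstar_seminormed PG.X MG
  by (intro cstar_seminormed.intro PG.X.star_algebra_axioms PG.cstar_seminorm_max_X)

sublocale AG: cstar_algebra CG.C
  by (rule CG.cstar_algebra_completion)

definition \<iota> :: "('g \<Rightarrow> 'a) \<Rightarrow> (nat \<Rightarrow> 'g \<Rightarrow> 'a) set" where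
  "\<iota> b = CG.emb b"

lemma star_hom_iota: "star_hom PG.X CG.C \<iota>"
  unfolding \<iota>_def by (rule CG.star_hom_emb)

lemmas iota_hom = star_homD[OF star_hom_iota]

lemma iota_carrier [simp]: "f \<in> carrier PG.X \<Longrightarrow> \<iota> f \<in> carrier CG.C"
  by (rule iota_hom(1))

lemma nrm_iota: "f \<in> carrier PG.X \<Longrightarrow> nrm CG.C (\<iota> f) = MG f"
  unfolding \<iota>_def by (rule CG.nrm_emb)

lemma iota_zero: "\<iota> \<zero>\<^bsub>PG.X\<^esub> = \<zero>\<^bsub>CG.C\<^esub>"
  unfolding \<iota>_def by (simp only: CG.zero_C)

lemma iota_dense:
  assumes "x \<in> carrier CG.C"
  obtains f where "\<And>n. f n \<in> carrier PG.X" "slim CG.C (nrm CG.C) (\<lambda>n. \<iota> (f n)) x"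
  using assms unfolding \<iota>_def by (rule CG.emb_dense) blast

definition R :: "'h \<Rightarrow> ((nat \<Rightarrow> 'g \<Rightarrow> 'a) set \<times> (nat \<Rightarrow> 'g \<Rightarrow> 'a) set) set" where
  "R h = {(\<iota> f, \<iota> (E h f)) |f. f \<in> J0 (inv\<^bsub>H\<^esub> h)}"

definition J :: "'h \<Rightarrow> (nat \<Rightarrow> 'g \<Rightarrow> 'a) set set" where
  "J h = seq_closure CG.C (\<iota> ` J0 h)"

text \<open>Meaningful on the closure of the domain of \<open>R h\<close> only, which is J at the
  inverse of h; elsewhere the definite description has no specified value.\<close>

definition \<eta> :: "'h \<Rightarrow> (nat \<Rightarrow> 'g \<Rightarrow> 'a) set \<Rightarrow> (nat \<Rightarrow> 'g \<Rightarrow> 'a) set" where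
  "\<eta> h = isometric_star_relation.extension CG.C CG.C (R h)"

lemma R_I: "f \<in> J0 (inv\<^bsub>H\<^esub> h) \<Longrightarrow> (\<iota> f, \<iota> (E h f)) \<in> R h"
  by (auto simp: R_def)

text \<open>Equality of norms is \<open>MG_E\<close>; the other axioms restate that
  \<open>E h\<close> respects the operations of the algebraic crossed product.\<close>

lemma isometric_R:
  assumes h: "h \<in> carrier H"
  shows "isometric_star_relation CG.C CG.C (R h)"
proof (intro isometric_star_relation.intro AG.cstar_algebra_axioms isometric_star_relation_axioms.intro)
  let ?k = "inv\<^bsub>H\<^esub> h"
  have k: "?k \<in> carrier H" using h by simp
  have J0E [simp]: "f \<in> carrier PG.X" "E h f \<in> carrier PG.X" "E h f \<in> J0 h" if "f \<in> J0 ?k" for f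
    using that h J0_carrier E_J0 by blast+
  have "E h \<zero>\<^bsub>PG.X\<^esub> = \<zero>\<^bsub>PG.X\<^esub>" using h by (auto simp: E_def PG.X_ops)
  then show "(\<zero>\<^bsub>CG.C\<^esub>, \<zero>\<^bsub>CG.C\<^esub>) \<in> R h"
    using R_I[OF J0_zero[OF k]] by (simp add: iota_zero)
  fix x y assume "(x, y) \<in> R h"
  then obtain f where f: "f \<in> J0 ?k" and xy: "x = \<iota> f" "y = \<iota> (E h f)" by (auto simp: R_def)
  show "x \<in> carrier CG.C \<and> y \<in> carrier CG.C" using f by (simp add: xy)
  show "nrm CG.C x = nrm CG.C y" using f MG_E[OF h f] by (simp add: xy nrm_iota)
  show "(c \<odot>\<^bsub>CG.C\<^esub> x, c \<odot>\<^bsub>CG.C\<^esub> y) \<in> R h" for c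
    using R_I[OF J0_smult[OF k f, of c]] f by (simp add: xy E_smult[OF h f] iota_hom(3))
  show "(star CG.C x, star CG.C y) \<in> R h"
    using R_I[OF J0_star[OF k f]] f by (simp add: xy E_star[OF h f] iota_hom(5))
  fix x' y' assume "(x', y') \<in> R h"
  then obtain f' where f': "f' \<in> J0 ?k" and xy': "x' = \<iota> f'" "y' = \<iota> (E h f')" by (auto simp: R_def)
  show "(x \<oplus>\<^bsub>CG.C\<^esub> x', y \<oplus>\<^bsub>CG.C\<^esub> y') \<in> R h"
    using R_I[OF J0_add[OF k f f']] f f' by (simp add: xy xy' E_add[OF h f f'] iota_hom(2))
  show "(x \<otimes>\<^bsub>CG.C\<^esub> x', y \<otimes>\<^bsub>CG.C\<^esub> y') \<in> R h"
    using R_I[OF J0_mult(1)[OF k f' J0_carrier[OF f]]] f f' by (simp add: xy xy' E_mult[OF h f f'] iota_hom(4))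
qed

lemma domain_R: "Domain (R h) = \<iota> ` J0 (inv\<^bsub>H\<^esub> h)"
  by (auto simp: R_def)

lemma range_R: "h \<in> carrier H \<Longrightarrow> Range (R h) = \<iota> ` J0 h"
proof
  assume h: "h \<in> carrier H"
  show "Range (R h) \<subseteq> \<iota> ` J0 h" using h by (auto simp: R_def)
  show "\<iota> ` J0 h \<subseteq> Range (R h)"
  proof
    fix y assume "y \<in> \<iota> ` J0 h"
    then obtain f where f: "f \<in> J0 h" "y = \<iota> f" by blast
    have "E (inv\<^bsub>H\<^esub> h) f \<in> J0 (inv\<^bsub>H\<^esub> h)" using f h by simp
    from R_I[OF this] show "y \<in> Range (R h)" using f E_inv_cancel[OF h f(1)] by auto
  qed
qed

lemma eta_iota: "\<lbrakk>h \<in> carrier H; f \<in> J0 (inv\<^bsub>H\<^esub> h)\<rbrakk> \<Longrightarrow> \<eta> h (\<iota> f) = \<iota> (E h f)"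
  unfolding \<eta>_def by (rule isometric_star_relation.extension_rel[OF isometric_R R_I])

lemma eta_lim:
  assumes h: "h \<in> carrier H" and f: "\<And>n. f n \<in> J0 (inv\<^bsub>H\<^esub> h)"
    and x: "slim CG.C (nrm CG.C) (\<lambda>n. \<iota> (f n)) x"
  shows "slim CG.C (nrm CG.C) (\<lambda>n. \<iota> (E h (f n))) (\<eta> h x)"
proof -
  interpret R: isometric_star_relation CG.C CG.C "R h" by (rule isometric_R[OF h])
  obtain y where y: "slim CG.C (nrm CG.C) (\<lambda>n. \<iota> (E h (f n))) y"
    using R.limit_transfer[OF R_I[OF f] x] by blast
  have "\<eta> h x = y" unfolding \<eta>_def by (rule R.extension_eq[OF R.graphI[OF R_I[OF f] x y]])
  then show ?thesis using y by simp
qed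

lemma iota_J0_J: "\<lbrakk>h \<in> carrier H; f \<in> J0 h\<rbrakk> \<Longrightarrow> \<iota> f \<in> J h"
  unfolding J_def by (rule AG.seq_closure_incl) (use J0_carrier in auto)

lemma J_E:
  assumes "x \<in> J h"
  obtains f where "\<And>n. f n \<in> J0 h" "slim CG.C (nrm CG.C) (\<lambda>n. \<iota> (f n)) x"
proof -
  obtain X where X: "\<And>n. X n \<in> \<iota> ` J0 h" "slim CG.C (nrm CG.C) X x"
    using assms unfolding J_def by (rule seq_closureE) blast
  then have "\<forall>n. \<exists>f. f \<in> J0 h \<and> X n = \<iota> f" by blast
  then obtain f where f: "\<And>n. f n \<in> J0 h" "\<And>n. X n = \<iota> (f n)" by metis
  have "X = (\<lambda>n. \<iota> (f n))" by (rule ext) (rule f(2))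
  then show thesis using X(2) by (intro that[OF f(1)]) simp
qed

lemma J_lim: "\<lbrakk>\<And>n. f n \<in> J0 h; slim CG.C (nrm CG.C) (\<lambda>n. \<iota> (f n)) x\<rbrakk> \<Longrightarrow> x \<in> J h"
  unfolding J_def by (rule seq_closureI) auto

lemma AG_dense: "x \<in> carrier CG.C \<Longrightarrow> x \<in> seq_closure CG.C (\<iota> ` carrier PG.X)"
proof -
  assume "x \<in> carrier CG.C"
  then obtain f where f: "\<And>n. f n \<in> carrier PG.X" "slim CG.C (nrm CG.C) (\<lambda>n. \<iota> (f n)) x"
    by (rule iota_dense) blast
  show ?thesis by (rule seq_closureI[OF _ f(2)]) (use f in simp)
qed

lemma J_closed_ideal:
  assumes h: "h \<in> carrier H"
  shows "closed_two_sided_ideal (J h) CG.C"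
  unfolding J_def
proof (rule AG.closed_ideal_seq_closure[OF _ AG_dense])
  have C: "f \<in> carrier PG.X" if "f \<in> J0 h" for f using that by simp
  show "star_closed_subset (\<iota> ` J0 h) CG.C"
    unfolding star_closed_subset_def
  proof (intro conjI ballI allI)
    show "\<iota> ` J0 h \<subseteq> carrier CG.C" using C by auto
    show "\<zero>\<^bsub>CG.C\<^esub> \<in> \<iota> ` J0 h" unfolding iota_zero[symmetric] using J0_zero[OF h] by blast
    fix x assume "x \<in> \<iota> ` J0 h"
    then obtain f where f: "f \<in> J0 h" "x = \<iota> f" by blast
    show "c \<odot>\<^bsub>CG.C\<^esub> x \<in> \<iota> ` J0 h" for c
      using iota_hom(3)[OF C[OF f(1)], of c] J0_smult[OF h f(1), of c] f(2) by (metis imageI)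
    show "star CG.C x \<in> \<iota> ` J0 h"
      using iota_hom(5)[OF C[OF f(1)]] J0_star[OF h f(1)] f(2) by (metis imageI)
    fix y assume "y \<in> \<iota> ` J0 h"
    then obtain f' where f': "f' \<in> J0 h" "y = \<iota> f'" by blast
    show "x \<oplus>\<^bsub>CG.C\<^esub> y \<in> \<iota> ` J0 h"
      using iota_hom(2)[OF C[OF f(1)] C[OF f'(1)]] J0_add[OF h f(1) f'(1)] f(2) f'(2) by (metis imageI)
    show "x \<otimes>\<^bsub>CG.C\<^esub> y \<in> \<iota> ` J0 h"
      using iota_hom(4)[OF C[OF f(1)] C[OF f'(1)]] J0_mult(2)[OF h f(1) C[OF f'(1)]] f(2) f'(2) by (metis imageI)
  qed
  fix d s assume "d \<in> \<iota> ` carrier PG.X" "s \<in> \<iota> ` J0 h"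
  then obtain b f where b: "b \<in> carrier PG.X" "d = \<iota> b" and f: "f \<in> J0 h" "s = \<iota> f" by blast
  show "d \<otimes>\<^bsub>CG.C\<^esub> s \<in> \<iota> ` J0 h \<and> s \<otimes>\<^bsub>CG.C\<^esub> d \<in> \<iota> ` J0 h"
    unfolding b(2) f(2) iota_hom(4)[OF b(1) C[OF f(1)], symmetric] iota_hom(4)[OF C[OF f(1)] b(1), symmetric]
    by (intro conjI imageI J0_mult[OF h f(1) b(1)])
qed

text \<open>Every element of \<open>J s \<inter> J t\<close> is a limit of elements \<open>u y\<close> of the product of these ideals, and
  the product of \<open>J0 s\<close> and \<open>J0 t\<close> lies in their intersection.\<close>

lemma J_inter:
  assumes s: "s \<in> carrier H" and t: "t \<in> carrier H" and y: "y \<in> J s" "y \<in> J t"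
  obtains f where "\<And>n. f n \<in> J0 s" "\<And>n. f n \<in> J0 t" "slim CG.C (nrm CG.C) (\<lambda>n. \<iota> (f n)) y"
proof -
  note Js = AG.closed_ideal_two_sided[OF J_closed_ideal[OF s]]
  have yC: "y \<in> carrier CG.C" using two_sided_idealD(1)[OF Js y(1)] .
  obtain u where u: "slim CG.C (nrm CG.C) (\<lambda>n. u n \<otimes>\<^bsub>CG.C\<^esub> y) y" "\<And>n. u n \<in> J s"
    by (rule AG.approximate_left_unit[OF yC]) (use Js y(1) in blast)
  let ?S = "\<iota> ` (J0 s \<inter> J0 t)"
  have sub: "?S \<subseteq> carrier CG.C" using J0_carrier by auto
  have "u n \<otimes>\<^bsub>CG.C\<^esub> y \<in> seq_closure CG.C ?S" for n
  proof -
    obtain f where f: "\<And>n. f n \<in> J0 s" "slim CG.C (nrm CG.C) (\<lambda>n. \<iota> (f n)) (u n)"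
      using u(2)[of n] by (rule J_E) blast
    obtain f' where f': "\<And>n. f' n \<in> J0 t" "slim CG.C (nrm CG.C) (\<lambda>n. \<iota> (f' n)) y"
      using y(2) by (rule J_E) blast
    show ?thesis
    proof (rule seq_closureI[OF _ AG.N.slim_mult[OF f(2) f'(2)]])
      fix m
      have "f m \<otimes>\<^bsub>PG.X\<^esub> f' m \<in> J0 s \<inter> J0 t"
        using J0_mult(2)[OF s f(1) J0_carrier[OF f'(1)]] J0_mult(1)[OF t f'(1) J0_carrier[OF f(1)]] by blast
      then show "\<iota> (f m) \<otimes>\<^bsub>CG.C\<^esub> \<iota> (f' m) \<in> ?S"
        using iota_hom(4)[OF J0_carrier[OF f(1)] J0_carrier[OF f'(1)], of m m] by (metis imageI)
    qed
  qed
  then have "y \<in> seq_closure CG.C ?S" by (rule AG.seq_closure_closed[OF _ u(1) sub])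
  then obtain X where X: "\<And>n. X n \<in> ?S" "slim CG.C (nrm CG.C) X y" by (rule seq_closureE) blast
  then have "\<forall>n. \<exists>f. f \<in> J0 s \<and> f \<in> J0 t \<and> X n = \<iota> f" by blast
  then obtain f where f: "\<And>n. f n \<in> J0 s" "\<And>n. f n \<in> J0 t" "\<And>n. X n = \<iota> (f n)" by metis
  have "X = (\<lambda>n. \<iota> (f n))" by (rule ext) (rule f(3))
  then show thesis using X(2) by (intro that[OF f(1,2)]) simp
qed

lemma J_one: "J \<one>\<^bsub>H\<^esub> = carrier CG.C"
proof
  show "J \<one>\<^bsub>H\<^esub> \<subseteq> carrier CG.C"
    using two_sided_idealD(1)[OF AG.closed_ideal_two_sided[OF J_closed_ideal]] by blast
  show "carrier CG.C \<subseteq> J \<one>\<^bsub>H\<^esub>" unfolding J_def J0_one using AG_dense by blast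
qed

lemma eta_iso:
  assumes h: "h \<in> carrier H"
  shows "star_isomorphism (CG.C\<lparr>carrier := J (inv\<^bsub>H\<^esub> h)\<rparr>) (CG.C\<lparr>carrier := J h\<rparr>) (\<eta> h)"
  using isometric_star_relation.star_isomorphism_extension[OF isometric_R[OF h]]
  unfolding domain_R range_R[OF h] J_def \<eta>_def .

text \<open>The value y = \<eta> s x lies in J s and in the domain of \<eta> t, so it is a limit of
  images of elements f n common to the two algebraic ideals. By isometry their preimages under
  \<open>E s\<close> converge as well, and the limit is x because the closed graph is injective.
  Both sides are then limits of the images of \<open>E t (f n)\<close>.\<close>

lemma eta_mult:
  assumes s: "s \<in> carrier H" and t: "t \<in> carrier H" and x: "x \<in> J (inv\<^bsub>H\<^esub> s)" "\<eta> s x \<in> J (inv\<^bsub>H\<^esub> t)"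
  shows "x \<in> J (inv\<^bsub>H\<^esub> (t \<otimes>\<^bsub>H\<^esub> s))" "\<eta> (t \<otimes>\<^bsub>H\<^esub> s) x = \<eta> t (\<eta> s x)"
proof -
  interpret R: isometric_star_relation CG.C CG.C "R s" by (rule isometric_R[OF s])
  define y where "y = \<eta> s x"
  have xy: "(x, y) \<in> R.closure_graph"
    using R.extension_graph[of x] x(1) unfolding domain_R J_def y_def \<eta>_def by simp
  have ys: "y \<in> J s" using R.range_graph[of y] xy unfolding range_R[OF s] J_def by blast
  have t': "inv\<^bsub>H\<^esub> t \<in> carrier H" using t by simp
  obtain f where f: "\<And>n. f n \<in> J0 s" "\<And>n. f n \<in> J0 (inv\<^bsub>H\<^esub> t)"
    and fy: "slim CG.C (nrm CG.C) (\<lambda>n. \<iota> (f n)) y"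
    using J_inter[OF s t' ys] x(2) unfolding y_def by blast
  let ?e = "\<lambda>n. E (inv\<^bsub>H\<^esub> s) (f n)"
  have e: "?e n \<in> J0 (inv\<^bsub>H\<^esub> s)" for n using f(1) s by simp
  have Ee: "E s (?e n) = f n" for n using E_inv_cancel[OF s f(1)] .
  have rel: "(\<iota> (?e n), \<iota> (f n)) \<in> R s" for n using R_I[OF e] Ee by simp
  interpret R': isometric_star_relation CG.C CG.C "(R s)\<inverse>" by (rule R.converse_relation)
  obtain x' where x': "slim CG.C (nrm CG.C) (\<lambda>n. \<iota> (?e n)) x'"
    using R'.limit_transfer[of "\<lambda>n. \<iota> (f n)" "\<lambda>n. \<iota> (?e n)" y] rel fy by blast
  have "(x', y) \<in> R.closure_graph" by (rule R.graphI[OF rel x' fy])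
  then have "x' = x" using xy by (rule R.graph_inj)
  then have ex: "slim CG.C (nrm CG.C) (\<lambda>n. \<iota> (?e n)) x" using x' by simp
  have e2: "?e n \<in> J0 (inv\<^bsub>H\<^esub> (t \<otimes>\<^bsub>H\<^esub> s))" for n by (rule E_comp(1)[OF s t f])
  show "x \<in> J (inv\<^bsub>H\<^esub> (t \<otimes>\<^bsub>H\<^esub> s))" by (rule J_lim[OF e2 ex])
  have ts: "t \<otimes>\<^bsub>H\<^esub> s \<in> carrier H" using s t by simp
  have "slim CG.C (nrm CG.C) (\<lambda>n. \<iota> (E t (f n))) (\<eta> (t \<otimes>\<^bsub>H\<^esub> s) x)"
    using eta_lim[OF ts e2 ex] by (simp add: E_comp(2)[OF s t f])
  moreover have "slim CG.C (nrm CG.C) (\<lambda>n. \<iota> (E t (f n))) (\<eta> t y)"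
    by (rule eta_lim[OF t f(2) fy])
  ultimately show "\<eta> (t \<otimes>\<^bsub>H\<^esub> s) x = \<eta> t (\<eta> s x)" unfolding y_def by (rule AG.slim_unique)
qed

lemma eta_one:
  assumes x: "x \<in> carrier CG.C"
  shows "\<eta> \<one>\<^bsub>H\<^esub> x = x"
proof -
  obtain f where f: "\<And>n. f n \<in> carrier PG.X" "slim CG.C (nrm CG.C) (\<lambda>n. \<iota> (f n)) x"
    using x by (rule iota_dense) blast
  have "slim CG.C (nrm CG.C) (\<lambda>n. \<iota> (E \<one>\<^bsub>H\<^esub> (f n))) (\<eta> \<one>\<^bsub>H\<^esub> x)"
    by (rule eta_lim[OF _ _ f(2)]) (simp_all add: J0_one f(1))
  then have "slim CG.C (nrm CG.C) (\<lambda>n. \<iota> (f n)) (\<eta> \<one>\<^bsub>H\<^esub> x)" by (simp add: E_one f(1))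
  then show ?thesis using f(2) by (rule AG.slim_unique)
qed

text \<open>H acting on A \<rtimes> G becomes another model of the abstract theory, so its l1-norm,
  its maximal seminorm and the calculus of \<delta> are available there too.\<close>

sublocale PH: partial_action CG.C H J \<eta>
proof (intro partial_action.intro AG.cstar_algebra_axioms H.is_group partial_action_axioms.intro)
qed (fact J_closed_ideal eta_iso J_one eta_one eta_mult)+

section \<open>The isomorphism\<close>

definition slice :: "('g \<times> 'h \<Rightarrow> 'a) \<Rightarrow> 'h \<Rightarrow> 'g \<Rightarrow> 'a" where
  "slice F h = (\<lambda>g. F (g, h))"

definition \<Phi> :: "('g \<times> 'h \<Rightarrow> 'a) \<Rightarrow> 'h \<Rightarrow> (nat \<Rightarrow> 'g \<Rightarrow> 'a) set" where
  "\<Phi> F = (\<lambda>h. \<iota> (slice F h))"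

definition lift :: "('g \<Rightarrow> 'a) \<Rightarrow> 'h \<Rightarrow> 'g \<times> 'h \<Rightarrow> 'a" where
  "lift f h = (\<lambda>(g, k). if k = h then f g else \<zero>\<^bsub>A\<^esub>)"

lemma slice_outside: "\<lbrakk>F \<in> carrier T.X; h \<notin> carrier H\<rbrakk> \<Longrightarrow> slice F h = \<zero>\<^bsub>PG.X\<^esub>"
  using T.X_outside[of F] by (auto simp: slice_def PG.X_ops)

lemma slice_J0:
  assumes F: "F \<in> carrier T.X" and h: "h \<in> carrier H"
  shows "slice F h \<in> J0 h"
proof -
  have "{g. F (g, h) \<noteq> \<zero>\<^bsub>A\<^esub>} \<subseteq> fst ` {r. F r \<noteq> \<zero>\<^bsub>A\<^esub>}" by force
  then have "finite {g. F (g, h) \<noteq> \<zero>\<^bsub>A\<^esub>}" by (rule finite_surj[OF T.X_finite[OF F]])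
  moreover have "F (g, h) \<in> I (g, \<one>\<^bsub>H\<^esub>)" "F (g, h) \<in> I (\<one>\<^bsub>G\<^esub>, h)" if "g \<in> carrier G" for g
    using T.X_I[OF F, of "(g, h)"] I_sub that h by auto
  moreover have "F (g, h) = \<zero>\<^bsub>A\<^esub>" if "g \<notin> carrier G" for g
    using T.X_outside[OF F, of "(g, h)"] that by simp
  ultimately show ?thesis unfolding J0_def PG.X_carrier slice_def by blast
qed

lemma slice_X [simp]: "F \<in> carrier T.X \<Longrightarrow> slice F h \<in> carrier PG.X"
  using slice_J0[of F h] slice_outside[of F h] PG.X_zero by (metis J0_carrier)

lemma lift_X [simp]:
  assumes h: "h \<in> carrier H" and f: "f \<in> J0 h"
  shows "lift f h \<in> carrier T.X"
proof -
  have "{r. lift f h r \<noteq> \<zero>\<^bsub>A\<^esub>} \<subseteq> (\<lambda>g. (g, h)) ` {g. f g \<noteq> \<zero>\<^bsub>A\<^esub>}"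
    by (auto simp: lift_def split: if_splits)
  then have "finite {r. lift f h r \<noteq> \<zero>\<^bsub>A\<^esub>}" by (rule finite_surj[OF PG.X_finite[OF J0_carrier[OF f]]])
  moreover have "lift f h r \<in> I r" if "r \<in> carrier \<Gamma>" for r
    using that J0_I[OF f _ h] T.I_closed(1)[OF that] by (auto simp: lift_def)
  moreover have "lift f h r = \<zero>\<^bsub>A\<^esub>" if "r \<notin> carrier \<Gamma>" for r
    using that h PG.X_outside[OF J0_carrier[OF f]] by (auto simp: lift_def split: prod.splits)
  ultimately show ?thesis unfolding T.X_carrier by blast
qed

lemma slice_lift: "slice (lift f h) k = (if k = h then f else \<zero>\<^bsub>PG.X\<^esub>)"
  by (auto simp: slice_def lift_def PG.X_ops)

lemma Phi_lift: "\<Phi> (lift f h) = PH.\<delta> (\<iota> f) h"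
  by (rule ext) (simp add: \<Phi>_def slice_lift iota_zero)

lemma delta_lift: "T.\<delta> a (g, h) = lift (PG.\<delta> a g) h"
  by (auto simp: lift_def)

lemma Phi_delta: "\<Phi> (T.\<delta> a (g, h)) = PH.\<delta> (\<iota> (PG.\<delta> a g)) h"
  unfolding delta_lift Phi_lift ..

lemma Phi_support: "{h. \<Phi> F h \<noteq> \<zero>\<^bsub>CG.C\<^esub>} \<subseteq> snd ` {r. F r \<noteq> \<zero>\<^bsub>A\<^esub>}"
proof
  fix h assume h: "h \<in> {h. \<Phi> F h \<noteq> \<zero>\<^bsub>CG.C\<^esub>}"
  have "slice F h \<noteq> \<zero>\<^bsub>PG.X\<^esub>"
  proof
    assume "slice F h = \<zero>\<^bsub>PG.X\<^esub>"
    then show False using h by (simp add: \<Phi>_def iota_zero)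
  qed
  then obtain g where "F (g, h) \<noteq> \<zero>\<^bsub>A\<^esub>" by (auto simp: slice_def PG.X_ops)
  then show "h \<in> snd ` {r. F r \<noteq> \<zero>\<^bsub>A\<^esub>}" by force
qed

lemma Phi_X [simp]:
  assumes F: "F \<in> carrier T.X"
  shows "\<Phi> F \<in> carrier PH.X"
proof -
  have "finite {h. \<Phi> F h \<noteq> \<zero>\<^bsub>CG.C\<^esub>}" by (rule finite_surj[OF T.X_finite[OF F] Phi_support])
  moreover have "\<Phi> F h \<in> J h" if "h \<in> carrier H" for h
    unfolding \<Phi>_def by (rule iota_J0_J[OF that slice_J0[OF F that]])
  moreover have "\<Phi> F h = \<zero>\<^bsub>CG.C\<^esub>" if "h \<notin> carrier H" for h
    unfolding \<Phi>_def slice_outside[OF F that] by (rule iota_zero)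
  ultimately show ?thesis unfolding PH.X_carrier by blast
qed

lemma Phi_add: "\<lbrakk>F \<in> carrier T.X; F' \<in> carrier T.X\<rbrakk> \<Longrightarrow> \<Phi> (F \<oplus>\<^bsub>T.X\<^esub> F') = \<Phi> F \<oplus>\<^bsub>PH.X\<^esub> \<Phi> F'"
proof -
  assume F: "F \<in> carrier T.X" "F' \<in> carrier T.X"
  have "slice (F \<oplus>\<^bsub>T.X\<^esub> F') h = slice F h \<oplus>\<^bsub>PG.X\<^esub> slice F' h" for h
    by (simp add: slice_def T.X_ops(2) PG.X_ops(2))
  then show ?thesis using iota_hom(2)[OF slice_X[OF F(1)] slice_X[OF F(2)]] by (simp add: \<Phi>_def PH.X_ops(2))
qed

lemma Phi_smult: "F \<in> carrier T.X \<Longrightarrow> \<Phi> (c \<odot>\<^bsub>T.X\<^esub> F) = c \<odot>\<^bsub>PH.X\<^esub> \<Phi> F"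
proof -
  assume F: "F \<in> carrier T.X"
  have "slice (c \<odot>\<^bsub>T.X\<^esub> F) h = c \<odot>\<^bsub>PG.X\<^esub> slice F h" for h
    by (simp add: slice_def T.X_ops(3) PG.X_ops(3))
  then show ?thesis using iota_hom(3)[OF slice_X[OF F]] by (simp add: \<Phi>_def PH.X_ops(3))
qed

section \<open>Compatibility of the comparison map with products and involutions\<close>

lemma eta_product:
  assumes h: "h \<in> carrier H" and f: "f \<in> J0 h" and b: "b \<in> carrier PG.X"
  shows "\<eta> h (\<eta> (inv\<^bsub>H\<^esub> h) (\<iota> f) \<otimes>\<^bsub>CG.C\<^esub> \<iota> b) = \<iota> (E h (E (inv\<^bsub>H\<^esub> h) f \<otimes>\<^bsub>PG.X\<^esub> b))"
proof -
  have k: "inv\<^bsub>H\<^esub> h \<in> carrier H" using h by simp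
  have f': "f \<in> J0 (inv\<^bsub>H\<^esub> (inv\<^bsub>H\<^esub> h))" using f h by simp
  have Ef: "E (inv\<^bsub>H\<^esub> h) f \<in> J0 (inv\<^bsub>H\<^esub> h)" by (rule E_J0[OF k f'])
  have "\<eta> h (\<eta> (inv\<^bsub>H\<^esub> h) (\<iota> f) \<otimes>\<^bsub>CG.C\<^esub> \<iota> b) = \<eta> h (\<iota> (E (inv\<^bsub>H\<^esub> h) f \<otimes>\<^bsub>PG.X\<^esub> b))"
    unfolding eta_iota[OF k f'] iota_hom(4)[OF J0_carrier[OF Ef] b] ..
  also have "\<dots> = \<iota> (E h (E (inv\<^bsub>H\<^esub> h) f \<otimes>\<^bsub>PG.X\<^esub> b))"
    by (rule eta_iota[OF h J0_mult(2)[OF k Ef b]])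
  finally show ?thesis .
qed

lemma Phi_delta_mult:
  assumes s: "s \<in> carrier G" and h: "h \<in> carrier H" and t: "t \<in> carrier G" and k: "k \<in> carrier H"
    and a: "a \<in> I (s, h)" and b: "b \<in> I (t, k)"
  shows "\<Phi> (T.\<delta> a (s, h) \<otimes>\<^bsub>T.X\<^esub> T.\<delta> b (t, k)) = \<Phi> (T.\<delta> a (s, h)) \<otimes>\<^bsub>PH.X\<^esub> \<Phi> (T.\<delta> b (t, k))"
proof -
  let ?h = "inv\<^bsub>H\<^esub> h"
  \<comment> \<open>Chosen so that (s, h) = (1, h) (s', 1); the inverse is then (s'^-1, 1) (1,
    h^-1).\<close>
  define s' where "s' = \<alpha> ?h s"
  have h': "?h \<in> carrier H" and s': "s' \<in> carrier G" "\<alpha> h s' = s" using s h by (simp_all add: s'_def)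
  have sh: "(s, h) \<in> carrier \<Gamma>" "(t, k) \<in> carrier \<Gamma>" and inv_sh: "inv\<^bsub>\<Gamma>\<^esub> (s, h) = (inv\<^bsub>G\<^esub> s', ?h)"
    using s h t k by (simp_all add: s'_def)
  have a1: "a \<in> I (s, \<one>\<^bsub>H\<^esub>)" "a \<in> I (\<one>\<^bsub>G\<^esub>, h)" and b1: "b \<in> I (t, \<one>\<^bsub>H\<^esub>)" "b \<in> carrier A"
    by (rule I_sub(1)[OF s h a], rule I_sub(2)[OF s h a], rule I_sub(1)[OF t k b], rule I_A[OF t k b])
  define c where "c = \<theta> (\<one>\<^bsub>G\<^esub>, ?h) a"
  have c: "c \<in> I (s', ?h)" using theta_H_I[OF h' s, of a] a h by (simp add: c_def s'_def)
  have c1: "c \<in> I (s', \<one>\<^bsub>H\<^esub>)" using I_sub(1)[OF s'(1) h' c] .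
  define d where "d = \<theta> (inv\<^bsub>G\<^esub> s', \<one>\<^bsub>H\<^esub>) c"
  \<comment> \<open>The map for (s, h)^-1 is computed in two stages: h^-1 gives c, and s'^-1 then
    gives d.\<close>
  have d_eq: "\<theta> (inv\<^bsub>\<Gamma>\<^esub> (s, h)) a = d"
    using theta_commute(1)[of "inv\<^bsub>G\<^esub> s" ?h a] s h a1 by (simp add: inv_sh d_def c_def s'_def alpha_inv)
  have "\<theta> (inv\<^bsub>\<Gamma>\<^esub> (s, h)) a \<in> I (inv\<^bsub>\<Gamma>\<^esub> (s, h))" by (rule T.theta_inv_closed[OF sh(1) a])
  then have d: "d \<in> I (inv\<^bsub>G\<^esub> s', ?h)" unfolding d_eq unfolding inv_sh .
  have db: "d \<otimes>\<^bsub>A\<^esub> b \<in> I (inv\<^bsub>G\<^esub> s', ?h)" using T.I_closed(5)[of "(inv\<^bsub>G\<^esub> s', ?h)", OF _ b1(2) d] s' h' by simp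
  have db1: "d \<otimes>\<^bsub>A\<^esub> b \<in> I (inv\<^bsub>G\<^esub> s', \<one>\<^bsub>H\<^esub>)" "d \<otimes>\<^bsub>A\<^esub> b \<in> I (\<one>\<^bsub>G\<^esub>, ?h)"
    using I_sub[OF G.inv_closed[OF s'(1)] h' db] .
  have th: "\<theta> (\<one>\<^bsub>G\<^esub>, h) (\<theta> (s', \<one>\<^bsub>H\<^esub>) (d \<otimes>\<^bsub>A\<^esub> b)) = \<theta> (s, h) (d \<otimes>\<^bsub>A\<^esub> b)"
    using theta_commute(2)[OF s'(1) h db1(2,1)] s' by simp
  have fa: "PG.\<delta> a s \<in> J0 h" by (rule delta_J0[OF s h a])
  have fb: "PG.\<delta> b t \<in> carrier PG.X" by (rule PG.delta_closed[OF t b1(1)])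
  have e1: "E ?h (PG.\<delta> a s) = PG.\<delta> c s'" unfolding E_delta[OF h' s] c_def s'_def ..
  have e2: "PG.\<delta> c s' \<otimes>\<^bsub>PG.X\<^esub> PG.\<delta> b t = PG.\<delta> (\<theta> (s', \<one>\<^bsub>H\<^esub>) (d \<otimes>\<^bsub>A\<^esub> b)) (s' \<otimes>\<^bsub>G\<^esub> t)"
    unfolding PG.delta_mult[OF s'(1) t c1 b1(1)] d_def ..
  have e3: "E h (PG.\<delta> (\<theta> (s', \<one>\<^bsub>H\<^esub>) (d \<otimes>\<^bsub>A\<^esub> b)) (s' \<otimes>\<^bsub>G\<^esub> t)) = PG.\<delta> (\<theta> (s, h) (d \<otimes>\<^bsub>A\<^esub> b)) (s \<otimes>\<^bsub>G\<^esub> \<alpha> h t)"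
    unfolding E_delta[OF h G.m_closed[OF s'(1) t]] th alpha_mult[OF h s'(1) t] s'(2) ..
  have "\<Phi> (T.\<delta> a (s, h) \<otimes>\<^bsub>T.X\<^esub> T.\<delta> b (t, k)) = \<Phi> (T.\<delta> (\<theta> (s, h) (d \<otimes>\<^bsub>A\<^esub> b)) (s \<otimes>\<^bsub>G\<^esub> \<alpha> h t, h \<otimes>\<^bsub>H\<^esub> k))"
    unfolding T.delta_mult[OF sh a b] d_eq \<Gamma>_simps ..
  also have "\<dots> = PH.\<delta> (\<iota> (PG.\<delta> (\<theta> (s, h) (d \<otimes>\<^bsub>A\<^esub> b)) (s \<otimes>\<^bsub>G\<^esub> \<alpha> h t))) (h \<otimes>\<^bsub>H\<^esub> k)"
    by (rule Phi_delta)
  also have "\<dots> = PH.\<delta> (\<eta> h (\<eta> ?h (\<iota> (PG.\<delta> a s)) \<otimes>\<^bsub>CG.C\<^esub> \<iota> (PG.\<delta> b t))) (h \<otimes>\<^bsub>H\<^esub> k)"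
    unfolding eta_product[OF h fa fb] e1 e2 e3 ..
  also have "\<dots> = PH.\<delta> (\<iota> (PG.\<delta> a s)) h \<otimes>\<^bsub>PH.X\<^esub> PH.\<delta> (\<iota> (PG.\<delta> b t)) k"
    by (rule PH.delta_mult[OF h k iota_J0_J[OF h fa] iota_J0_J[OF k delta_J0[OF t k b]], symmetric])
  finally show ?thesis unfolding Phi_delta .
qed

lemma Phi_delta_star:
  assumes s: "s \<in> carrier G" and h: "h \<in> carrier H" and a: "a \<in> I (s, h)"
  shows "\<Phi> (star T.X (T.\<delta> a (s, h))) = star PH.X (\<Phi> (T.\<delta> a (s, h)))"
proof -
  let ?h = "inv\<^bsub>H\<^esub> h" and ?s = "inv\<^bsub>G\<^esub> s"
  have h': "?h \<in> carrier H" using h by simp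
  have sh: "(s, h) \<in> carrier \<Gamma>" and inv_sh: "inv\<^bsub>\<Gamma>\<^esub> (s, h) = (\<alpha> ?h ?s, ?h)"
    using s h by (simp_all add: alpha_inv)
  have sa: "star A a \<in> I (s, h)" using T.I_closed(6)[OF sh a] .
  have a1: "a \<in> I (s, \<one>\<^bsub>H\<^esub>)" "star A a \<in> I (s, \<one>\<^bsub>H\<^esub>)" "star A a \<in> I (\<one>\<^bsub>G\<^esub>, h)" using I_sub s h a sa by blast+
  have fa: "PG.\<delta> a s \<in> J0 h" by (rule delta_J0[OF s h a])
  have sfa: "star PG.X (PG.\<delta> a s) \<in> J0 (inv\<^bsub>H\<^esub> ?h)" using J0_star[OF h fa] h by simp
  \<comment> \<open>Here (s, h)^-1 = (1, h^-1) (s^-1, 1): the involution of the crossed product by G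
    supplies s^-1, and \<open>E\<close> supplies h^-1.\<close>
  have th: "\<theta> (\<one>\<^bsub>G\<^esub>, ?h) (\<theta> (?s, \<one>\<^bsub>H\<^esub>) (star A a)) = \<theta> (inv\<^bsub>\<Gamma>\<^esub> (s, h)) (star A a)"
    using theta_commute(2)[of ?s ?h "star A a"] s h a1 unfolding inv_sh by simp
  have "star PH.X (\<Phi> (T.\<delta> a (s, h))) = PH.\<delta> (\<eta> ?h (star CG.C (\<iota> (PG.\<delta> a s)))) ?h"
    unfolding Phi_delta by (rule PH.delta_star[OF h iota_J0_J[OF h fa]])
  also have "\<dots> = PH.\<delta> (\<iota> (E ?h (star PG.X (PG.\<delta> a s)))) ?h"
    unfolding iota_hom(5)[OF J0_carrier[OF fa], symmetric] eta_iota[OF h' sfa] ..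
  also have "\<dots> = PH.\<delta> (\<iota> (PG.\<delta> (\<theta> (inv\<^bsub>\<Gamma>\<^esub> (s, h)) (star A a)) (\<alpha> ?h ?s))) ?h"
    unfolding PG.delta_star[OF s a1(1)] E_delta[OF h' G.inv_closed[OF s]] th ..
  also have "\<dots> = \<Phi> (star T.X (T.\<delta> a (s, h)))"
    unfolding T.delta_star[OF sh a] unfolding inv_sh Phi_delta ..
  finally show ?thesis by simp
qed

lemma Phi_hom: "star_hom T.X PH.X \<Phi>"
proof (rule T.star_hom_from_deltas[OF PH.star_algebra_X Phi_X Phi_add Phi_smult])
  show "\<Phi> (T.\<delta> a r \<otimes>\<^bsub>T.X\<^esub> T.\<delta> b t) = \<Phi> (T.\<delta> a r) \<otimes>\<^bsub>PH.X\<^esub> \<Phi> (T.\<delta> b t)"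
    if "r \<in> carrier \<Gamma>" "t \<in> carrier \<Gamma>" "a \<in> I r" "b \<in> I t" for a r b t
  proof -
    obtain g h g' h' where eq: "r = (g, h)" "t = (g', h')" by (cases r, cases t)
    show ?thesis unfolding eq by (rule Phi_delta_mult) (use that eq in auto)
  qed
  show "\<Phi> (star T.X (T.\<delta> a r)) = star PH.X (\<Phi> (T.\<delta> a r))" if "r \<in> carrier \<Gamma>" "a \<in> I r" for a r
  proof -
    obtain g h where eq: "r = (g, h)" by (cases r)
    show ?thesis unfolding eq by (rule Phi_delta_star) (use that eq in auto)
  qed
qed

text \<open>Through this embedding a C*-seminorm on the large crossed product restricts to one on
  the crossed product by G, where it is dominated by \<open>MG\<close>.\<close>

lemma lift_one_hom: "star_hom PG.X T.X (\<lambda>f. lift f \<one>\<^bsub>H\<^esub>)"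
proof (rule PG.star_hom_from_deltas[OF T.star_algebra_X])
  show "lift f \<one>\<^bsub>H\<^esub> \<in> carrier T.X" if "f \<in> carrier PG.X" for f
    using that by (intro lift_X) (simp_all add: J0_one)
  show "lift (f \<oplus>\<^bsub>PG.X\<^esub> g) \<one>\<^bsub>H\<^esub> = lift f \<one>\<^bsub>H\<^esub> \<oplus>\<^bsub>T.X\<^esub> lift g \<one>\<^bsub>H\<^esub>" for f g
    by (auto simp: lift_def PG.X_ops(2) T.X_ops(2) fun_eq_iff)
  show "lift (c \<odot>\<^bsub>PG.X\<^esub> f) \<one>\<^bsub>H\<^esub> = c \<odot>\<^bsub>T.X\<^esub> lift f \<one>\<^bsub>H\<^esub>" for c f
    by (auto simp: lift_def PG.X_ops(3) T.X_ops(3) fun_eq_iff)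
  fix a s assume s: "s \<in> carrier G" and a: "a \<in> I (s, \<one>\<^bsub>H\<^esub>)"
  have s': "(s, \<one>\<^bsub>H\<^esub>) \<in> carrier \<Gamma>" and inv_s: "inv\<^bsub>\<Gamma>\<^esub> (s, \<one>\<^bsub>H\<^esub>) = (inv\<^bsub>G\<^esub> s, \<one>\<^bsub>H\<^esub>)" using s by simp_all
  show "lift (star PG.X (PG.\<delta> a s)) \<one>\<^bsub>H\<^esub> = star T.X (lift (PG.\<delta> a s) \<one>\<^bsub>H\<^esub>)"
    unfolding PG.delta_star[OF s a] delta_lift[symmetric] T.delta_star[OF s' a] inv_s ..
  fix b t assume t: "t \<in> carrier G" and b: "b \<in> I (t, \<one>\<^bsub>H\<^esub>)"
  have t': "(t, \<one>\<^bsub>H\<^esub>) \<in> carrier \<Gamma>" and st: "(s, \<one>\<^bsub>H\<^esub>) \<otimes>\<^bsub>\<Gamma>\<^esub> (t, \<one>\<^bsub>H\<^esub>) = (s \<otimes>\<^bsub>G\<^esub> t, \<one>\<^bsub>H\<^esub>)"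
    using t by simp_all
  show "lift (PG.\<delta> a s \<otimes>\<^bsub>PG.X\<^esub> PG.\<delta> b t) \<one>\<^bsub>H\<^esub> = lift (PG.\<delta> a s) \<one>\<^bsub>H\<^esub> \<otimes>\<^bsub>T.X\<^esub> lift (PG.\<delta> b t) \<one>\<^bsub>H\<^esub>"
    unfolding PG.delta_mult[OF s t a b] delta_lift[symmetric] T.delta_mult[OF s' t' a b] inv_s st ..
qed

text \<open>For \<open>F\<close> supported on \<open>G \<times> {h}\<close> the element \<open>F\<^sup>* F\<close> is supported on \<open>G \<times> {1}\<close>, where the
  seminorm is dominated by the norm of \<open>A \<rtimes> G\<close>.\<close>

lemma cstar_seminorm_lift_le:
  assumes p: "cstar_seminorm T.X p" and h: "h \<in> carrier H" and f: "f \<in> J0 h"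
  shows "p (lift f h) \<le> MG f"
proof (rule power2_le_imp_le)
  define F where "F = lift f h"
  have F: "F \<in> carrier T.X" using lift_X[OF h f] by (simp add: F_def)
  define u where "u = star T.X F \<otimes>\<^bsub>T.X\<^esub> F"
  have u: "u \<in> carrier T.X" using F by (simp add: u_def)
  have supp_F: "snd r = h" if "F r \<noteq> \<zero>\<^bsub>A\<^esub>" for r
    using that by (auto simp: F_def lift_def split: prod.splits if_splits)
  \<comment> \<open>F lives over h, so every product contributing to u has second coordinate h^-1 h
    = 1.\<close>
  have supp: "u (g, k) = \<zero>\<^bsub>A\<^esub>" if k: "k \<noteq> \<one>\<^bsub>H\<^esub>" for g k
  proof (rule ccontr)
    assume "u (g, k) \<noteq> \<zero>\<^bsub>A\<^esub>"
    then obtain s t where s: "star T.X F s \<noteq> \<zero>\<^bsub>A\<^esub>" and t: "F t \<noteq> \<zero>\<^bsub>A\<^esub>" and gk: "(g, k) = s \<otimes>\<^bsub>\<Gamma>\<^esub> t"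
      using T.mult_support[OF T.X_star[OF F] F] unfolding u_def by auto
    obtain s0 where s0: "F s0 \<noteq> \<zero>\<^bsub>A\<^esub>" "s = inv\<^bsub>\<Gamma>\<^esub> s0" using T.star_support[of F] s by blast
    obtain g0 g1 where g0: "s0 = (g0, h)" "t = (g1, h)"
      using supp_F[OF s0(1)] supp_F[OF t] by (metis prod.collapse)
    have "s0 \<in> carrier \<Gamma>" using T.X_support[OF F] s0(1) by blast
    then have "k = \<one>\<^bsub>H\<^esub>" using gk s0(2) h by (simp add: g0)
    with k show False by simp
  qed
  have slice_u: "slice u \<one>\<^bsub>H\<^esub> \<in> carrier PG.X" using u by simp
  have "u = lift (slice u \<one>\<^bsub>H\<^esub>) \<one>\<^bsub>H\<^esub>"
    using supp by (auto simp: lift_def slice_def fun_eq_iff)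
  then have "p u = p (lift (slice u \<one>\<^bsub>H\<^esub>) \<one>\<^bsub>H\<^esub>)" by simp
  also have "\<dots> \<le> MG (slice u \<one>\<^bsub>H\<^esub>)"
    by (rule PG.max_seminorm_upper_X[OF cstar_seminorm_pullback[OF PG.star_algebra_X lift_one_hom p] slice_u])
  also have "\<dots> = nrm CG.C (\<Phi> u \<one>\<^bsub>H\<^esub>)" unfolding \<Phi>_def by (rule nrm_iota[OF slice_u, symmetric])
  \<comment> \<open>The same element is now computed in the crossed product by H, where it comes
    from a single \<delta>; its coefficient over 1 has as norm the square of the norm of
    \<open>\<iota> f\<close>.\<close>
  also have "\<Phi> u = star PH.X (PH.\<delta> (\<iota> f) h) \<otimes>\<^bsub>PH.X\<^esub> PH.\<delta> (\<iota> f) h"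
    unfolding u_def star_homD(4)[OF Phi_hom T.X_star[OF F] F] star_homD(5)[OF Phi_hom F]
    unfolding F_def Phi_lift ..
  also have "nrm CG.C ((star PH.X (PH.\<delta> (\<iota> f) h) \<otimes>\<^bsub>PH.X\<^esub> PH.\<delta> (\<iota> f) h) \<one>\<^bsub>H\<^esub>) = (nrm CG.C (\<iota> f))\<^sup>2"
    by (rule PH.nrm_inv_delta_sq[OF h iota_J0_J[OF h f]])
  finally show "(p (lift f h))\<^sup>2 \<le> (MG f)\<^sup>2"
    using cstar_seminorm.cstar_identity[OF p F] nrm_iota[OF J0_carrier[OF f]] by (simp add: u_def F_def)
  show "0 \<le> MG f" by (rule CG.S.nonneg[OF J0_carrier[OF f]])
qed

text \<open>The triangle inequality is applied to whole slices over h, each bounded by its norm in A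
  \<rtimes> G. The l1-norm of F itself also bounds p but would be too large: extension by density
  asks for a bound through the image \<open>\<Phi> F\<close>.\<close>

lemma cstar_seminorm_le_ell1_Phi:
  assumes p: "cstar_seminorm T.X p" and F: "F \<in> carrier T.X"
  shows "p F \<le> PH.ell1 (\<Phi> F)"
proof -
  interpret p: seminormed_star_algebra T.X p by (rule T.X.seminormed_of_cstar_seminorm[OF p])
  have sum_bound: "p F \<le> (\<Sum>h\<in>S. nrm CG.C (\<Phi> F h))"
    if "finite S" "S \<subseteq> carrier H" "F \<in> carrier T.X" "snd ` {r. F r \<noteq> \<zero>\<^bsub>A\<^esub>} \<subseteq> S" for S F
    using that
  proof (induction S arbitrary: F rule: finite_induct)
    case empty
    then have "F = \<zero>\<^bsub>T.X\<^esub>" by (auto simp: T.X_ops)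
    then show ?case by simp
  next
    case (insert h S)
    have h: "h \<in> carrier H" and F: "F \<in> carrier T.X" using insert.prems by auto
    define F' where "F' = (\<lambda>(g, k). if k = h then \<zero>\<^bsub>A\<^esub> else F (g, k))"
    have "finite {r. F' r \<noteq> \<zero>\<^bsub>A\<^esub>}"
      by (rule finite_subset[OF _ T.X_finite[OF F]]) (auto simp: F'_def split: if_splits)
    moreover have "F' r \<in> I r" if "r \<in> carrier \<Gamma>" for r
      using T.X_I[OF F that] T.I_closed(1)[OF that] by (cases r) (auto simp: F'_def)
    moreover have "F' r = \<zero>\<^bsub>A\<^esub>" if "r \<notin> carrier \<Gamma>" for r
      using T.X_outside[OF F that] by (cases r) (simp add: F'_def)
    ultimately have F': "F' \<in> carrier T.X" unfolding T.X_carrier by blast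
    have slice: "slice F h \<in> J0 h" by (rule slice_J0[OF F h])
    have eq: "F = F' \<oplus>\<^bsub>T.X\<^esub> lift (slice F h) h"
    proof
      fix r show "F r = (F' \<oplus>\<^bsub>T.X\<^esub> lift (slice F h) h) r"
        using T.X_A[OF F, of r] by (cases r) (auto simp: F'_def lift_def slice_def T.X_ops(2))
    qed
    have "slice F' k = slice F k" if "k \<in> S" for k
      using that insert.hyps(2) by (auto simp: slice_def F'_def fun_eq_iff)
    then have \<Phi>F': "(\<Sum>k\<in>S. nrm CG.C (\<Phi> F' k)) = (\<Sum>k\<in>S. nrm CG.C (\<Phi> F k))"
      by (intro sum.cong) (simp_all add: \<Phi>_def)
    have "k \<in> S" if "F' (g, k) \<noteq> \<zero>\<^bsub>A\<^esub>" for g k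
    proof -
      have "k \<noteq> h" "F (g, k) \<noteq> \<zero>\<^bsub>A\<^esub>" using that by (simp_all add: F'_def split: if_splits)
      moreover from this have "k \<in> insert h S" using insert.prems(3) by force
      ultimately show ?thesis by simp
    qed
    then have "snd ` {r. F' r \<noteq> \<zero>\<^bsub>A\<^esub>} \<subseteq> S" by auto
    then have "p F' \<le> (\<Sum>k\<in>S. nrm CG.C (\<Phi> F k))"
      using insert.IH[OF _ F'] insert.prems(1) \<Phi>F' by simp
    moreover have "p (lift (slice F h) h) \<le> nrm CG.C (\<Phi> F h)"
      using cstar_seminorm_lift_le[OF p h slice] nrm_iota[OF J0_carrier[OF slice]] by (simp add: \<Phi>_def)
    moreover have "p F \<le> p F' + p (lift (slice F h) h)"
      using p.triangle[OF F' lift_X[OF h slice]] eq by simp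
    ultimately show ?case using insert.hyps by simp
  qed
  let ?S = "snd ` {r. F r \<noteq> \<zero>\<^bsub>A\<^esub>}"
  have S: "finite ?S" using T.X_finite[OF F] by simp
  have "?S \<subseteq> carrier H" using T.X_support[OF F] by auto
  then have "p F \<le> (\<Sum>h\<in>?S. nrm CG.C (\<Phi> F h))" by (intro sum_bound S F subset_refl)
  also have "\<dots> = PH.ell1 (\<Phi> F)" by (rule PH.ell1_eq[OF S Phi_support, symmetric])
  finally show ?thesis .
qed

text \<open>A coefficient in J h is by construction a limit of images of elements of
  \<open>J0 h\<close>, and lifting these over h gives the approximants; the finitely many
  coefficients are added up by induction.\<close>

lemma Phi_dense:
  assumes "x \<in> carrier PH.X" "0 < e"
  shows "\<exists>F\<in>carrier T.X. PH.ell1 (x \<ominus>\<^bsub>PH.X\<^esub> \<Phi> F) < e"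
  using assms
proof (induction x arbitrary: e rule: PH.delta_induct)
  case zero
  have "\<Phi> \<zero>\<^bsub>T.X\<^esub> = \<zero>\<^bsub>PH.X\<^esub>"
    by (rule star_hom_zero[OF T.star_algebra_X PH.star_algebra_X Phi_hom])
  then have "PH.ell1 (\<zero>\<^bsub>PH.X\<^esub> \<ominus>\<^bsub>PH.X\<^esub> \<Phi> \<zero>\<^bsub>T.X\<^esub>) = 0"
    using PH.X.diff_self[OF PH.X_zero] seminormed_star_algebra.p_zero[OF PH.seminormed_ell1] by simp
  then show ?case using zero T.X_zero by (intro bexI[of _ "\<zero>\<^bsub>T.X\<^esub>"]) auto
next
  case (delta x h)
  have xC: "x \<in> carrier CG.C" using PH.I_carrier[OF delta(1,2)] .
  obtain f where f: "\<And>n. f n \<in> J0 h" "slim CG.C (nrm CG.C) (\<lambda>n. \<iota> (f n)) x"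
    using delta(2) by (rule J_E) blast
  have "\<forall>\<^sub>F n in sequentially. nrm CG.C (\<iota> (f n) \<ominus>\<^bsub>CG.C\<^esub> x) < e"
    using f(2) delta(3) by (intro order_tendstoD(2)[of _ 0]) (auto simp: slim_def)
  then obtain n where n: "nrm CG.C (\<iota> (f n) \<ominus>\<^bsub>CG.C\<^esub> x) < e" by (auto simp: eventually_sequentially)
  let ?y = "\<iota> (f n)"
  have y: "?y \<in> J h" by (rule iota_J0_J[OF delta(1) f(1)])
  have yC: "?y \<in> carrier CG.C" by (rule iota_carrier[OF J0_carrier[OF f(1)]])
  have "PH.\<delta> x h \<ominus>\<^bsub>PH.X\<^esub> PH.\<delta> ?y h = PH.\<delta> (x \<ominus>\<^bsub>CG.C\<^esub> ?y) h"
    unfolding PH.X.minus_sm[OF PH.delta_closed[OF delta(1,2)] PH.delta_closed[OF delta(1) y]]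
      CG.C.minus_sm[OF xC yC] by (auto simp: PH.X_ops(2,3) fun_eq_iff)
  then have "PH.ell1 (PH.\<delta> x h \<ominus>\<^bsub>PH.X\<^esub> \<Phi> (lift (f n) h)) = nrm CG.C (x \<ominus>\<^bsub>CG.C\<^esub> ?y)"
    unfolding Phi_lift by (simp only: PH.ell1_delta)
  also have "\<dots> < e" using n AG.N.p_diff_comm[OF xC yC] by simp
  finally show ?case using lift_X[OF delta(1) f(1)] by blast
next
  case (add x y)
  interpret N: seminormed_star_algebra PH.X PH.ell1 by (rule PH.seminormed_ell1)
  have "e / 2 > 0" using add.prems by simp
  then obtain F F' where F: "F \<in> carrier T.X" "PH.ell1 (x \<ominus>\<^bsub>PH.X\<^esub> \<Phi> F) < e / 2"
    and F': "F' \<in> carrier T.X" "PH.ell1 (y \<ominus>\<^bsub>PH.X\<^esub> \<Phi> F') < e / 2" using add.IH by blast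
  note P = Phi_X[OF F(1)] Phi_X[OF F'(1)]
  have "(x \<oplus>\<^bsub>PH.X\<^esub> y) \<ominus>\<^bsub>PH.X\<^esub> \<Phi> (F \<oplus>\<^bsub>T.X\<^esub> F') = (x \<ominus>\<^bsub>PH.X\<^esub> \<Phi> F) \<oplus>\<^bsub>PH.X\<^esub> (y \<ominus>\<^bsub>PH.X\<^esub> \<Phi> F')"
    unfolding Phi_add[OF F(1) F'(1)] by (rule PH.X.diff_add) (use add.hyps P in simp_all)
  then have "PH.ell1 ((x \<oplus>\<^bsub>PH.X\<^esub> y) \<ominus>\<^bsub>PH.X\<^esub> \<Phi> (F \<oplus>\<^bsub>T.X\<^esub> F')) < e"
    using N.triangle[OF PH.X.diff_closed[OF add.hyps(1) P(1)] PH.X.diff_closed[OF add.hyps(2) P(2)]] F(2) F'(2)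
    by simp
  then show ?case using T.X_add[OF F(1) F'(1)] by blast
qed

text \<open>Pulling back along \<Phi> gives one inequality. For the other, the extension of p from
  the image of \<Phi> takes part in the supremum on the target.\<close>

lemma max_seminorm_Phi:
  assumes F: "F \<in> carrier T.X"
  shows "max_seminorm PH.X (\<Phi> F) = max_seminorm T.X F"
proof (rule antisym)
  show "max_seminorm PH.X (\<Phi> F) \<le> max_seminorm T.X F"
  proof (rule PH.max_seminorm_least_X)
    fix q assume q: "cstar_seminorm PH.X q"
    show "q (\<Phi> F) \<le> max_seminorm T.X F"
      by (rule T.max_seminorm_upper_X[OF cstar_seminorm_pullback[OF T.star_algebra_X Phi_hom q] F])
  qed
  show "max_seminorm T.X F \<le> max_seminorm PH.X (\<Phi> F)"
  proof (rule T.max_seminorm_least_X)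
    fix p assume p: "cstar_seminorm T.X p"
    show "p F \<le> max_seminorm PH.X (\<Phi> F)"
    proof (rule extend_cstar_seminorm_dense[OF T.star_algebra_X PH.seminormed_ell1 p Phi_hom])
      fix q assume q: "cstar_seminorm PH.X q" "\<And>F. F \<in> carrier T.X \<Longrightarrow> q (\<Phi> F) = p F"
      show "p F \<le> max_seminorm PH.X (\<Phi> F)"
        using PH.max_seminorm_upper_X[OF q(1) Phi_X[OF F]] q(2)[OF F] by simp
    qed (fact Phi_dense cstar_seminorm_le_ell1_Phi[OF p])+
  qed
qed

lemma crossed_product_isomorphism:
  obtains \<phi> where "star_isomorphism (crossed_product A \<Gamma> I \<theta>) (crossed_product CG.C H J \<eta>) \<phi>"
    "\<And>g h a. \<lbrakk>g \<in> carrier G; h \<in> carrier H; a \<in> I (g, h)\<rbrakk> \<Longrightarrow>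
      \<phi> (cp_delta A \<Gamma> I \<theta> a (g, h)) = cp_delta CG.C H J \<eta> (\<iota> (PG.\<delta> a g)) h"
proof -
  have T: "cstar_seminormed T.X (max_seminorm T.X)"
    by (intro cstar_seminormed.intro T.star_algebra_X T.cstar_seminorm_max_X)
  have P: "cstar_seminormed PH.X (max_seminorm PH.X)"
    by (intro cstar_seminormed.intro PH.star_algebra_X PH.cstar_seminorm_max_X)
  \<comment> \<open>Density for the l1-norm implies density for the maximal seminorm, which is the
    smaller of the two.\<close>
  have dense: "\<exists>F\<in>carrier T.X. max_seminorm PH.X (x \<ominus>\<^bsub>PH.X\<^esub> \<Phi> F) < e"
    if x: "x \<in> carrier PH.X" and e: "0 < e" for x e
  proof -
    obtain F where F: "F \<in> carrier T.X" "PH.ell1 (x \<ominus>\<^bsub>PH.X\<^esub> \<Phi> F) < e" using Phi_dense[OF x e] by blast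
    have "max_seminorm PH.X (x \<ominus>\<^bsub>PH.X\<^esub> \<Phi> F) \<le> PH.ell1 (x \<ominus>\<^bsub>PH.X\<^esub> \<Phi> F)"
      by (rule PH.cstar_seminorm_le_ell1[OF PH.cstar_seminorm_max_X PH.X.diff_closed[OF x Phi_X[OF F(1)]]])
    then show ?thesis using F by force
  qed
  show thesis
  proof (rule completion_isomorphism[OF T P Phi_hom])
    fix \<phi> assume iso: "star_isomorphism (completion T.X (max_seminorm T.X)) (completion PH.X (max_seminorm PH.X)) \<phi>"
      and \<phi>: "\<And>F. F \<in> carrier T.X \<Longrightarrow> \<phi> (cauchy_rel T.X (max_seminorm T.X) `` {\<lambda>n. F}) =
        cauchy_rel PH.X (max_seminorm PH.X) `` {\<lambda>n. \<Phi> F}"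
    show thesis
    proof (rule that)
      show "star_isomorphism (crossed_product A \<Gamma> I \<theta>) (crossed_product CG.C H J \<eta>) \<phi>"
        using iso by (simp only: crossed_product_def enveloping_cstar_def)
      fix g h a assume g: "g \<in> carrier G" and h: "h \<in> carrier H" and a: "a \<in> I (g, h)"
      have "T.\<delta> a (g, h) \<in> carrier T.X" by (rule T.delta_closed) (use g h a in simp_all)
      from \<phi>[OF this] show "\<phi> (cp_delta A \<Gamma> I \<theta> a (g, h)) = cp_delta CG.C H J \<eta> (\<iota> (PG.\<delta> a g)) h"
        unfolding Phi_delta cp_delta_def to_enveloping_def .
    qed
  qed (fact max_seminorm_Phi dense)+
qed

end

theorem proposition4p2:
  fixes A :: "'a cstar_alg"
    and G :: "'g monoid" and H :: "'h monoid"
    and \<alpha> :: "'h \<Rightarrow> 'g \<Rightarrow> 'g"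
    and I :: "'g \<times> 'h \<Rightarrow> 'a set" and \<theta> :: "'g \<times> 'h \<Rightarrow> 'a \<Rightarrow> 'a"
  assumes "cstar_algebra A" and "group G" and "group H"
    and "\<alpha> \<in> hom H (AutoGroup G)"
    and "partial_action A (semidirect_product G \<alpha> H) I \<theta>"
    and "\<And>g h. \<lbrakk>g \<in> carrier G; h \<in> carrier H\<rbrakk> \<Longrightarrow>
           I (g, h) \<subseteq> I (g, \<one>\<^bsub>H\<^esub>) \<inter> I (\<one>\<^bsub>G\<^esub>, h)"
  shows "let \<Gamma> = semidirect_product G \<alpha> H;
             I\<^sub>G = (\<lambda>g. I (g, \<one>\<^bsub>H\<^esub>));
             \<theta>\<^sub>G = (\<lambda>g. \<theta> (g, \<one>\<^bsub>H\<^esub>));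
             AG = crossed_product A G I\<^sub>G \<theta>\<^sub>G
         in \<exists>J \<eta>. partial_action AG H J \<eta> \<and>
              (\<exists>\<phi>. star_isomorphism (crossed_product A \<Gamma> I \<theta>) (crossed_product AG H J \<eta>) \<phi> \<and>
                (\<forall>g\<in>carrier G. \<forall>h\<in>carrier H. \<forall>a\<in>I (g, h).
                   cp_delta A G I\<^sub>G \<theta>\<^sub>G a g \<in> J h \<and>
                   \<phi> (cp_delta A \<Gamma> I \<theta> a (g, h)) =
                     cp_delta AG H J \<eta> (cp_delta A G I\<^sub>G \<theta>\<^sub>G a g) h))"
proof -
  interpret S: semidirect_partial_action A G H \<alpha> I \<theta>
    by (intro semidirect_partial_action.intro semidirect_partial_action_axioms.intro assms)
  \<comment> \<open>Unfolding identifies the crossed product by G in the statement with the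
    completion that carries J and \<eta>.\<close>
  have AG: "crossed_product A G (\<lambda>g. I (g, \<one>\<^bsub>H\<^esub>)) (\<lambda>g. \<theta> (g, \<one>\<^bsub>H\<^esub>)) = S.CG.C"
    by (simp only: crossed_product_def enveloping_cstar_def)
  have delta: "cp_delta A G (\<lambda>g. I (g, \<one>\<^bsub>H\<^esub>)) (\<lambda>g. \<theta> (g, \<one>\<^bsub>H\<^esub>)) a g = S.\<iota> (S.PG.\<delta> a g)" for a g
    by (simp only: cp_delta_def to_enveloping_def S.\<iota>_def)
  obtain \<phi> where \<phi>: "star_isomorphism (crossed_product A (semidirect_product G \<alpha> H) I \<theta>)
      (crossed_product S.CG.C H S.J S.\<eta>) \<phi>"
    "\<And>g h a. \<lbrakk>g \<in> carrier G; h \<in> carrier H; a \<in> I (g, h)\<rbrakk> \<Longrightarrow>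
      \<phi> (cp_delta A (semidirect_product G \<alpha> H) I \<theta> a (g, h)) = cp_delta S.CG.C H S.J S.\<eta> (S.\<iota> (S.PG.\<delta> a g)) h"
    using S.crossed_product_isomorphism by blast
  have J: "S.\<iota> (S.PG.\<delta> a g) \<in> S.J h" if "g \<in> carrier G" "h \<in> carrier H" "a \<in> I (g, h)" for a g h
    using that by (intro S.iota_J0_J S.delta_J0)
  show ?thesis
    unfolding Let_def AG delta using S.PH.partial_action_axioms \<phi> J by blast
qed

end
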